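(* Let $M=(N,P)$ be a model of $\mathsf{ZF}_2$ and let $\kappa\in\mathrm{OR}^N$ be such that $M\models$ ``$\kappa$ is super Reinhardt''. Suppose that $N$ and $P$ are countable. Then there is a set $X\in N$ such that $X\subseteq\kappa$ and $X$ has size $\kappa$ in $N$ (i.e. $N\models$ ``$X\subseteq\kappa$ and $|X|=\kappa$''), and such that for each $\mu\in X$ there is a function $j:N\to N$ (not required to belong to $P$) such that $(N,j)\models\mathsf{ZFR}$ and $\mathrm{crit}(j)=\mu$.
   Context: $\mathsf{ZF}_2$ is second-order set theory without choice, regarded as a first-order theory in a two-sorted language (sets and classes). A model is written $M=(N,P)$, where $N$ is the universe of sets with its membership relation $\in^N$ (so $N\models\mathsf{ZF}$; $N$ is not assumed well-founded) and $P$ is the collection of classes, identified with a collection of subsets of $N$. The axioms are those of $\mathsf{ZF}$ for sets, with Separation and Replacement holding for classes (the intersection of a set with a class is a set; the image of a set under a class function is a set), extensionality for classes, and comprehension for classes: for each formula of the two-sorted language, with set and class parameters, the sets satisfying it form a class. The basic example is $(V_\delta,V_{\delta+1})$ for $\delta$ inaccessible. $\mathrm{OR}^N$ denotes the ordinals of $N$. In $\mathsf{ZF}_2$, an elementary embedding $j:V\to V$ is a class function that is elementary with respect to the language of set theory, i.e. from $(V,\in)$ to $(V,\in)$ (for maps $V\to V$ this is expressed by the single statement that $j$ is $\Sigma_1$-elementary). The critical point $\mathrm{crit}(j)$ is the least ordinal $\alpha$ with $j(\alpha)\neq\alpha$. An ordinal $\kappa$ is super Reinhardt iff for every ordinal $\alpha$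 there is a class $j$ which is an elementary embedding $j:V\to V$ with $\mathrm{crit}(j)=\kappa$ and $j(\kappa)\geq\alpha$. Thus ``$M\models\kappa$ is super Reinhardt'' refers to embeddings $j\in P$. $\mathsf{ZFR}$ is the first-order theory in the language $\{=,\in,\tilde{j}\}$ consisting of the $\mathsf{ZF}(\tilde j)$ axioms (the usual $\mathsf{ZF}$ axioms, but with Collection and Separation for all formulas of the language $\{=,\in,\tilde{j}\}$), together with the scheme asserting that $\tilde{j}:V\to V$ is elementary (with respect to formulas in the language $\{=,\in\}$). $(N,j)\models\mathsf{ZFR}$ means that the structure with universe $N$, membership $\in^N$, and $\tilde{j}$ interpreted by $j$ satisfies $\mathsf{ZFR}$; $\mathrm{crit}(j)=\mu$ means $\mu$ is the least ordinal of $N$ moved by $j$. *)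

theory Defs
  imports Main "HOL-Library.FuncSet" "HOL-Library.Countable_Set"
begin

text \<open>
  A structure for set theory is given by a carrier \<open>N\<close> and a relation \<open>E\<close>, where \<open>E x y\<close> means
  that \<open>x\<close> is a member of \<open>y\<close> in the sense of the structure. All quantifiers are bounded by \<open>N\<close>;
  \<open>E\<close> need not be well-founded.
\<close>

subsection \<open>Formulas\<close>

text \<open>
  Formulas with named variables in the language with equality, membership and the symbol for
  an embedding. \<open>FJ i k\<close> is the atomic formula saying that the embedding maps \<open>x\<^sub>i\<close> to \<open>x\<^sub>k\<close>; nested
  terms in the function symbol are expressed by quantifying over the intermediate values.
\<close>

datatype fm =
    FEq nat nat
  | FMem nat nat
  | FJ nat nat
  | FNeg fm
  | FAnd fm fm
  | FAll nat fm

primrec pure_fm :: "fm \<Rightarrow> bool" where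
  "pure_fm (FEq i k) = True"
| "pure_fm (FMem i k) = True"
| "pure_fm (FJ i k) = False"
| "pure_fm (FNeg \<phi>) = pure_fm \<phi>"
| "pure_fm (FAnd \<phi> \<psi>) = (pure_fm \<phi> \<and> pure_fm \<psi>)"
| "pure_fm (FAll n \<phi>) = pure_fm \<phi>"

primrec sat :: "'a set \<Rightarrow> ('a \<Rightarrow> 'a \<Rightarrow> bool) \<Rightarrow> ('a \<Rightarrow> 'a) \<Rightarrow> fm \<Rightarrow> (nat \<Rightarrow> 'a) \<Rightarrow> bool" where
  "sat N E j (FEq i k) v = (v i = v k)"
| "sat N E j (FMem i k) v = E (v i) (v k)"
| "sat N E j (FJ i k) v = (j (v i) = v k)"
| "sat N E j (FNeg \<phi>) v = (\<not> sat N E j \<phi> v)"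
| "sat N E j (FAnd \<phi> \<psi>) v = (sat N E j \<phi> v \<and> sat N E j \<psi> v)"
| "sat N E j (FAll n \<phi>) v = (\<forall>x\<in>N. sat N E j \<phi> (v(n := x)))"

lemma sat_pure_indep: "pure_fm \<phi> \<Longrightarrow> sat N E j \<phi> v \<longleftrightarrow> sat N E j' \<phi> v"
  by (induction \<phi> arbitrary: v) auto

text \<open>
  Formulas of the two-sorted language: set variables and class variables are numbered
  independently, \<open>CIn i k\<close> says that set \<open>x\<^sub>i\<close> belongs to class \<open>X\<^sub>k\<close>, and \<open>CAllS\<close>, \<open>CAllC\<close>
  quantify over sets and classes.
\<close>

datatype fm2 =
    CEqS nat nat
  | CMem nat nat
  | CEqC nat nat
  | CIn nat nat
  | CNeg fm2
  | CAnd fm2 fm2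
  | CAllS nat fm2
  | CAllC nat fm2

primrec sat2 :: "'a set \<Rightarrow> ('a \<Rightarrow> 'a \<Rightarrow> bool) \<Rightarrow> 'a set set \<Rightarrow> fm2 \<Rightarrow>
    (nat \<Rightarrow> 'a) \<Rightarrow> (nat \<Rightarrow> 'a set) \<Rightarrow> bool" where
  "sat2 N E P (CEqS i k) v w = (v i = v k)"
| "sat2 N E P (CMem i k) v w = E (v i) (v k)"
| "sat2 N E P (CEqC i k) v w = (w i = w k)"
| "sat2 N E P (CIn i k) v w = (v i \<in> w k)"
| "sat2 N E P (CNeg \<phi>) v w = (\<not> sat2 N E P \<phi> v w)"
| "sat2 N E P (CAnd \<phi> \<psi>) v w = (sat2 N E P \<phi> v w \<and> sat2 N E P \<psi> v w)"
| "sat2 N E P (CAllS n \<phi>) v w = (\<forall>x\<in>N. sat2 N E P \<phi> (v(n := x)) w)"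
| "sat2 N E P (CAllC n \<phi>) v w = (\<forall>X\<in>P. sat2 N E P \<phi> v (w(n := X)))"

subsection \<open>Set-theoretic notions inside a structure\<close>

definition sub_in :: "'a set \<Rightarrow> ('a \<Rightarrow> 'a \<Rightarrow> bool) \<Rightarrow> 'a \<Rightarrow> 'a \<Rightarrow> bool" where
  "sub_in N E x y \<longleftrightarrow> (\<forall>z\<in>N. E z x \<longrightarrow> E z y)"

definition upair_in :: "'a set \<Rightarrow> ('a \<Rightarrow> 'a \<Rightarrow> bool) \<Rightarrow> 'a \<Rightarrow> 'a \<Rightarrow> 'a \<Rightarrow> bool" where
  "upair_in N E p x y \<longleftrightarrow> (\<forall>z\<in>N. E z p \<longleftrightarrow> z = x \<or> z = y)"

text \<open>\<open>p\<close> is the Kuratowski pair of \<open>x\<close> and \<open>y\<close>.\<close>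

definition opair_in :: "'a set \<Rightarrow> ('a \<Rightarrow> 'a \<Rightarrow> bool) \<Rightarrow> 'a \<Rightarrow> 'a \<Rightarrow> 'a \<Rightarrow> bool" where
  "opair_in N E p x y \<longleftrightarrow>
     (\<exists>s\<in>N. \<exists>t\<in>N. upair_in N E s x x \<and> upair_in N E t x y \<and> upair_in N E p s t)"

text \<open>In the presence of Foundation, a transitive set linearly ordered by membership is an ordinal.\<close>

definition ord_in :: "'a set \<Rightarrow> ('a \<Rightarrow> 'a \<Rightarrow> bool) \<Rightarrow> 'a \<Rightarrow> bool" where
  "ord_in N E a \<longleftrightarrow> a \<in> N \<and>
     (\<forall>x\<in>N. E x a \<longrightarrow> sub_in N E x a) \<and>
     (\<forall>x\<in>N. \<forall>y\<in>N. E x a \<and> E y a \<longrightarrow> E x y \<or> x = y \<or> E y x)"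

definition ord_le :: "('a \<Rightarrow> 'a \<Rightarrow> bool) \<Rightarrow> 'a \<Rightarrow> 'a \<Rightarrow> bool" where
  "ord_le E a b \<longleftrightarrow> E a b \<or> a = b"

definition bij_in :: "'a set \<Rightarrow> ('a \<Rightarrow> 'a \<Rightarrow> bool) \<Rightarrow> 'a \<Rightarrow> 'a \<Rightarrow> 'a \<Rightarrow> bool" where
  "bij_in N E f A B \<longleftrightarrow>
     (\<forall>p\<in>N. E p f \<longrightarrow> (\<exists>x\<in>N. \<exists>y\<in>N. E x A \<and> E y B \<and> opair_in N E p x y)) \<and>
     (\<forall>x\<in>N. E x A \<longrightarrow> (\<exists>!y. y \<in> N \<and> (\<exists>p\<in>N. E p f \<and> opair_in N E p x y))) \<and>
     (\<forall>y\<in>N. E y B \<longrightarrow> (\<exists>!x. x \<in> N \<and> (\<exists>p\<in>N. E p f \<and> opair_in N E p x y)))"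

definition equipotent_in :: "'a set \<Rightarrow> ('a \<Rightarrow> 'a \<Rightarrow> bool) \<Rightarrow> 'a \<Rightarrow> 'a \<Rightarrow> bool" where
  "equipotent_in N E A B \<longleftrightarrow> (\<exists>f\<in>N. bij_in N E f A B)"

subsection \<open>Axioms\<close>

text \<open>
  The single axioms of ZF: Extensionality, Foundation, Pairing, Union, Power Set, Infinity.
\<close>

definition zf_base :: "'a set \<Rightarrow> ('a \<Rightarrow> 'a \<Rightarrow> bool) \<Rightarrow> bool" where
  "zf_base N E \<longleftrightarrow>
     N \<noteq> {} \<and>
     (\<forall>x\<in>N. \<forall>y\<in>N. (\<forall>z\<in>N. E z x \<longleftrightarrow> E z y) \<longrightarrow> x = y) \<and>
     (\<forall>x\<in>N. (\<exists>y\<in>N. E y x) \<longrightarrow> (\<exists>y\<in>N. E y x \<and> \<not> (\<exists>z\<in>N. E z y \<and> E z x))) \<and>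
     (\<forall>x\<in>N. \<forall>y\<in>N. \<exists>p\<in>N. upair_in N E p x y) \<and>
     (\<forall>x\<in>N. \<exists>u\<in>N. \<forall>z\<in>N. E z u \<longleftrightarrow> (\<exists>y\<in>N. E y x \<and> E z y)) \<and>
     (\<forall>x\<in>N. \<exists>q\<in>N. \<forall>z\<in>N. E z q \<longleftrightarrow> sub_in N E z x) \<and>
     (\<exists>x\<in>N. (\<exists>e\<in>N. E e x \<and> (\<forall>z\<in>N. \<not> E z e)) \<and>
            (\<forall>y\<in>N. E y x \<longrightarrow> (\<exists>s\<in>N. E s x \<and> (\<forall>z\<in>N. E z s \<longleftrightarrow> E z y \<or> z = y))))"

text \<open>
  Models \<open>(N, P)\<close> of second-order set theory. Extensionality for classes is built into the
  representation of classes as subsets of \<open>N\<close>. The last three conjuncts are Separation and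
  Replacement for classes, and Comprehension for arbitrary two-sorted formulas.
\<close>

definition ZF2_model :: "'a set \<Rightarrow> ('a \<Rightarrow> 'a \<Rightarrow> bool) \<Rightarrow> 'a set set \<Rightarrow> bool" where
  "ZF2_model N E P \<longleftrightarrow>
     zf_base N E \<and> P \<noteq> {} \<and> P \<subseteq> Pow N \<and>
     (\<forall>C\<in>P. \<forall>a\<in>N. \<exists>b\<in>N. \<forall>x\<in>N. E x b \<longleftrightarrow> E x a \<and> x \<in> C) \<and>
     (\<forall>F\<in>P.
        (\<forall>x\<in>N. \<forall>y\<in>N. \<forall>z\<in>N. \<forall>p\<in>F. \<forall>q\<in>F.
           opair_in N E p x y \<and> opair_in N E q x z \<longrightarrow> y = z) \<longrightarrow>
        (\<forall>a\<in>N. \<exists>b\<in>N. \<forall>y\<in>N. E y b \<longleftrightarrow> (\<exists>x\<in>N. E x a \<and> (\<exists>p\<in>F. opair_in N E p x y)))) \<and>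
     (\<forall>\<phi> v w. range v \<subseteq> N \<and> range w \<subseteq> P \<longrightarrow> {x \<in> N. sat2 N E P \<phi> (v(0 := x)) w} \<in> P)"

text \<open>Separation and Collection for all formulas that may mention the embedding.\<close>

definition ZFj_model :: "'a set \<Rightarrow> ('a \<Rightarrow> 'a \<Rightarrow> bool) \<Rightarrow> ('a \<Rightarrow> 'a) \<Rightarrow> bool" where
  "ZFj_model N E j \<longleftrightarrow>
     zf_base N E \<and>
     (\<forall>\<phi> v. range v \<subseteq> N \<longrightarrow>
        (\<forall>a\<in>N. \<exists>b\<in>N. \<forall>x\<in>N. E x b \<longleftrightarrow> E x a \<and> sat N E j \<phi> (v(0 := x)))) \<and>
     (\<forall>\<phi> v. range v \<subseteq> N \<longrightarrow>
        (\<forall>a\<in>N. (\<forall>x\<in>N. E x a \<longrightarrow> (\<exists>y\<in>N. sat N E j \<phi> (v(0 := x, 1 := y)))) \<longrightarrow>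
           (\<exists>b\<in>N. \<forall>x\<in>N. E x a \<longrightarrow> (\<exists>y\<in>N. E y b \<and> sat N E j \<phi> (v(0 := x, 1 := y))))))"

subsection \<open>Embeddings\<close>

text \<open>
  Only formulas in equality and membership are tested, so by \<open>sat_pure_indep\<close> the third
  argument of \<open>sat\<close> plays no role here.
\<close>

definition elementary_emb :: "'a set \<Rightarrow> ('a \<Rightarrow> 'a \<Rightarrow> bool) \<Rightarrow> ('a \<Rightarrow> 'a) \<Rightarrow> bool" where
  "elementary_emb N E j \<longleftrightarrow> j \<in> N \<rightarrow> N \<and>
     (\<forall>\<phi> v. pure_fm \<phi> \<and> range v \<subseteq> N \<longrightarrow> (sat N E j \<phi> v \<longleftrightarrow> sat N E j \<phi> (j \<circ> v)))"

definition is_crit :: "'a set \<Rightarrow> ('a \<Rightarrow> 'a \<Rightarrow> bool) \<Rightarrow> ('a \<Rightarrow> 'a) \<Rightarrow> 'a \<Rightarrow> bool" where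
  "is_crit N E j \<mu> \<longleftrightarrow> ord_in N E \<mu> \<and> j \<mu> \<noteq> \<mu> \<and>
     (\<forall>\<alpha>. ord_in N E \<alpha> \<and> j \<alpha> \<noteq> \<alpha> \<longrightarrow> ord_le E \<mu> \<alpha>)"

definition ZFR_model :: "'a set \<Rightarrow> ('a \<Rightarrow> 'a \<Rightarrow> bool) \<Rightarrow> ('a \<Rightarrow> 'a) \<Rightarrow> bool" where
  "ZFR_model N E j \<longleftrightarrow> ZFj_model N E j \<and> elementary_emb N E j"

text \<open>The class of ordered pairs in the sense of \<open>N\<close> that encodes a map from \<open>N\<close> to \<open>N\<close>.\<close>

definition graph_in :: "'a set \<Rightarrow> ('a \<Rightarrow> 'a \<Rightarrow> bool) \<Rightarrow> ('a \<Rightarrow> 'a) \<Rightarrow> 'a set" where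
  "graph_in N E j = {p \<in> N. \<exists>x\<in>N. opair_in N E p x (j x)}"

definition super_Reinhardt ::
    "'a set \<Rightarrow> ('a \<Rightarrow> 'a \<Rightarrow> bool) \<Rightarrow> 'a set set \<Rightarrow> 'a \<Rightarrow> bool" where
  "super_Reinhardt N E P \<kappa> \<longleftrightarrow> ord_in N E \<kappa> \<and>
     (\<forall>\<alpha>. ord_in N E \<alpha> \<longrightarrow>
        (\<exists>j \<in> N \<rightarrow> N. graph_in N E j \<in> P \<and> elementary_emb N E j \<and>
                    is_crit N E j \<kappa> \<and> ord_le E \<alpha> (j \<kappa>)))"

end

theory Submission
  imports Defs
begin

text \<open>
  Fix a class \<open>j\<close> of the model that is an embedding with critical point \<open>\<kappa>\<close> and \<open>\<kappa> \<in> j \<kappa>\<close>. The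
  structure \<open>(N, j)\<close> satisfies ZFR because \<open>j\<close> is a class (\<open>ZFR_class\<close>), and ZFR amounts to the
  validity of a collection of formulas (\<open>ZFR_model_iff_valid\<close>). So it is enough to find, for \<open>\<kappa>\<close> many
  \<open>\<mu> < \<kappa>\<close>, a map \<open>k\<close> with critical point \<open>\<mu>\<close> such that every formula valid in \<open>(N, j)\<close> is valid in \<open>(N, k)\<close>.

  Such a \<open>k\<close> is built outside the model, as the union of a chain of sets that approximate it. To have the
  limit satisfy the right formulas, the approximations carry truth values as well: \<open>truth\<close> is a class
  of pairs of a code of a formula in negation normal form and an assignment, together with the facts
  \<open>j x = y\<close>. That a class is a truth class of some embedding with critical point \<open>\<mu>\<close> is a
  \<open>\<forall>\<exists>\<close> condition, with universal part \<open>coh\<close> and existential part \<open>wit\<close>, and such conditions survive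
  unions of chains when every step provides the witnesses demanded by the previous one. This defines a game on
  positions \<open>\<langle>\<mu>, u, x\<rangle>\<close>, where \<open>x\<close> is the approximation restricted to the set \<open>u\<close>: given a challenge \<open>b\<close>,
  answer with an extension \<open>\<langle>\<mu>, u', x'\<rangle>\<close> such that \<open>u \<union> b \<subseteq> u'\<close> (\<open>extends\<close>). The set of codes valid
  in \<open>(N, j)\<close> is a parameter of the game, and \<open>j\<close> fixes it. Call a position lost if it belongs to the least
  class that contains every position with a challenge all of whose answers are in the class. As \<open>N\<close> is
  countable, a position that is not lost starts a run that answers challenges covering \<open>N\<close>, and its
  union is the wanted \<open>k\<close> (\<open>branch_embedding\<close>).

  It remains to see that the set \<open>Y\<close> of those \<open>\<mu> < \<kappa>\<close> whose initial position \<open>\<langle>\<mu>, 0, 0\<rangle>\<close> is not lost has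
  size \<open>\<kappa>\<close>. Let \<open>L\<close> be the class of lost positions. The initial segments of the truth class of \<open>j\<close> itself
  answer all challenges, so they form a self-sustaining class of positions with first entry \<open>\<kappa>\<close>. The
  embedding acts on classes, and the point is that a self-sustaining class is disjoint from the image of
  \<open>L\<close>, not only from \<open>L\<close> (\<open>self_sustaining_not_lost\<close>). For this, losing must be witnessed in a first-order way:
  \<open>lost_ranked\<close> produces a class relation that is well-founded on sets and that decreases along all
  answers to a suitable challenge; these properties pass to the images under \<open>j\<close>. Now all initial positions with
  \<open>\<mu> \<in> \<kappa> - Y\<close> are in \<open>L\<close>, hence all those with \<open>\<mu> \<in> j \<kappa> - j Y\<close> are in the image of \<open>L\<close>. The initial
  position of \<open>\<kappa>\<close> is not, and so \<open>\<kappa> \<in> j Y\<close>. By elementarity this makes the transitive collapse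
  of \<open>Y\<close> equal to \<open>\<kappa>\<close> (\<open>equipotent_\<kappa>\<close>).

  Choice is not among the axioms. So Collection is derived from a cumulative hierarchy (\<open>lev\<close>), the
  well-founded relation on \<open>L\<close> comes from comparing stages of the inductive definition of \<open>L\<close>, and a failure of
  well-foundedness for classes is reflected to a set (\<open>successor_closed_set_ex\<close>).
\<close>

section \<open>Substitution in formulas\<close>

primrec fm2_bound :: "fm2 \<Rightarrow> nat" where
  "fm2_bound (CEqS i k) = Suc (max i k)"
| "fm2_bound (CMem i k) = Suc (max i k)"
| "fm2_bound (CEqC i k) = Suc (max i k)"
| "fm2_bound (CIn i k) = Suc (max i k)"
| "fm2_bound (CNeg \<phi>) = fm2_bound \<phi>"
| "fm2_bound (CAnd \<phi> \<psi>) = max (fm2_bound \<phi>) (fm2_bound \<psi>)"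
| "fm2_bound (CAllS n \<phi>) = max n (fm2_bound \<phi>)"
| "fm2_bound (CAllC n \<phi>) = max n (fm2_bound \<phi>)"

text \<open>
  The two-sorted formulas that mention no classes; they are the ones that elementarity applies to.
\<close>

primrec set_fm2 :: "fm2 \<Rightarrow> bool" where
  "set_fm2 (CEqS i k) = True"
| "set_fm2 (CMem i k) = True"
| "set_fm2 (CEqC i k) = False"
| "set_fm2 (CIn i k) = False"
| "set_fm2 (CNeg \<phi>) = set_fm2 \<phi>"
| "set_fm2 (CAnd \<phi> \<psi>) = (set_fm2 \<phi> \<and> set_fm2 \<psi>)"
| "set_fm2 (CAllS n \<phi>) = set_fm2 \<phi>"
| "set_fm2 (CAllC n \<phi>) = False"

primrec fm_of :: "fm2 \<Rightarrow> fm" where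
  "fm_of (CEqS i k) = FEq i k"
| "fm_of (CMem i k) = FMem i k"
| "fm_of (CEqC i k) = FEq 0 0"
| "fm_of (CIn i k) = FEq 0 0"
| "fm_of (CNeg \<phi>) = FNeg (fm_of \<phi>)"
| "fm_of (CAnd \<phi> \<psi>) = FAnd (fm_of \<phi>) (fm_of \<psi>)"
| "fm_of (CAllS n \<phi>) = FAll n (fm_of \<phi>)"
| "fm_of (CAllC n \<phi>) = FEq 0 0"

lemma fm_of_pure: "set_fm2 \<phi> \<Longrightarrow> pure_fm (fm_of \<phi>)"
  by (induction \<phi>) auto

lemma sat_fm_of: "set_fm2 \<phi> \<Longrightarrow> sat N E j (fm_of \<phi>) v \<longleftrightarrow> sat2 N E P \<phi> v w"
  by (induction \<phi> arbitrary: v) auto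

lemma sat2_cong:
  "\<forall>i<fm2_bound \<phi>. v i = v' i \<and> w i = w' i \<Longrightarrow> sat2 N E P \<phi> v w \<longleftrightarrow> sat2 N E P \<phi> v' w'"
proof (induction \<phi> arbitrary: v v' w w')
  case (CAnd \<phi> \<psi>)
  have "sat2 N E P \<phi> v w \<longleftrightarrow> sat2 N E P \<phi> v' w'" by (rule CAnd.IH(1)) (simp add: CAnd.prems)
  moreover have "sat2 N E P \<psi> v w \<longleftrightarrow> sat2 N E P \<psi> v' w'" by (rule CAnd.IH(2)) (simp add: CAnd.prems)
  ultimately show ?case by simp
next
  case (CNeg \<phi>)
  have "sat2 N E P \<phi> v w \<longleftrightarrow> sat2 N E P \<phi> v' w'" by (rule CNeg.IH) (use CNeg.prems in simp)
  then show ?case by simp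
next
  case (CAllS n \<phi>)
  have "sat2 N E P \<phi> (v(n := x)) w \<longleftrightarrow> sat2 N E P \<phi> (v'(n := x)) w'" for x
    by (rule CAllS.IH) (simp add: CAllS.prems)
  then show ?case by simp
next
  case (CAllC n \<phi>)
  have "sat2 N E P \<phi> v (w(n := x)) \<longleftrightarrow> sat2 N E P \<phi> v' (w'(n := x))" for x
    by (rule CAllC.IH) (simp add: CAllC.prems)
  then show ?case by simp
qed (simp_all add: less_Suc_eq_le)

lemma fresh_nat:
  fixes k :: nat and f :: "nat \<Rightarrow> nat"
  shows "\<exists>m. \<forall>i<k. f i < m"
proof (induction k)
  case (Suc k)
  then obtain m where "\<forall>i<k. f i < m" by blast
  then have "\<forall>i<Suc k. f i < max m (Suc (f k))" by (auto simp: less_Suc_eq)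
  then show ?case by blast
qed simp

text \<open>
  Variables can be replaced along arbitrary maps, injective or not: a bound variable is first moved to an
  index that no relevant free variable is mapped to.
\<close>

lemma sat2_subst:
  "\<exists>\<phi>'. (set_fm2 \<phi> \<longrightarrow> set_fm2 \<phi>') \<and>
     (\<forall>v w. sat2 N E P \<phi>' v w \<longleftrightarrow> sat2 N E P \<phi> (v \<circ> f) (w \<circ> g))"
proof (induction \<phi> arbitrary: f g)
  case (CEqS i k) show ?case by (rule exI[of _ "CEqS (f i) (f k)"]) simp
next
  case (CMem i k) show ?case by (rule exI[of _ "CMem (f i) (f k)"]) simp
next
  case (CEqC i k) show ?case by (rule exI[of _ "CEqC (g i) (g k)"]) simp
next
  case (CIn i k) show ?case by (rule exI[of _ "CIn (f i) (g k)"]) simp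
next
  case (CNeg \<phi>)
  from CNeg[of f g] obtain \<phi>' where "(set_fm2 \<phi> \<longrightarrow> set_fm2 \<phi>') \<and>
     (\<forall>v w. sat2 N E P \<phi>' v w \<longleftrightarrow> sat2 N E P \<phi> (v \<circ> f) (w \<circ> g))" by blast
  then show ?case by (intro exI[of _ "CNeg \<phi>'"]) (simp add: comp_def)
next
  case (CAnd \<phi> \<psi>)
  from CAnd.IH(1)[of f g] CAnd.IH(2)[of f g] obtain \<phi>' \<psi>' where
    "(set_fm2 \<phi> \<longrightarrow> set_fm2 \<phi>') \<and> (\<forall>v w. sat2 N E P \<phi>' v w \<longleftrightarrow> sat2 N E P \<phi> (v \<circ> f) (w \<circ> g))"
    "(set_fm2 \<psi> \<longrightarrow> set_fm2 \<psi>') \<and> (\<forall>v w. sat2 N E P \<psi>' v w \<longleftrightarrow> sat2 N E P \<psi> (v \<circ> f) (w \<circ> g))"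
    by blast
  then show ?case by (intro exI[of _ "CAnd \<phi>' \<psi>'"]) (simp add: comp_def)
next
  case (CAllS n \<phi>)
  obtain m where m: "\<forall>i<fm2_bound \<phi>. f i < m" using fresh_nat by blast
  from CAllS[of "f(n := m)" g] obtain \<phi>' where 1: "set_fm2 \<phi> \<longrightarrow> set_fm2 \<phi>'"
    "\<And>v w. sat2 N E P \<phi>' v w \<longleftrightarrow> sat2 N E P \<phi> (v \<circ> f(n := m)) (w \<circ> g)" by blast
  have "sat2 N E P \<phi> (v(m := x) \<circ> f(n := m)) (w \<circ> g) \<longleftrightarrow> sat2 N E P \<phi> ((v \<circ> f)(n := x)) (w \<circ> g)"
    for v x w by (rule sat2_cong) (use m in auto)
  with 1 show ?case by (intro exI[of _ "CAllS m \<phi>'"]) (simp add: comp_def)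
next
  case (CAllC n \<phi>)
  obtain m where m: "\<forall>i<fm2_bound \<phi>. g i < m" using fresh_nat by blast
  from CAllC[of f "g(n := m)"] obtain \<phi>' where 1:
    "\<And>v w. sat2 N E P \<phi>' v w \<longleftrightarrow> sat2 N E P \<phi> (v \<circ> f) (w \<circ> g(n := m))" by blast
  have "sat2 N E P \<phi> (v \<circ> f) (w(m := x) \<circ> g(n := m)) \<longleftrightarrow> sat2 N E P \<phi> (v \<circ> f) ((w \<circ> g)(n := x))"
    for v x w by (rule sat2_cong) (use m in auto)
  with 1 show ?case by (intro exI[of _ "CAllC m \<phi>'"]) (simp add: comp_def)
qed

text \<open>
  Even variables are reserved for arguments, odd ones for parameters.
\<close>

definition mix :: "(nat \<Rightarrow> 'b) \<Rightarrow> (nat \<Rightarrow> 'b) \<Rightarrow> nat \<Rightarrow> 'b" where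
  "mix v p i = (if even i then v (i div 2) else p (i div 2))"

lemma mix_range: "range v \<subseteq> A \<Longrightarrow> range p \<subseteq> A \<Longrightarrow> range (mix v p) \<subseteq> A"
  by (auto simp: mix_def)

lemma mix_simps [simp]: "mix v p (2 * i) = v i" "mix v p (Suc (2 * i)) = p i"
  by (auto simp: mix_def)

text \<open>
  The substitution that turns variable \<open>0\<close> into the fresh argument \<open>m\<close> and shifts the other arguments down,
  as needed when variable \<open>0\<close> is about to be bound.
\<close>

definition bind_index :: "nat \<Rightarrow> nat \<Rightarrow> nat" where
  "bind_index m i = (if i = 0 then 2 * m else if even i then i - 2 else i)"

lemma mix_bind_index:
  "i < m \<Longrightarrow> ((mix v p)(2 * m := x) \<circ> bind_index m) i = mix (case_nat x v) p i"
proof (cases "i = 0 \<or> odd i")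
  case False
  then obtain k where "i = 2 * Suc k" by (metis evenE not0_implies_Suc mult_0_right)
  then show "i < m \<Longrightarrow> ?thesis" by (auto simp: bind_index_def mix_def)
qed (auto simp: bind_index_def mix_def)

section \<open>Definable predicates\<close>

locale zf2 =
  fixes N :: "'a set" and E :: "'a \<Rightarrow> 'a \<Rightarrow> bool" and P :: "'a set set"
  assumes zf2: "ZF2_model N E P"
begin

lemma zf: "zf_base N E" using zf2 by (simp add: ZF2_model_def)

lemma P_nonempty: "P \<noteq> {}" and P_sub: "C \<in> P \<Longrightarrow> C \<subseteq> N"
  using zf2 by (auto simp: ZF2_model_def)

lemma extensionality:
  "x \<in> N \<Longrightarrow> y \<in> N \<Longrightarrow> (\<And>z. z \<in> N \<Longrightarrow> E z x \<longleftrightarrow> E z y) \<Longrightarrow> x = y"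
  and set_foundation:
  "x \<in> N \<Longrightarrow> y \<in> N \<Longrightarrow> E y x \<Longrightarrow> \<exists>m\<in>N. E m x \<and> \<not> (\<exists>z\<in>N. E z m \<and> E z x)"
  and pairing: "x \<in> N \<Longrightarrow> y \<in> N \<Longrightarrow> \<exists>p\<in>N. upair_in N E p x y"
  and union: "x \<in> N \<Longrightarrow> \<exists>u\<in>N. \<forall>z\<in>N. E z u \<longleftrightarrow> (\<exists>y\<in>N. E y x \<and> E z y)"
  and power_set: "x \<in> N \<Longrightarrow> \<exists>q\<in>N. \<forall>z\<in>N. E z q \<longleftrightarrow> sub_in N E z x"
  and infinity: "\<exists>x\<in>N. (\<exists>e\<in>N. E e x \<and> (\<forall>z\<in>N. \<not> E z e)) \<and>
            (\<forall>y\<in>N. E y x \<longrightarrow> (\<exists>s\<in>N. E s x \<and> (\<forall>z\<in>N. E z s \<longleftrightarrow> E z y \<or> z = y)))"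
proof -
  note * = zf[unfolded zf_base_def]
  show "x \<in> N \<Longrightarrow> y \<in> N \<Longrightarrow> (\<And>z. z \<in> N \<Longrightarrow> E z x \<longleftrightarrow> E z y) \<Longrightarrow> x = y"
    using conjunct1[OF conjunct2[OF *]] by simp
  show "x \<in> N \<Longrightarrow> y \<in> N \<Longrightarrow> E y x \<Longrightarrow> \<exists>m\<in>N. E m x \<and> \<not> (\<exists>z\<in>N. E z m \<and> E z x)"
    using conjunct1[OF conjunct2[OF conjunct2[OF *]]] by blast
qed (use zf in \<open>simp_all add: zf_base_def\<close>)

text \<open>
  Only used for \<open>Q\<close> whose extension is a set of the model.
\<close>

definition the_set :: "('a \<Rightarrow> bool) \<Rightarrow> 'a" where
  "the_set Q = (THE b. b \<in> N \<and> (\<forall>z\<in>N. E z b \<longleftrightarrow> Q z))"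

lemma the_set:
  assumes "\<exists>b\<in>N. \<forall>z\<in>N. E z b \<longleftrightarrow> Q z"
  shows "the_set Q \<in> N" and "z \<in> N \<Longrightarrow> E z (the_set Q) \<longleftrightarrow> Q z"
proof -
  obtain b where b: "b \<in> N" "\<forall>z\<in>N. E z b \<longleftrightarrow> Q z" using assms by blast
  have "the_set Q = b" unfolding the_set_def
  proof (rule the_equality)
    show "c = b" if "c \<in> N \<and> (\<forall>z\<in>N. E z c \<longleftrightarrow> Q z)" for c
      by (rule extensionality) (use b that in simp_all)
  qed (use b in simp)
  with b show "the_set Q \<in> N" "z \<in> N \<Longrightarrow> E z (the_set Q) \<longleftrightarrow> Q z" by auto
qed

definition emp :: 'a where "emp = the_set (\<lambda>z. False)"

lemma emp_ex: "\<exists>b\<in>N. \<forall>z\<in>N. E z b \<longleftrightarrow> False"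
proof -
  from infinity obtain x e where "x \<in> N" "e \<in> N" "\<forall>z\<in>N. \<not> E z e" by (elim bexE conjE) (rule that)
  then show ?thesis by auto
qed

lemma emp_in [simp]: "emp \<in> N" and emp_mem [simp]: "z \<in> N \<Longrightarrow> \<not> E z emp"
  using the_set[OF emp_ex] by (auto simp: emp_def)

text \<open>
  The parameters allowed in a definition. In the pure case only the empty set remains, which every
  embedding fixes.
\<close>

definition cst :: "bool \<Rightarrow> 'a set" where
  "cst b = (if b then {emp} else N)"

type_synonym 'b pred = "(nat \<Rightarrow> 'b) \<Rightarrow> (nat \<Rightarrow> 'b set) \<Rightarrow> bool"

definition defines_by :: "bool \<Rightarrow> fm2 \<Rightarrow> (nat \<Rightarrow> 'a) \<Rightarrow> (nat \<Rightarrow> 'a set) \<Rightarrow> 'a pred \<Rightarrow> bool" where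
  "defines_by b \<phi> p q Q \<longleftrightarrow> (b \<longrightarrow> set_fm2 \<phi>) \<and> range p \<subseteq> cst b \<and> range q \<subseteq> P \<and>
     (\<forall>v w. range v \<subseteq> N \<longrightarrow> range w \<subseteq> P \<longrightarrow>
        (Q v w \<longleftrightarrow> sat2 N E P \<phi> (mix v p) (mix w q)))"

text \<open>
  \<open>dfn False\<close> means definable over \<open>(N, P)\<close> with set and class parameters, \<open>dfn True\<close> means definable
  over \<open>N\<close> in the language of membership without parameters. Predicates take environments, and
  a quantifier is introduced by abstracting variable \<open>0\<close> while the other variables move up by one. In this form
  the closure properties below are syntax-directed rules, and definability of a concrete predicate is
  proved by applying them repeatedly.
\<close>

definition dfn :: "bool \<Rightarrow> 'a pred \<Rightarrow> bool" where
  "dfn b Q \<longleftrightarrow> (\<exists>\<phi> p q. defines_by b \<phi> p q Q)"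

named_theorems dfn_intros

lemma emp_cst [simp]: "emp \<in> cst b" by (simp add: cst_def)

lemma cst_sub: "cst b \<subseteq> N" by (simp add: cst_def)

lemma dfnI:
  assumes "b \<longrightarrow> set_fm2 \<phi>" "range p \<subseteq> cst b" "range q \<subseteq> P"
    "\<And>v w. range v \<subseteq> N \<Longrightarrow> range w \<subseteq> P \<Longrightarrow> Q v w \<longleftrightarrow> sat2 N E P \<phi> (mix v p) (mix w q)"
  shows "dfn b Q"
  unfolding dfn_def defines_by_def
  by (intro exI[of _ \<phi>] exI[of _ p] exI[of _ q] conjI allI impI assms(2,3)) (simp_all add: assms(1,4))

lemma dfnE:
  assumes "dfn b Q"
  obtains \<phi> p q where "defines_by b \<phi> p q Q"
  using assms unfolding dfn_def by (elim exE) (rule that)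

lemma defines_byD:
  assumes "defines_by b \<phi> p q Q"
  shows "b \<longrightarrow> set_fm2 \<phi>" "range p \<subseteq> cst b" "range q \<subseteq> P"
    "\<And>v w. range v \<subseteq> N \<Longrightarrow> range w \<subseteq> P \<Longrightarrow> Q v w \<longleftrightarrow> sat2 N E P \<phi> (mix v p) (mix w q)"
  using assms unfolding defines_by_def by simp_all

lemma dfn_cong:
  assumes "dfn b Q'" "\<And>v w. range v \<subseteq> N \<Longrightarrow> range w \<subseteq> P \<Longrightarrow> Q v w \<longleftrightarrow> Q' v w"
  shows "dfn b Q"
proof -
  obtain \<phi> p q where "defines_by b \<phi> p q Q'" using assms(1) by (rule dfnE)
  note 1 = defines_byD[OF this]
  show ?thesis by (rule dfnI[OF 1(1-3)]) (simp add: assms(2) 1(4))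
qed

definition some_class :: "'a set" where "some_class = (SOME C. C \<in> P)"

lemma some_class [simp]: "some_class \<in> P"
  using P_nonempty unfolding some_class_def by (simp add: some_in_eq)

text \<open>A reindexing of the variables is a substitution, so no binder can be captured.\<close>

lemma dfn_reindex:
  assumes "dfn b Q"
  shows "dfn b (\<lambda>v w. Q (\<lambda>i. v (f i)) (\<lambda>i. w (g i)))"
proof -
  obtain \<phi> p q where "defines_by b \<phi> p q Q" using assms by (rule dfnE)
  note 1 = defines_byD[OF this]
  define r :: "(nat \<Rightarrow> nat) \<Rightarrow> nat \<Rightarrow> nat"
    where "r f i = (if even i then 2 * f (i div 2) else i)" for f i
  obtain \<phi>' where 2: "set_fm2 \<phi> \<longrightarrow> set_fm2 \<phi>'"
    "\<And>v w. sat2 N E P \<phi>' v w \<longleftrightarrow> sat2 N E P \<phi> (v \<circ> r f) (w \<circ> r g)"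
    using sat2_subst[of \<phi> N E P "r f" "r g"] by blast
  have mix_r: "mix u s \<circ> r h = mix (\<lambda>i. u (h i)) s" for u s :: "nat \<Rightarrow> 'c" and h
    by (auto simp: fun_eq_iff mix_def r_def)
  show ?thesis
  proof (rule dfnI[where \<phi> = \<phi>' and p = p and q = q])
    fix v w assume v: "range (v :: nat \<Rightarrow> 'a) \<subseteq> N" and w: "range (w :: nat \<Rightarrow> 'a set) \<subseteq> P"
    have "range (\<lambda>i. v (f i)) \<subseteq> N" "range (\<lambda>i. w (g i)) \<subseteq> P" using v w by auto
    from 1(4)[OF this]
    show "Q (\<lambda>i. v (f i)) (\<lambda>i. w (g i)) \<longleftrightarrow> sat2 N E P \<phi>' (mix v p) (mix w q)"
      by (simp add: 2(2) mix_r)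
  qed (use 1 2 in auto)
qed

lemma dfn_neg [dfn_intros]:
  assumes "dfn b Q" shows "dfn b (\<lambda>v w. \<not> Q v w)"
proof -
  obtain \<phi> p q where "defines_by b \<phi> p q Q" using assms by (rule dfnE)
  note 1 = defines_byD[OF this]
  show ?thesis by (rule dfnI[where \<phi> = "CNeg \<phi>" and p = p and q = q]) (use 1 in auto)
qed

lemma dfn_conj [dfn_intros]:
  assumes "dfn b Q" "dfn b R" shows "dfn b (\<lambda>v w. Q v w \<and> R v w)"
proof -
  obtain \<phi> p q where "defines_by b \<phi> p q Q" using assms(1) by (rule dfnE)
  note 1 = defines_byD[OF this]
  obtain \<psi> p' q' where "defines_by b \<psi> p' q' R" using assms(2) by (rule dfnE)
  note 2 = defines_byD[OF this]
  \<comment> \<open>the parameters of the two formulas are interleaved\<close>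
  define f :: "nat \<Rightarrow> nat" where "f i = (if even i then i else Suc (2 * (i - 1)))" for i
  define g :: "nat \<Rightarrow> nat" where "g i = (if even i then i else Suc (Suc (Suc (2 * (i - 1)))))" for i
  have f: "mix u (mix s t) \<circ> f = mix u s" for u s t :: "nat \<Rightarrow> 'c"
    by (auto simp: fun_eq_iff mix_def f_def elim!: oddE)
  have g: "mix u (mix s t) \<circ> g = mix u t" for u s t :: "nat \<Rightarrow> 'c"
    by (auto simp: fun_eq_iff mix_def g_def elim!: oddE)
  obtain \<phi>' where \<phi>': "set_fm2 \<phi> \<longrightarrow> set_fm2 \<phi>'"
    "\<And>v w. sat2 N E P \<phi>' v w \<longleftrightarrow> sat2 N E P \<phi> (v \<circ> f) (w \<circ> f)"
    using sat2_subst[of \<phi> N E P f f] by blast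
  obtain \<psi>' where \<psi>': "set_fm2 \<psi> \<longrightarrow> set_fm2 \<psi>'"
    "\<And>v w. sat2 N E P \<psi>' v w \<longleftrightarrow> sat2 N E P \<psi> (v \<circ> g) (w \<circ> g)"
    using sat2_subst[of \<psi> N E P g g] by blast
  show ?thesis
  proof (rule dfnI[where \<phi> = "CAnd \<phi>' \<psi>'" and p = "mix p p'" and q = "mix q q'"])
    show "b \<longrightarrow> set_fm2 (CAnd \<phi>' \<psi>')" using 1(1) 2(1) \<phi>'(1) \<psi>'(1) by simp
  qed (use 1 2 in \<open>simp_all add: mix_range \<phi>'(2) \<psi>'(2) f g\<close>)
qed

lemma dfn_all [dfn_intros]:
  assumes "dfn b (\<lambda>v w. A (v 0) (\<lambda>i. v (Suc i)) w)"
  shows "dfn b (\<lambda>v w. \<forall>x\<in>N. A x v w)"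
proof -
  obtain \<phi> p q where "defines_by b \<phi> p q (\<lambda>v w. A (v 0) (\<lambda>i. v (Suc i)) w)" using assms by (rule dfnE)
  note 1 = defines_byD[OF this]
  define m where "m = fm2_bound \<phi>"
  define f where "f = bind_index m"
  obtain \<phi>' where 2: "set_fm2 \<phi> \<longrightarrow> set_fm2 \<phi>'"
    "\<And>v w. sat2 N E P \<phi>' v w \<longleftrightarrow> sat2 N E P \<phi> (v \<circ> f) (w \<circ> id)"
    using sat2_subst[of \<phi> N E P f id] by blast
  have 3: "sat2 N E P \<phi> ((mix v p)(2 * m := x) \<circ> f) w \<longleftrightarrow> sat2 N E P \<phi> (mix (case_nat x v) p) w"
    for x v w
    by (rule sat2_cong) (simp add: f_def m_def mix_bind_index del: comp_apply)
  show ?thesis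
  proof (rule dfnI[where \<phi> = "CAllS (2 * m) \<phi>'" and p = p and q = q])
    fix v w assume v: "range (v :: nat \<Rightarrow> 'a) \<subseteq> N" and w: "range (w :: nat \<Rightarrow> 'a set) \<subseteq> P"
    have "A x v w \<longleftrightarrow> sat2 N E P \<phi> (mix (case_nat x v) p) (mix w q)" if "x \<in> N" for x
      using 1(4)[of "case_nat x v" w] that v w by (auto simp: image_subset_iff split: nat.split)
    then show "(\<forall>x\<in>N. A x v w) \<longleftrightarrow> sat2 N E P (CAllS (2 * m) \<phi>') (mix v p) (mix w q)"
      by (simp add: 2(2) 3)
  qed (use 1 2 in auto)
qed

lemma dfn_all_class [dfn_intros]:
  assumes "dfn False (\<lambda>v w. A (w 0) v (\<lambda>i. w (Suc i)))"
  shows "dfn False (\<lambda>v w. \<forall>X\<in>P. A X v w)"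
proof -
  obtain \<phi> p q where "defines_by False \<phi> p q (\<lambda>v w. A (w 0) v (\<lambda>i. w (Suc i)))" using assms by (rule dfnE)
  note 1 = defines_byD[OF this]
  define m where "m = fm2_bound \<phi>"
  define f where "f = bind_index m"
  obtain \<phi>' where 2: 
    "\<And>v w. sat2 N E P \<phi>' v w \<longleftrightarrow> sat2 N E P \<phi> (v \<circ> id) (w \<circ> f)"
    using sat2_subst[of \<phi> N E P id f] by blast
  have 3: "sat2 N E P \<phi> v ((mix w q)(2 * m := x) \<circ> f) \<longleftrightarrow> sat2 N E P \<phi> v (mix (case_nat x w) q)"
    for x v w
    by (rule sat2_cong) (simp add: f_def m_def mix_bind_index del: comp_apply)
  show ?thesis
  proof (rule dfnI[where \<phi> = "CAllC (2 * m) \<phi>'" and p = p and q = q])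
    fix v w assume v: "range (v :: nat \<Rightarrow> 'a) \<subseteq> N" and w: "range (w :: nat \<Rightarrow> 'a set) \<subseteq> P"
    have "A x v w \<longleftrightarrow> sat2 N E P \<phi> (mix v p) (mix (case_nat x w) q)" if "x \<in> P" for x
      using 1(4)[of v "case_nat x w"] that v w by (auto simp: image_subset_iff split: nat.split)
    then show "(\<forall>x\<in>P. A x v w) \<longleftrightarrow> sat2 N E P (CAllC (2 * m) \<phi>') (mix v p) (mix w q)"
      by (simp add: 2 3)
  qed (use 1 in auto)
qed

lemma dfn_iff [dfn_intros]:
  assumes "dfn b Q" "dfn b R" shows "dfn b (\<lambda>v w. Q v w \<longleftrightarrow> R v w)"
proof (rule dfn_cong)
  show "dfn b (\<lambda>v w. \<not> (Q v w \<and> \<not> R v w) \<and> \<not> (R v w \<and> \<not> Q v w))"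
    by (intro dfn_conj dfn_neg assms)
qed blast

lemma dfn_disj [dfn_intros]:
  assumes "dfn b Q" "dfn b R" shows "dfn b (\<lambda>v w. Q v w \<or> R v w)"
proof (rule dfn_cong)
  show "dfn b (\<lambda>v w. \<not> (\<not> Q v w \<and> \<not> R v w))"
    by (intro dfn_conj dfn_neg assms)
qed blast

lemma dfn_imp [dfn_intros]:
  assumes "dfn b Q" "dfn b R" shows "dfn b (\<lambda>v w. Q v w \<longrightarrow> R v w)"
proof (rule dfn_cong)
  show "dfn b (\<lambda>v w. \<not> (Q v w \<and> \<not> R v w))"
    by (intro dfn_conj dfn_neg assms)
qed blast

lemma dfn_ex [dfn_intros]:
  assumes "dfn b (\<lambda>v w. A (v 0) (\<lambda>i. v (Suc i)) w)"
  shows "dfn b (\<lambda>v w. \<exists>x\<in>N. A x v w)"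
proof (rule dfn_cong)
  show "dfn b (\<lambda>v w. \<not> (\<forall>x\<in>N. \<not> A x v w))"
    by (intro dfn_all dfn_neg assms)
qed blast

lemma dfn_var_eq: "dfn b (\<lambda>v w. v i = v k)"
  by (rule dfnI[where \<phi> = "CEqS (2 * i) (2 * k)" and p = "\<lambda>_. emp" and q = "\<lambda>_. some_class"]) auto

lemma dfn_var_mem: "dfn b (\<lambda>v w. E (v i) (v k))"
  by (rule dfnI[where \<phi> = "CMem (2 * i) (2 * k)" and p = "\<lambda>_. emp" and q = "\<lambda>_. some_class"]) auto

lemma dfn_var_in: "dfn False (\<lambda>v w. v i \<in> w k)"
  by (rule dfnI[where \<phi> = "CIn (2 * i) (2 * k)" and p = "\<lambda>_. emp" and q = "\<lambda>_. some_class"]) auto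

lemma dfn_const_eq: "c \<in> cst b \<Longrightarrow> dfn b (\<lambda>v w. v i = c)"
  by (rule dfnI[where \<phi> = "CEqS (2 * i) (Suc (2 * 0))" and p = "\<lambda>_. c" and q = "\<lambda>_. some_class"])
    (auto simp: mix_def)

lemma dfn_const_class: "C \<in> P \<Longrightarrow> dfn False (\<lambda>v w. v i \<in> C)"
  by (rule dfnI[where \<phi> = "CIn (2 * i) (Suc (2 * 0))" and p = "\<lambda>_. emp" and q = "\<lambda>_. C"])
    (auto simp: mix_def)

subsection \<open>Definable terms\<close>

text \<open>
  A term is definable if its graph is; \<open>ctm\<close> is the analogue for class terms, whose values
  are given through their elements.
\<close>

definition tm :: "bool \<Rightarrow> ((nat \<Rightarrow> 'a) \<Rightarrow> (nat \<Rightarrow> 'a set) \<Rightarrow> 'a) \<Rightarrow> bool" where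
  "tm b t \<longleftrightarrow> (\<forall>v w. range v \<subseteq> N \<longrightarrow> range w \<subseteq> P \<longrightarrow> t v w \<in> N) \<and>
     dfn b (\<lambda>v w. v 0 = t (\<lambda>i. v (Suc i)) w)"

definition ctm :: "((nat \<Rightarrow> 'a) \<Rightarrow> (nat \<Rightarrow> 'a set) \<Rightarrow> 'a set) \<Rightarrow> bool" where
  "ctm W \<longleftrightarrow> dfn False (\<lambda>v w. v 0 \<in> W (\<lambda>i. v (Suc i)) w)"

lemma tm_var [dfn_intros]: "tm b (\<lambda>v w. v i)"
  by (auto simp: tm_def intro: dfn_var_eq)

lemma tm_const [dfn_intros]: "c \<in> N \<Longrightarrow> tm False (\<lambda>v w. c)"
  by (auto simp: tm_def cst_def intro!: dfn_const_eq)

lemma tm_emp [dfn_intros]: "tm b (\<lambda>v w. emp)"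
  by (auto simp: tm_def intro!: dfn_const_eq)

lemma ctm_var [dfn_intros]: "ctm (\<lambda>v w. w k)"
  by (auto simp: ctm_def intro: dfn_var_in)

lemma ctm_const [dfn_intros]: "C \<in> P \<Longrightarrow> ctm (\<lambda>v w. C)"
  by (auto simp: ctm_def intro: dfn_const_class)

lemma tm_reindex:
  assumes t: "tm b t" shows "tm b (\<lambda>v w. t (\<lambda>i. v (f i)) w)"
  unfolding tm_def
proof (intro conjI allI impI)
  fix v w assume "range (v :: nat \<Rightarrow> 'a) \<subseteq> N" "range (w :: nat \<Rightarrow> 'a set) \<subseteq> P"
  then show "t (\<lambda>i. v (f i)) w \<in> N" using t unfolding tm_def by (simp add: image_subset_iff)
next
  have "dfn b (\<lambda>v w. v 0 = t (\<lambda>i. v (Suc i)) w)" using t by (simp add: tm_def)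
  from dfn_reindex[OF this, where f = "case_nat 0 (\<lambda>i. Suc (f i))" and g = id]
  show "dfn b (\<lambda>v w. v 0 = t (\<lambda>i. v (Suc (f i))) w)" by simp
qed

lemma dfn_let:
  assumes t: "tm b t" and A: "dfn b (\<lambda>v w. A (v 0) (\<lambda>i. v (Suc i)) w)"
  shows "dfn b (\<lambda>v w. A (t v w) v w)"
proof (rule dfn_cong)
  show "dfn b (\<lambda>v w. \<exists>x\<in>N. x = t v w \<and> A x v w)"
    by (intro dfn_ex dfn_conj A) (use t in \<open>simp add: tm_def\<close>)
qed (use t in \<open>auto simp: tm_def\<close>)

lemma dfn_subst1:
  assumes R: "dfn b (\<lambda>v w. R (v 0))" and t: "tm b t"
  shows "dfn b (\<lambda>v w. R (t v w))"
  by (rule dfn_let[OF t, where A = "\<lambda>x v w. R x"]) (rule R)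

lemma dfn_subst2:
  assumes R: "dfn b (\<lambda>v w. R (v 0) (v 1))" and t: "tm b t" and s: "tm b s"
  shows "dfn b (\<lambda>v w. R (t v w) (s v w))"
  by (rule dfn_let[OF t, where A = "\<lambda>x v w. R x (s v w)"],
      rule dfn_let[OF tm_reindex[OF s], where A = "\<lambda>y v w. R (v 0) y"])
    (use dfn_reindex[OF R, where f = "case_nat 1 (\<lambda>_. 0)"] in simp)

lemma dfn_subst3:
  assumes R: "dfn b (\<lambda>v w. R (v 0) (v 1) (v 2))" and t: "tm b t" and s: "tm b s" and r: "tm b r"
  shows "dfn b (\<lambda>v w. R (t v w) (s v w) (r v w))"
proof (rule dfn_let[OF t, where A = "\<lambda>x v w. R x (s v w) (r v w)"],
    rule dfn_let[OF tm_reindex[OF s], where A = "\<lambda>y v w. R (v 0) y (r (\<lambda>i. v (Suc i)) w)"],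
    rule dfn_let[OF tm_reindex[OF r], where A = "\<lambda>z v w. R (v (Suc 0)) (v 0) z"])
  show "dfn b (\<lambda>v w. R (v (Suc (Suc 0))) (v (Suc 0)) (v 0))"
    using dfn_reindex[OF R, where f = "\<lambda>i. 2 - i"] by (simp add: numeral_2_eq_2)
qed

lemma dfn_subst4:
  assumes R: "dfn b (\<lambda>v w. R (v 0) (v 1) (v 2) (v 3))"
    and t: "tm b t" and s: "tm b s" and r: "tm b r" and q: "tm b q"
  shows "dfn b (\<lambda>v w. R (t v w) (s v w) (r v w) (q v w))"
proof (rule dfn_let[OF t, where A = "\<lambda>x v w. R x (s v w) (r v w) (q v w)"],
    rule dfn_let[OF tm_reindex[OF s],
      where A = "\<lambda>y v w. R (v 0) y (r (\<lambda>i. v (Suc i)) w) (q (\<lambda>i. v (Suc i)) w)"],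
    rule dfn_let[OF tm_reindex[OF r],
      where A = "\<lambda>z v w. R (v (Suc 0)) (v 0) z (q (\<lambda>i. v (Suc (Suc i))) w)"],
    rule dfn_let[OF tm_reindex[OF q],
      where A = "\<lambda>z v w. R (v (Suc (Suc 0))) (v (Suc 0)) (v 0) z"])
  show "dfn b (\<lambda>v w. R (v (Suc (Suc (Suc 0)))) (v (Suc (Suc 0))) (v (Suc 0)) (v 0))"
    using dfn_reindex[OF R, where f = "\<lambda>i. 3 - i"] by (simp add: numeral_2_eq_2 numeral_3_eq_3)
qed

lemma dfn_mem [dfn_intros]: "tm b t \<Longrightarrow> tm b s \<Longrightarrow> dfn b (\<lambda>v w. E (t v w) (s v w))"
  by (rule dfn_subst2[where R = E]) (rule dfn_var_mem)

lemma dfn_eq [dfn_intros]: "tm b t \<Longrightarrow> tm b s \<Longrightarrow> dfn b (\<lambda>v w. t v w = s v w)"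
  by (rule dfn_subst2[where R = "(=)"]) (rule dfn_var_eq)

lemma dfn_in [dfn_intros]: "tm False t \<Longrightarrow> ctm W \<Longrightarrow> dfn False (\<lambda>v w. t v w \<in> W v w)"
  unfolding ctm_def by (rule dfn_let[where A = "\<lambda>x v w. x \<in> W v w"])

lemma tm_the_set:
  assumes "dfn b (\<lambda>v w. Q (v 0) (\<lambda>i. v (Suc i)) w)"
    and "\<And>v w. range v \<subseteq> N \<Longrightarrow> range w \<subseteq> P \<Longrightarrow> \<exists>b\<in>N. \<forall>z\<in>N. E z b \<longleftrightarrow> Q z v w"
  shows "tm b (\<lambda>v w. the_set (\<lambda>z. Q z v w))"
  unfolding tm_def
proof (intro conjI allI impI)
  fix v w assume "range (v :: nat \<Rightarrow> 'a) \<subseteq> N" "range (w :: nat \<Rightarrow> 'a set) \<subseteq> P"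
  then show "the_set (\<lambda>z. Q z v w) \<in> N" using the_set(1)[OF assms(2)] by blast
next
  have 1: "dfn b (\<lambda>v w. Q (v 0) (\<lambda>i. v (Suc (Suc i))) w)"
    using dfn_reindex[OF assms(1), where f = "case_nat 0 (\<lambda>i. Suc (Suc i))" and g = id] by simp
  show "dfn b (\<lambda>v w. v 0 = the_set (\<lambda>z. Q z (\<lambda>i. v (Suc i)) w))"
  proof (rule dfn_cong)
    show "dfn b (\<lambda>v w. \<forall>z\<in>N. E z (v 0) \<longleftrightarrow> Q z (\<lambda>i. v (Suc i)) w)"
      by (intro dfn_intros 1)
    fix v w assume vw: "range (v :: nat \<Rightarrow> 'a) \<subseteq> N" "range (w :: nat \<Rightarrow> 'a set) \<subseteq> P"
    then have "range (\<lambda>i. v (Suc i)) \<subseteq> N" by auto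
    note * = the_set[OF assms(2)[OF this vw(2)]]
    have "v 0 \<in> N" using vw by auto
    then show "v 0 = the_set (\<lambda>z. Q z (\<lambda>i. v (Suc i)) w) \<longleftrightarrow>
        (\<forall>z\<in>N. E z (v 0) \<longleftrightarrow> Q z (\<lambda>i. v (Suc i)) w)"
      using * extensionality[of "v 0" "the_set (\<lambda>z. Q z (\<lambda>i. v (Suc i)) w)"] by metis
  qed
qed

lemma tm_fun1:
  assumes t: "tm b t" and f: "tm b (\<lambda>v w. f (v 0))"
  shows "tm b (\<lambda>v w. f (t v w))"
proof -
  have 1: "f x \<in> N" if "x \<in> N" for x
    using f that some_class unfolding tm_def
    by (auto dest!: spec[of _ "\<lambda>_. x"] spec[of _ "\<lambda>_. some_class"])
  have 2: "dfn b (\<lambda>v w. v 0 = f (v 1))" using f by (simp add: tm_def)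
  have 3: "dfn b (\<lambda>v w. v 0 = f (t (\<lambda>i. v (Suc i)) w))"
    by (rule dfn_subst2[OF 2 tm_var]) (rule tm_reindex[OF t])
  show ?thesis using t 1 3 by (simp add: tm_def)
qed

lemma tm_fun2:
  assumes t: "tm b t" and s: "tm b s" and f: "tm b (\<lambda>v w. f (v 0) (v 1))"
  shows "tm b (\<lambda>v w. f (t v w) (s v w))"
proof -
  have 1: "f x y \<in> N" if "x \<in> N" "y \<in> N" for x y
    using f that some_class unfolding tm_def
    by (auto dest!: spec[of _ "case_nat x (\<lambda>_. y)"] spec[of _ "\<lambda>_. some_class"] simp: image_subset_iff split: nat.splits)
  have 2: "dfn b (\<lambda>v w. v 0 = f (v 1) (v 2))" using f by (simp add: tm_def numeral_2_eq_2)
  have 3: "dfn b (\<lambda>v w. v 0 = f (t (\<lambda>i. v (Suc i)) w) (s (\<lambda>i. v (Suc i)) w))"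
    by (rule dfn_subst3[OF 2 tm_var]) (rule tm_reindex[OF t] tm_reindex[OF s])+
  show ?thesis using t s 1 3 by (simp add: tm_def)
qed

end

context zf2
begin

text \<open>
  The values of the remaining variables become parameters; this makes the axioms for predicates in one or two
  variables applicable under further free variables.
\<close>

lemma dfn_fix_from:
  assumes Q: "dfn b Q" and v0: "range v0 \<subseteq> N" and w0: "range w0 \<subseteq> P"
  shows "dfn False (\<lambda>v w. Q (\<lambda>i. if i < k then v i else v0 i) w0)"
proof -
  obtain \<phi> p q where "defines_by b \<phi> p q Q" using Q by (rule dfnE)
  note 1 = defines_byD[OF this]
  define g :: "nat \<Rightarrow> nat" where "g i = Suc (2 * i)" for i
  define f :: "nat \<Rightarrow> nat" where
    "f i = (if even i \<and> i div 2 < k then i else Suc (2 * i))" for i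
  have g: "mix u (mix s t) \<circ> g = mix s t" for u s t :: "nat \<Rightarrow> 'a set"
    by (auto simp: fun_eq_iff g_def)
  have f: "mix u (mix s t) \<circ> f = mix (\<lambda>i. if i < k then u i else s i) t" for u s t :: "nat \<Rightarrow> 'a"
    by (auto simp: fun_eq_iff f_def) (auto simp: mix_def)
  obtain \<phi>' where 2: "\<And>v w. sat2 N E P \<phi>' v w \<longleftrightarrow> sat2 N E P \<phi> (v \<circ> f) (w \<circ> g)"
    using sat2_subst[of \<phi> N E P f g] by blast
  have p: "range p \<subseteq> N" using 1(2) cst_sub by blast
  show ?thesis
  proof (rule dfnI[where \<phi> = \<phi>' and p = "mix v0 p" and q = "mix w0 q"])
    fix v w assume "range (v :: nat \<Rightarrow> 'a) \<subseteq> N" "range (w :: nat \<Rightarrow> 'a set) \<subseteq> P"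
    then have "range (\<lambda>i. if i < k then v i else v0 i) \<subseteq> N"
      using v0 by (simp add: image_subset_iff)
    from 1(4)[OF this w0] show "Q (\<lambda>i. if i < k then v i else v0 i) w0 \<longleftrightarrow>
        sat2 N E P \<phi>' (mix v (mix v0 p)) (mix w (mix w0 q))"
      by (simp add: 2 f g)
  qed (use 1 v0 w0 p in \<open>simp_all add: mix_range cst_def\<close>)
qed

lemma dfn_fix:
  assumes Q: "dfn b Q" and v0: "range v0 \<subseteq> N" and w0: "range w0 \<subseteq> P"
  shows "dfn False (\<lambda>v w. Q (case_nat (v 0) v0) w0)"
proof -
  have "(\<lambda>i. if i < 1 then v i else case_nat emp v0 i) = case_nat (v 0) v0" for v
    by (auto simp: fun_eq_iff split: nat.split)
  moreover have "range (case_nat emp v0) \<subseteq> N"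
    using v0 by (simp add: image_subset_iff split: nat.split)
  ultimately show ?thesis using dfn_fix_from[OF Q _ w0, of "case_nat emp v0" 1] by simp
qed

lemma comprehension:
  assumes "dfn False (\<lambda>v w. Q (v 0))"
  shows "{x \<in> N. Q x} \<in> P"
proof -
  obtain \<phi> p q where "defines_by False \<phi> p q (\<lambda>v w. Q (v 0))" using assms by (rule dfnE)
  note 1 = defines_byD[OF this]
  define v where "v = mix (\<lambda>_. emp) p"
  define w where "w = mix (\<lambda>_. some_class) q"
  have p: "range p \<subseteq> N" using 1(2) cst_sub by blast
  have "range v \<subseteq> N" "range w \<subseteq> P" unfolding v_def w_def by (rule mix_range; use 1(3) p in auto)+
  then have 2: "{x \<in> N. sat2 N E P \<phi> (v(0 := x)) w} \<in> P"
    using zf2 by (simp add: ZF2_model_def)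
  have "Q x \<longleftrightarrow> sat2 N E P \<phi> (v(0 := x)) w" if x: "x \<in> N" for x
  proof -
    have eq: "mix (case_nat x (\<lambda>_. emp)) p = v(0 := x)"
      by (auto simp: fun_eq_iff v_def mix_def split: nat.splits)
    have "range (case_nat x (\<lambda>_. emp)) \<subseteq> N" using x by (simp add: image_subset_iff split: nat.split)
    from 1(4)[OF this, of "\<lambda>_. some_class"] show ?thesis by (simp add: eq w_def)
  qed
  then have "{x \<in> N. Q x} = {x \<in> N. sat2 N E P \<phi> (v(0 := x)) w}" by blast
  with 2 show ?thesis by simp
qed

lemma separation_ex:
  assumes "dfn False (\<lambda>v w. Q (v 0))" and a: "a \<in> N"
  shows "\<exists>b\<in>N. \<forall>x\<in>N. E x b \<longleftrightarrow> E x a \<and> Q x"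
proof -
  have "\<forall>C\<in>P. \<forall>a\<in>N. \<exists>b\<in>N. \<forall>x\<in>N. E x b \<longleftrightarrow> E x a \<and> x \<in> C"
    using zf2 by (simp add: ZF2_model_def)
  with comprehension[OF assms(1)] a
  obtain b where "b \<in> N" "\<forall>x\<in>N. E x b \<longleftrightarrow> E x a \<and> x \<in> {x \<in> N. Q x}" by blast
  then show ?thesis by (intro bexI[of _ b]) simp_all
qed

section \<open>Sets and pairs\<close>

definition sep :: "'a \<Rightarrow> ('a \<Rightarrow> bool) \<Rightarrow> 'a" where "sep a Q = the_set (\<lambda>x. E x a \<and> Q x)"
definition up :: "'a \<Rightarrow> 'a \<Rightarrow> 'a" where "up x y = the_set (\<lambda>z. z = x \<or> z = y)"
definition un :: "'a \<Rightarrow> 'a" where "un x = the_set (\<lambda>z. \<exists>y\<in>N. E y x \<and> E z y)"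
definition pw :: "'a \<Rightarrow> 'a" where "pw x = the_set (\<lambda>z. \<forall>y\<in>N. E y z \<longrightarrow> E y x)"
definition bun :: "'a \<Rightarrow> 'a \<Rightarrow> 'a" where "bun x y = un (up x y)"
definition pr :: "'a \<Rightarrow> 'a \<Rightarrow> 'a" where "pr x y = up (up x x) (up x y)"
abbreviation sub :: "'a \<Rightarrow> 'a \<Rightarrow> bool" where "sub \<equiv> sub_in N E"

lemma sep:
  assumes "dfn False (\<lambda>v w. Q (v 0))" "a \<in> N"
  shows "sep a Q \<in> N" and "z \<in> N \<Longrightarrow> E z (sep a Q) \<longleftrightarrow> E z a \<and> Q z"
  using the_set[OF separation_ex[OF assms]] by (simp_all add: sep_def)

lemma up_ex: "x \<in> N \<Longrightarrow> y \<in> N \<Longrightarrow> \<exists>p\<in>N. \<forall>z\<in>N. E z p \<longleftrightarrow> z = x \<or> z = y"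
  using pairing unfolding upair_in_def by simp

lemma up_in [simp]: "x \<in> N \<Longrightarrow> y \<in> N \<Longrightarrow> up x y \<in> N"
  and up_mem [simp]: "x \<in> N \<Longrightarrow> y \<in> N \<Longrightarrow> z \<in> N \<Longrightarrow> E z (up x y) \<longleftrightarrow> z = x \<or> z = y"
  using the_set[OF up_ex] by (simp_all add: up_def)

lemma un_in [simp]: "x \<in> N \<Longrightarrow> un x \<in> N"
  and un_mem [simp]: "x \<in> N \<Longrightarrow> z \<in> N \<Longrightarrow> E z (un x) \<longleftrightarrow> (\<exists>y\<in>N. E y x \<and> E z y)"
  using the_set[OF union] by (simp_all add: un_def)

lemma pw_ex: "x \<in> N \<Longrightarrow> \<exists>q\<in>N. \<forall>z\<in>N. E z q \<longleftrightarrow> (\<forall>y\<in>N. E y z \<longrightarrow> E y x)"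
  using power_set unfolding sub_in_def by simp

lemma pw_in [simp]: "x \<in> N \<Longrightarrow> pw x \<in> N"
  and pw_mem [simp]: "x \<in> N \<Longrightarrow> z \<in> N \<Longrightarrow> E z (pw x) \<longleftrightarrow> sub z x"
  using the_set[OF pw_ex] by (simp_all add: pw_def sub_in_def)

lemma bun_in [simp]: "x \<in> N \<Longrightarrow> y \<in> N \<Longrightarrow> bun x y \<in> N"
  and bun_mem [simp]: "x \<in> N \<Longrightarrow> y \<in> N \<Longrightarrow> z \<in> N \<Longrightarrow> E z (bun x y) \<longleftrightarrow> E z x \<or> E z y"
  by (auto simp: bun_def)

lemma pr_in [simp]: "x \<in> N \<Longrightarrow> y \<in> N \<Longrightarrow> pr x y \<in> N"
  by (simp add: pr_def)

lemma upD: "up x y = up a b \<Longrightarrow> x \<in> N \<Longrightarrow> y \<in> N \<Longrightarrow> a \<in> N \<Longrightarrow> b \<in> N \<Longrightarrow> 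
  (x = a \<and> y = b) \<or> (x = b \<and> y = a)"
  by (metis up_mem)

lemma pr_inj [simp]:
  assumes "x \<in> N" "y \<in> N" "a \<in> N" "b \<in> N"
  shows "pr x y = pr a b \<longleftrightarrow> x = a \<and> y = b"
  using assms upD[of "up x x" "up x y" "up a a" "up a b"] upD[of x x a a] upD[of x y a b]
    upD[of x x a b] upD[of x y a a] by (auto simp: pr_def)

lemma opair_iff:
  assumes [simp]: "p \<in> N" "x \<in> N" "y \<in> N" shows "opair_in N E p x y \<longleftrightarrow> p = pr x y"
proof -
  have *: "upair_in N E q a b \<longleftrightarrow> q = up a b" if "q \<in> N" "a \<in> N" "b \<in> N" for q a b
    using that extensionality[of q "up a b"] by (auto simp: upair_in_def)
  show ?thesis by (auto simp: opair_in_def * pr_def)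
qed

lemma tm_sep [dfn_intros]:
  assumes t: "tm b t" and Q: "dfn b (\<lambda>v w. Q (v 0) (\<lambda>i. v (Suc i)) w)"
  shows "tm b (\<lambda>v w. sep (t v w) (\<lambda>x. Q x v w))"
  unfolding sep_def
proof (rule tm_the_set)
  show "dfn b (\<lambda>v w. E (v 0) (t (\<lambda>i. v (Suc i)) w) \<and> Q (v 0) (\<lambda>i. v (Suc i)) w)"
    by (intro dfn_intros Q tm_reindex[OF t])
  fix v w assume vw: "range (v :: nat \<Rightarrow> 'a) \<subseteq> N" "range (w :: nat \<Rightarrow> 'a set) \<subseteq> P"
  show "\<exists>b\<in>N. \<forall>z\<in>N. E z b \<longleftrightarrow> E z (t v w) \<and> Q z v w"
  proof (rule separation_ex)
    show "dfn False (\<lambda>v' w'. Q (v' 0) v w)" using dfn_fix[OF Q vw] by simp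
    show "t v w \<in> N" using t vw by (simp add: tm_def)
  qed
qed

lemma tm_up [dfn_intros]: "tm b s \<Longrightarrow> tm b t \<Longrightarrow> tm b (\<lambda>v w. up (s v w) (t v w))"
  by (erule (1) tm_fun2) (unfold up_def, rule tm_the_set, intro dfn_intros, simp add: up_ex image_subset_iff)

lemma tm_un [dfn_intros]: "tm b s \<Longrightarrow> tm b (\<lambda>v w. un (s v w))"
  by (erule tm_fun1) (unfold un_def, rule tm_the_set, intro dfn_intros, simp add: union image_subset_iff)

lemma tm_pw [dfn_intros]: "tm b s \<Longrightarrow> tm b (\<lambda>v w. pw (s v w))"
  by (erule tm_fun1) (unfold pw_def, rule tm_the_set, intro dfn_intros, simp add: pw_ex image_subset_iff)

lemma tm_bun [dfn_intros]: "tm b s \<Longrightarrow> tm b t \<Longrightarrow> tm b (\<lambda>v w. bun (s v w) (t v w))"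
  unfolding bun_def by (intro dfn_intros)

lemma tm_pr [dfn_intros]: "tm b s \<Longrightarrow> tm b t \<Longrightarrow> tm b (\<lambda>v w. pr (s v w) (t v w))"
  unfolding pr_def by (intro dfn_intros)

lemma dfn_sub [dfn_intros]: "tm b s \<Longrightarrow> tm b t \<Longrightarrow> dfn b (\<lambda>v w. sub (s v w) (t v w))"
  by (rule dfn_subst2) (unfold sub_in_def, intro dfn_intros)

lemma sub_trans: "sub x y \<Longrightarrow> sub y z \<Longrightarrow> sub x z" by (simp add: sub_in_def)
lemma sub_refl [simp]: "sub x x" by (simp add: sub_in_def)
lemma subD: "sub x y \<Longrightarrow> z \<in> N \<Longrightarrow> E z x \<Longrightarrow> E z y" by (simp add: sub_in_def)
lemma subI: "(\<And>z. z \<in> N \<Longrightarrow> E z x \<Longrightarrow> E z y) \<Longrightarrow> sub x y" by (simp add: sub_in_def)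
lemma sub_antisym: "x \<in> N \<Longrightarrow> y \<in> N \<Longrightarrow> sub x y \<Longrightarrow> sub y x \<Longrightarrow> x = y"
  by (rule extensionality) (auto simp: sub_in_def)

lemma replacement_ex:
  assumes R: "dfn False (\<lambda>v w. R (v 0) (v 1))" and a: "a \<in> N"
    and fn: "\<forall>x\<in>N. \<forall>y\<in>N. \<forall>z\<in>N. R x y \<and> R x z \<longrightarrow> y = z"
  shows "\<exists>b\<in>N. \<forall>y\<in>N. E y b \<longleftrightarrow> (\<exists>x\<in>N. E x a \<and> R x y)"
proof -
  define F where "F = {p \<in> N. \<exists>x\<in>N. \<exists>y\<in>N. p = pr x y \<and> R x y}"
  have "F \<in> P" unfolding F_def by (rule comprehension) (intro dfn_intros dfn_subst2[OF R])
  have ax: "\<forall>F\<in>P.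
        (\<forall>x\<in>N. \<forall>y\<in>N. \<forall>z\<in>N. \<forall>p\<in>F. \<forall>q\<in>F.
           opair_in N E p x y \<and> opair_in N E q x z \<longrightarrow> y = z) \<longrightarrow>
        (\<forall>a\<in>N. \<exists>b\<in>N. \<forall>y\<in>N. E y b \<longleftrightarrow> (\<exists>x\<in>N. E x a \<and> (\<exists>p\<in>F. opair_in N E p x y)))"
    using zf2 by (simp add: ZF2_model_def)
  have *: "(\<exists>p\<in>F. opair_in N E p x y) \<longleftrightarrow> R x y" if "x \<in> N" "y \<in> N" for x y
    using that by (auto simp: F_def opair_iff)
  have "\<forall>x\<in>N. \<forall>y\<in>N. \<forall>z\<in>N. \<forall>p\<in>F. \<forall>q\<in>F. opair_in N E p x y \<and> opair_in N E q x z \<longrightarrow> y = z"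
  proof (intro ballI impI, elim conjE)
    fix x y z p q assume xyz: "x \<in> N" "y \<in> N" "z \<in> N" and "p \<in> F" "q \<in> F"
      "opair_in N E p x y" "opair_in N E q x z"
    then have "R x y" "R x z" using *[of x y] *[of x z] by (simp_all add: bexI)
    then show "y = z" using fn xyz by blast
  qed
  from bspec[OF mp[OF bspec[OF ax \<open>F \<in> P\<close>] this] a] obtain b where
    "b \<in> N" "\<forall>y\<in>N. E y b \<longleftrightarrow> (\<exists>x\<in>N. E x a \<and> (\<exists>p\<in>F. opair_in N E p x y))" by (rule bexE)
  then show ?thesis by (intro bexI[of _ b]) (simp_all add: * cong: conj_cong)
qed

lemma no_loop: "x \<in> N \<Longrightarrow> \<not> E x x"
  using set_foundation[of "up x x" x] by auto

lemma no_2_loop: "x \<in> N \<Longrightarrow> y \<in> N \<Longrightarrow> E x y \<Longrightarrow> \<not> E y x"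
  using set_foundation[of "up x y" x] by auto

section \<open>Inductively defined classes\<close>

text \<open>
  The intersection of all classes closed under \<open>op\<close>. This quantifies over classes, but it is a class
  by full comprehension.
\<close>

definition lfpc :: "('a set \<Rightarrow> 'a \<Rightarrow> bool) \<Rightarrow> 'a set" where
  "lfpc op = {z \<in> N. \<forall>X\<in>P. (\<forall>y\<in>N. op X y \<longrightarrow> y \<in> X) \<longrightarrow> z \<in> X}"

context
  fixes op :: "'a set \<Rightarrow> 'a \<Rightarrow> bool"
  assumes op: "dfn False (\<lambda>v w. op (w 0) (v 0))"
    and mono: "\<forall>X Y z. X \<subseteq> Y \<longrightarrow> op X z \<longrightarrow> op Y z"
begin

lemma lfpc_class: "lfpc op \<in> P"
  unfolding lfpc_def by (rule comprehension) (intro dfn_intros op)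

lemma lfpc_least:
  assumes "X \<in> P" "\<And>z. z \<in> N \<Longrightarrow> op X z \<Longrightarrow> z \<in> X" shows "lfpc op \<subseteq> X"
  using assms by (auto simp: lfpc_def)

lemma lfpc_intro: "z \<in> N \<Longrightarrow> op (lfpc op) z \<Longrightarrow> z \<in> lfpc op"
proof -
  assume z: "z \<in> N" "op (lfpc op) z"
  have "z \<in> X" if X: "X \<in> P" "\<forall>y\<in>N. op X y \<longrightarrow> y \<in> X" for X
  proof -
    have "lfpc op \<subseteq> X" using X by (auto simp: lfpc_def)
    with mono z(2) have "op X z" by blast
    then show ?thesis using z X by blast
  qed
  with z show ?thesis by (simp add: lfpc_def)
qed

lemma lfpc_unfold: "z \<in> N \<Longrightarrow> z \<in> lfpc op \<longleftrightarrow> op (lfpc op) z"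
proof
  have "dfn False (\<lambda>v w. op (lfpc op) (v 0))"
    using dfn_fix[OF op, of "\<lambda>_. emp" "\<lambda>_. lfpc op"] lfpc_class by simp
  then have 1: "{z \<in> N. op (lfpc op) z} \<in> P" by (rule comprehension)
  have "lfpc op \<subseteq> {z \<in> N. op (lfpc op) z}"
  proof (rule lfpc_least[OF 1])
    fix z assume z: "z \<in> N" "op {z \<in> N. op (lfpc op) z} z"
    have "{z \<in> N. op (lfpc op) z} \<subseteq> lfpc op" using lfpc_intro by blast
    with mono z(2) have "op (lfpc op) z" by blast
    with z(1) show "z \<in> {z \<in> N. op (lfpc op) z}" by simp
  qed
  then show "z \<in> lfpc op \<Longrightarrow> op (lfpc op) z" by blast
qed (rule lfpc_intro)

lemma lfpc_induct:
  assumes Q: "dfn False (\<lambda>v w. Q (v 0))" and z: "z \<in> lfpc op"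
    and step: "\<And>z. z \<in> N \<Longrightarrow> op {x \<in> N. Q x} z \<Longrightarrow> Q z"
  shows "Q z"
proof -
  have "lfpc op \<subseteq> {x \<in> N. Q x}" by (rule lfpc_least[OF comprehension[OF Q]]) (use step in simp)
  with z show ?thesis by blast
qed

end

section \<open>Iteration, foundation and collection for classes\<close>

definition suc :: "'a \<Rightarrow> 'a" where "suc x = bun x (up x x)"

lemma suc_in [simp]: "x \<in> N \<Longrightarrow> suc x \<in> N"
  and suc_mem [simp]: "x \<in> N \<Longrightarrow> z \<in> N \<Longrightarrow> E z (suc x) \<longleftrightarrow> E z x \<or> z = x"
  by (auto simp: suc_def)

lemma tm_suc [dfn_intros]: "tm b s \<Longrightarrow> tm b (\<lambda>v w. suc (s v w))"
  by (erule tm_fun1) (unfold suc_def, intro dfn_intros)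

lemma suc_inj: "x \<in> N \<Longrightarrow> y \<in> N \<Longrightarrow> suc x = suc y \<Longrightarrow> x = y"
  using no_2_loop[of x y] suc_mem[of x y] suc_mem[of y x] suc_mem[of x x] suc_mem[of y y] by auto

lemma suc_emp: "x \<in> N \<Longrightarrow> suc x \<noteq> emp"
  using suc_mem[of x x] emp_mem[of x] by metis

lemma tm_in: "tm b (\<lambda>v w. f (v 0)) \<Longrightarrow> x \<in> N \<Longrightarrow> f x \<in> N"
  unfolding tm_def by (auto dest!: spec[of _ "\<lambda>_. x"] spec[of _ "\<lambda>_. some_class"])

text \<open>
  The stages of the iteration are indexed by the elements of an inductive set, so that Replacement
  collects them.
\<close>

lemma closed_set_ex:
  assumes g: "tm False (\<lambda>v w. g (v 0))" and x0: "x0 \<in> N"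
  shows "\<exists>W\<in>N. E x0 W \<and> (\<forall>y\<in>N. E y W \<longrightarrow> E (g y) W)"
proof -
  note [simp] = tm_in[OF g]
  define op where "op X z \<longleftrightarrow>
    z = pr emp x0 \<or> (\<exists>n\<in>N. \<exists>y\<in>N. pr n y \<in> X \<and> z = pr (suc n) (g y))" for X z
  have op: "dfn False (\<lambda>v w. op (w 0) (v 0))"
    unfolding op_def by (intro dfn_intros x0 tm_fun1[OF _ g])
  have mono: "\<forall>X Y z. X \<subseteq> Y \<longrightarrow> op X z \<longrightarrow> op Y z" unfolding op_def by blast
  define Z where "Z = lfpc op"
  have Z: "Z \<in> P" unfolding Z_def by (rule lfpc_class[OF op mono])
  have Z_iff: "z \<in> Z \<longleftrightarrow> op Z z" if "z \<in> N" for z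
    unfolding Z_def by (rule lfpc_unfold[OF op mono that])
  have fun1: "\<exists>n\<in>N. \<exists>y\<in>N. z = pr n y \<and> (\<forall>y'\<in>N. pr n y' \<in> Z \<longrightarrow> y' = y)" if "z \<in> Z" for z
  proof (rule lfpc_induct[OF op mono _ that[unfolded Z_def], 
      where Q = "\<lambda>z. \<exists>n\<in>N. \<exists>y\<in>N. z = pr n y \<and> (\<forall>y'\<in>N. pr n y' \<in> Z \<longrightarrow> y' = y)"])
    show "dfn False (\<lambda>v w. \<exists>n\<in>N. \<exists>y\<in>N. v 0 = pr n y \<and> (\<forall>y'\<in>N. pr n y' \<in> Z \<longrightarrow> y' = y))"
      by (intro dfn_intros Z)
    fix z assume z: "z \<in> N" "op {x \<in> N. \<exists>n\<in>N. \<exists>y\<in>N. x = pr n y \<and> (\<forall>y'\<in>N. pr n y' \<in> Z \<longrightarrow> y' = y)} z"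
    from z(2)[unfolded op_def] consider "z = pr emp x0"
      | n y where "n \<in> N" "y \<in> N" "\<forall>y'\<in>N. pr n y' \<in> Z \<longrightarrow> y' = y" "z = pr (suc n) (g y)"
      by auto
    then show "\<exists>n\<in>N. \<exists>y\<in>N. z = pr n y \<and> (\<forall>y'\<in>N. pr n y' \<in> Z \<longrightarrow> y' = y)"
    proof cases
      case 1
      have "y' = x0" if y': "y' \<in> N" "pr emp y' \<in> Z" for y'
      proof -
        have "op Z (pr emp y')" using y' Z_iff[of "pr emp y'"] by simp
        then show ?thesis using y' x0 suc_emp by (fastforce simp: op_def)
      qed
      then show ?thesis by (intro bexI[OF _ emp_in] bexI[OF _ x0] conjI ballI impI 1)
    next
      case (2 n y)
      have "y' = g y" if y': "y' \<in> N" "pr (suc n) y' \<in> Z" for y'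
      proof -
        have "op Z (pr (suc n) y')" using y' 2 Z_iff[of "pr (suc n) y'"] by simp
        then obtain m u where m: "m \<in> N" "u \<in> N" "pr m u \<in> Z" "suc n = suc m" "y' = g u"
          using y' 2 x0 suc_emp[of n] by (auto simp: op_def)
        then have "m = n" using suc_inj 2 by blast
        with m 2 show ?thesis by blast
      qed
      then show ?thesis
        by (intro bexI[OF _ suc_in[OF 2(1)]] bexI[OF _ tm_in[OF g 2(2)]] conjI ballI impI 2)
    qed
  qed
  have fn: "y = y'" if "n \<in> N" "y \<in> N" "y' \<in> N" "pr n y \<in> Z" "pr n y' \<in> Z" for n y y'
  proof -
    from fun1[OF that(4)] obtain m u where m: "m \<in> N" "u \<in> N" "pr n y = pr m u"
      "\<forall>y'\<in>N. pr m y' \<in> Z \<longrightarrow> y' = u" by (elim bexE conjE) (rule that)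
    then have "m = n" "u = y" using that(1,2) by auto
    then show ?thesis using m(4) that(3,5) by blast
  qed
  obtain I where I: "I \<in> N" "E emp I" "\<And>y. y \<in> N \<Longrightarrow> E y I \<Longrightarrow> E (suc y) I"
  proof -
    from infinity obtain x e where x: "x \<in> N" "e \<in> N" "E e x" "\<forall>z\<in>N. \<not> E z e"
      "\<forall>y\<in>N. E y x \<longrightarrow> (\<exists>s\<in>N. E s x \<and> (\<forall>z\<in>N. E z s \<longleftrightarrow> E z y \<or> z = y))"
      by (elim bexE conjE) (rule that)
    have "e = emp" using x by (intro extensionality) auto
    moreover have "E (suc y) x" if y: "y \<in> N" "E y x" for y
    proof -
      from x(5) y obtain s where s: "s \<in> N" "E s x" "\<forall>z\<in>N. E z s \<longleftrightarrow> E z y \<or> z = y" by blast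
      have "s = suc y" using s y by (intro extensionality) auto
      with s show ?thesis by simp
    qed
    ultimately show thesis using that x by blast
  qed
  have "dfn False (\<lambda>v w. pr (v 0) (v 1) \<in> Z)" by (intro dfn_intros Z)
  moreover have "\<forall>n\<in>N. \<forall>y\<in>N. \<forall>z\<in>N. pr n y \<in> Z \<and> pr n z \<in> Z \<longrightarrow> y = z"
    using fn by blast
  ultimately have "\<exists>b\<in>N. \<forall>y\<in>N. E y b \<longleftrightarrow> (\<exists>x\<in>N. E x I \<and> pr x y \<in> Z)"
    using replacement_ex[of "\<lambda>x y. pr x y \<in> Z" I] I(1) by simp
  then
  obtain W where W: "W \<in> N" "\<And>y. y \<in> N \<Longrightarrow> E y W \<longleftrightarrow> (\<exists>x\<in>N. E x I \<and> pr x y \<in> Z)" by blast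
  have "op Z (pr emp x0)" by (simp add: op_def)
  then have "pr emp x0 \<in> Z" using x0 Z_iff[of "pr emp x0"] by simp
  then have "E x0 W" using W I x0 by auto
  moreover have "E (g y) W" if y: "y \<in> N" "E y W" for y
  proof -
    from y W obtain n where n: "n \<in> N" "E n I" "pr n y \<in> Z" by blast
    then have "op Z (pr (suc n) (g y))" using y unfolding op_def by blast
    then have "pr (suc n) (g y) \<in> Z" using y n Z_iff[of "pr (suc n) (g y)"] by simp
    then show ?thesis using W(2)[OF tm_in[OF g y(1)]] suc_in[OF n(1)] I(3)[OF n(1,2)] by blast
  qed
  ultimately show ?thesis using W(1) by blast
qed

lemma transitive_superset_ex:
  assumes x: "x \<in> N"
  shows "\<exists>T\<in>N. sub x T \<and> (\<forall>y\<in>N. E y T \<longrightarrow> sub y T)"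
proof -
  obtain W where W: "W \<in> N" "E x W" "\<forall>y\<in>N. E y W \<longrightarrow> E (un y) W"
    using closed_set_ex[of un, OF tm_un[OF tm_var] x] by (elim bexE conjE) (rule that)
  have "sub x (un W)" using W(1,2) x by (intro subI) auto
  moreover have "sub y (un W)" if y: "y \<in> N" "E y (un W)" for y
  proof (rule subI)
    fix z assume z: "z \<in> N" "E z y"
    from y W(1) obtain u where u: "u \<in> N" "E u W" "E y u" by auto
    then have "E z (un u)" using z y(1) by auto
    then show "E z (un W)" using u z W un_mem[of W z] un_in[of u] by blast
  qed
  ultimately show ?thesis using W(1) un_in[of W] by blast
qed

lemma class_foundation:
  assumes Q: "dfn False (\<lambda>v w. Q (v 0))" and x: "x \<in> N" "Q x"
  shows "\<exists>m\<in>N. Q m \<and> (\<forall>z\<in>N. E z m \<longrightarrow> \<not> Q z)"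
proof -
  obtain T where T: "T \<in> N" "sub (up x x) T" "\<forall>y\<in>N. E y T \<longrightarrow> sub y T"
    using transitive_superset_ex[OF up_in[OF x(1) x(1)]] by blast
  note s = sep[OF Q T(1)]
  have "E x T" by (rule subD[OF T(2) x(1)]) (simp add: x)
  then have "E x (sep T Q)" using x s(2) by simp
  from set_foundation[OF s(1) x(1) this]
  obtain m where m: "m \<in> N" "E m (sep T Q)" "\<not> (\<exists>z\<in>N. E z m \<and> E z (sep T Q))" by blast
  then have mT: "E m T" "Q m" using s(2) by auto
  have "\<not> Q z" if z: "z \<in> N" "E z m" for z
  proof -
    have "E z T" using T(3) m(1) mT(1) subD[OF _ z] by blast
    then show ?thesis using m(3) z s(2)[OF z(1)] by blast
  qed
  with m mT show ?thesis by blast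
qed

lemma set_induct:
  assumes Q: "dfn False (\<lambda>v w. Q (v 0))" and x: "x \<in> N"
    and step: "\<And>x. x \<in> N \<Longrightarrow> (\<And>y. y \<in> N \<Longrightarrow> E y x \<Longrightarrow> Q y) \<Longrightarrow> Q x"
  shows "Q x"
proof (rule ccontr)
  assume "\<not> Q x"
  with class_foundation[OF dfn_neg[OF Q] x] step show False by blast
qed

text \<open>
  The levels of the cumulative hierarchy, generated by power sets and unions. Defining them inductively
  avoids ordinals.
\<close>

definition lev :: "'a set" where
  "lev = lfpc (\<lambda>X z. (\<exists>s\<in>N. s \<in> X \<and> z = pw s) \<or> (\<exists>a\<in>N. (\<forall>s\<in>N. E s a \<longrightarrow> s \<in> X) \<and> z = un a))"

context
begin

private lemma lev_mono: "\<forall>X Y z. X \<subseteq> Y \<longrightarrow>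
    (\<exists>s\<in>N. s \<in> X \<and> z = pw s) \<or> (\<exists>a\<in>N. (\<forall>s\<in>N. E s a \<longrightarrow> s \<in> X) \<and> z = un a) \<longrightarrow>
    (\<exists>s\<in>N. s \<in> Y \<and> z = pw s) \<or> (\<exists>a\<in>N. (\<forall>s\<in>N. E s a \<longrightarrow> s \<in> Y) \<and> z = un a)"
  by blast

private lemma lev_op:
  "dfn False (\<lambda>v w. (\<exists>s\<in>N. s \<in> w 0 \<and> v 0 = pw s) \<or> (\<exists>a\<in>N. (\<forall>s\<in>N. E s a \<longrightarrow> s \<in> w 0) \<and> v 0 = un a))"
  by (intro dfn_intros)

lemma lev_class [simp]: "lev \<in> P"
  unfolding lev_def by (rule lfpc_class[OF lev_op lev_mono])

lemma lev_N: "s \<in> lev \<Longrightarrow> s \<in> N"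
  using lev_class P_sub by blast

lemma lev_iff:
  "z \<in> N \<Longrightarrow> z \<in> lev \<longleftrightarrow>
    (\<exists>s\<in>N. s \<in> lev \<and> z = pw s) \<or> (\<exists>a\<in>N. (\<forall>s\<in>N. E s a \<longrightarrow> s \<in> lev) \<and> z = un a)"
  unfolding lev_def by (rule lfpc_unfold[OF lev_op lev_mono])

lemma lev_pw: "s \<in> lev \<Longrightarrow> pw s \<in> lev"
  using lev_iff[OF pw_in[OF lev_N]] lev_N by blast

lemma lev_un: "a \<in> N \<Longrightarrow> (\<And>s. s \<in> N \<Longrightarrow> E s a \<Longrightarrow> s \<in> lev) \<Longrightarrow> un a \<in> lev"
  using lev_iff[OF un_in] by blast

lemma lev_induct [consumes 1, case_names dfn pw un]:
  assumes s: "s \<in> lev" and Q: "dfn False (\<lambda>v w. Q (v 0))"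
    and pw: "\<And>s. s \<in> lev \<Longrightarrow> Q s \<Longrightarrow> Q (pw s)"
    and un: "\<And>a. a \<in> N \<Longrightarrow> (\<And>s. s \<in> N \<Longrightarrow> E s a \<Longrightarrow> s \<in> lev \<and> Q s) \<Longrightarrow> Q (un a)"
  shows "Q s"
proof -
  have "s \<in> lev \<and> Q s"
  proof (rule lfpc_induct[OF lev_op lev_mono _ s[unfolded lev_def], where Q = "\<lambda>s. s \<in> lev \<and> Q s"])
    show "dfn False (\<lambda>v w. v 0 \<in> lev \<and> Q (v 0))" by (intro dfn_intros Q lev_class)
    fix z assume "z \<in> N" "(\<exists>s\<in>N. s \<in> {x \<in> N. x \<in> lev \<and> Q x} \<and> z = pw s) \<or>
      (\<exists>a\<in>N. (\<forall>s\<in>N. E s a \<longrightarrow> s \<in> {x \<in> N. x \<in> lev \<and> Q x}) \<and> z = un a)"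
    then show "z \<in> lev \<and> Q z"
    proof (elim disjE bexE conjE)
      fix s assume "s \<in> {x \<in> N. x \<in> lev \<and> Q x}" "z = pw s"
      then show ?thesis using pw[of s] lev_pw[of s] by simp
    next
      fix a assume a: "a \<in> N" "\<forall>s\<in>N. E s a \<longrightarrow> s \<in> {x \<in> N. x \<in> lev \<and> Q x}" "z = un a"
      then have "s \<in> lev \<and> Q s" if "s \<in> N" "E s a" for s using that by blast
      then show ?thesis using un[OF a(1)] lev_un[OF a(1)] a(3) by blast
    qed
  qed
  then show ?thesis by simp
qed

end

lemma lev_trans: "s \<in> lev \<Longrightarrow> x \<in> N \<Longrightarrow> E x s \<Longrightarrow> sub x s"
proof -
  have "\<forall>x\<in>N. E x s \<longrightarrow> sub x s" if "s \<in> lev" for s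
    using that
  proof (induction rule: lev_induct)
    case dfn show ?case by (intro dfn_intros)
  next
    case (pw s)
    have s: "s \<in> N" using pw(1) by (rule lev_N)
    show ?case
    proof (intro ballI impI subI)
      fix x z assume x: "x \<in> N" "E x (pw s)" "z \<in> N" "E z x"
      then have "E z s" using s subD[of x s z] by simp
      then have "sub z s" using pw(2) x by blast
      then show "E z (pw s)" using s x by simp
    qed
  next
    case (un a)
    show ?case
    proof (intro ballI impI subI)
      fix x z assume x: "x \<in> N" "E x (un a)" "z \<in> N" "E z x"
      then obtain s where s: "s \<in> N" "E s a" "E x s" using un(1) by auto
      then have "sub x s" using un(2)[OF s(1,2)] x by blast
      then have "E z s" using x subD by blast
      then show "E z (un a)" using s x un(1) by auto
    qed
  qed
  then show "s \<in> lev \<Longrightarrow> x \<in> N \<Longrightarrow> E x s \<Longrightarrow> sub x s" by blast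
qed

lemma lev_sub_pw: "s \<in> lev \<Longrightarrow> sub s (pw s)"
  by (rule subI) (simp add: lev_N lev_trans)

lemma pw_mono: "s \<in> N \<Longrightarrow> t \<in> N \<Longrightarrow> sub s t \<Longrightarrow> sub (pw s) (pw t)"
  by (rule subI) (simp add: sub_trans[of _ s t])

lemma sub_un: "a \<in> N \<Longrightarrow> s \<in> N \<Longrightarrow> E s a \<Longrightarrow> sub s (un a)"
  by (rule subI) (auto simp: un_mem)

lemma un_sub: "a \<in> N \<Longrightarrow> (\<And>s. s \<in> N \<Longrightarrow> E s a \<Longrightarrow> sub s t) \<Longrightarrow> sub (un a) t"
  by (rule subI) (auto simp: un_mem dest: subD)

text \<open>
  Levels are linearly ordered by inclusion, as in Zermelo's second proof of the
  well-ordering theorem: a level \<open>t\<close> is comparable with all others once \<open>pw s\<close> is included in \<open>t\<close>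
  for every level \<open>s\<close> strictly below \<open>t\<close>.
\<close>

lemma lev_comparable:
  assumes s: "s \<in> lev" and t: "t \<in> lev"
  shows "sub s t \<or> sub (pw t) s"
proof -
  define good where "good t \<longleftrightarrow> (\<forall>s\<in>N. s \<in> lev \<and> sub s t \<and> s \<noteq> t \<longrightarrow> sub (pw s) t)" for t
  have good: "dfn False (\<lambda>v w. good (v 0))" unfolding good_def by (intro dfn_intros lev_class)
  have *: "sub s t \<or> sub (pw t) s" if t: "good t" "t \<in> lev" and "s \<in> lev" for s t
    using that(3)
  proof (induction rule: lev_induct)
    case dfn show ?case by (intro dfn_intros lev_N[OF t(2)])
  next
    case (pw s)
    have N: "s \<in> N" "t \<in> N" using pw(1) t(2) by (simp_all add: lev_N)
    from pw(2) show ?case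
    proof
      assume st: "sub s t"
      show ?thesis
      proof (cases "s = t")
        case False
        with st t(1) pw(1) N show ?thesis unfolding good_def by blast
      qed simp
    next
      assume "sub (pw t) s" then show ?thesis using lev_sub_pw[OF pw(1)] sub_trans by blast
    qed
  next
    case (un a)
    show ?case
    proof (cases "\<exists>s\<in>N. E s a \<and> sub (pw t) s")
      case True
      then obtain s where s: "s \<in> N" "E s a" "sub (pw t) s" by blast
      from sub_trans[OF s(3) sub_un[OF un(1) s(1,2)]] show ?thesis ..
    next
      case False
      then have "sub (un a) t" using un by (intro un_sub) blast+
      then show ?thesis ..
    qed
  qed
  have "good t" using t
  proof (induction rule: lev_induct)
    case dfn show ?case by (rule good)
  next
    case (pw t)
    have N: "t \<in> N" using pw(1) by (rule lev_N)
    show ?case unfolding good_def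
    proof (intro ballI impI)
      fix s assume s: "s \<in> N" "s \<in> lev \<and> sub s (pw t) \<and> s \<noteq> pw t"
      then have "\<not> sub (pw t) s" using sub_antisym[of s "pw t"] N by auto
      then have "sub s t" using *[OF pw(2,1), of s] s by blast
      then show "sub (pw s) (pw t)" using s N by (simp add: pw_mono)
    qed
  next
    case (un a)
    show ?case unfolding good_def
    proof (intro ballI impI)
      fix s assume s: "s \<in> N" "s \<in> lev \<and> sub s (un a) \<and> s \<noteq> un a"
      have "\<exists>t\<in>N. E t a \<and> \<not> sub t s"
      proof (rule ccontr)
        assume "\<not> ?thesis"
        then have "sub (un a) s" using un(1) by (intro un_sub) blast+
        with s sub_antisym[of s "un a"] un(1) show False by simp
      qed
      then obtain t where t: "t \<in> N" "E t a" "\<not> sub t s" by blast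
      then have gt: "good t" "t \<in> lev" using un(2) by blast+
      from t lev_sub_pw[OF gt(2)] have "\<not> sub (pw t) s" using sub_trans by blast
      with *[OF gt] s have "sub s t" by blast
      moreover have "s \<noteq> t" using t(3) by auto
      ultimately have "sub (pw s) t" using gt(1) s unfolding good_def by blast
      from this sub_un[OF un(1) t(1,2)] show "sub (pw s) (un a)" by (rule sub_trans)
    qed
  qed
  from *[OF this t s] show ?thesis .
qed

lemma lev_linear: "s \<in> lev \<Longrightarrow> t \<in> lev \<Longrightarrow> sub s t \<or> E t s"
  using lev_comparable[of s t] lev_N[of t] subD[of "pw t" s t] by auto

text \<open>
  Foundation applies because for levels strict inclusion is membership.
\<close>

lemma lev_least:
  assumes Q: "dfn False (\<lambda>v w. Q (v 0))" and s: "s \<in> lev" "Q s"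
  shows "\<exists>m\<in>lev. Q m \<and> (\<forall>t\<in>lev. Q t \<longrightarrow> sub m t)"
proof -
  have "dfn False (\<lambda>v w. v 0 \<in> lev \<and> Q (v 0))" by (intro dfn_intros Q lev_class)
  from class_foundation[OF this, of s] s lev_N
  obtain m where m: "m \<in> N" "m \<in> lev \<and> Q m" "\<forall>z\<in>N. E z m \<longrightarrow> \<not> (z \<in> lev \<and> Q z)" by blast
  then have "sub m t" if "t \<in> lev" "Q t" for t using that lev_linear[of m t] lev_N[of t] by blast
  with m show ?thesis by blast
qed

text \<open>
  Replacement is applied to the map that sends \<open>x\<close> to the least level with the required property.
\<close>

lemma collect_levels:
  assumes Q: "dfn False (\<lambda>v w. Q (v 0) (v 1))" and a: "a \<in> N"
    and ex: "\<And>x. x \<in> N \<Longrightarrow> E x a \<Longrightarrow> \<exists>s\<in>lev. Q x s"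
    and up: "\<And>x s t. x \<in> N \<Longrightarrow> s \<in> lev \<Longrightarrow> t \<in> lev \<Longrightarrow> sub s t \<Longrightarrow> Q x s \<Longrightarrow> Q x t"
  shows "\<exists>t\<in>lev. \<forall>x\<in>N. E x a \<longrightarrow> Q x t"
proof -
  define R where "R x s \<longleftrightarrow> s \<in> lev \<and> Q x s \<and> (\<forall>t\<in>N. t \<in> lev \<and> Q x t \<longrightarrow> sub s t)" for x s
  have "dfn False (\<lambda>v w. R (v 0) (v 1))"
    unfolding R_def by (intro dfn_intros dfn_subst2[OF Q] lev_class)
  moreover have "\<forall>x\<in>N. \<forall>y\<in>N. \<forall>z\<in>N. R x y \<and> R x z \<longrightarrow> y = z"
    unfolding R_def using sub_antisym by blast
  ultimately obtain b where
    b: "b \<in> N" "\<forall>y\<in>N. E y b \<longleftrightarrow> (\<exists>x\<in>N. E x a \<and> R x y)"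
    using replacement_ex[of R a] a by blast
  have t: "un b \<in> lev"
  proof (rule lev_un[OF b(1)])
    fix s assume "s \<in> N" "E s b"
    then obtain x where "R x s" using b(2) by blast
    then show "s \<in> lev" by (simp add: R_def)
  qed
  have "Q x (un b)" if x: "x \<in> N" "E x a" for x
  proof -
    have "dfn False (\<lambda>v w. Q x (v 0))" by (intro dfn_subst2[OF Q] dfn_intros x)
    from ex[OF x] lev_least[OF this] obtain s where s: "s \<in> lev" "R x s"
      unfolding R_def by blast
    then have "E s b" using b x lev_N by blast
    then have "sub s (un b)" using b(1) s(1) by (simp add: sub_un lev_N)
    then show ?thesis using up[OF x(1) s(1) t] s unfolding R_def by blast
  qed
  with t show ?thesis by blast
qed

text \<open>
  By induction along membership: if the elements of \<open>x\<close> lie in levels, then they lie in one level, so that \<open>x\<close>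
  is included in it and is an element of its power set.
\<close>

lemma lev_cover: "x \<in> N \<Longrightarrow> \<exists>s\<in>lev. E x s"
proof -
  assume x: "x \<in> N"
  have "\<exists>s\<in>N. s \<in> lev \<and> E x s"
  proof (rule set_induct[OF _ x, where Q = "\<lambda>x. \<exists>s\<in>N. s \<in> lev \<and> E x s"])
    show "dfn False (\<lambda>v w. \<exists>s\<in>N. s \<in> lev \<and> E (v 0) s)" by (intro dfn_intros lev_class)
    fix x assume x: "x \<in> N" and IH: "\<And>y. y \<in> N \<Longrightarrow> E y x \<Longrightarrow> \<exists>s\<in>N. s \<in> lev \<and> E y s"
    have "\<exists>t\<in>lev. \<forall>y\<in>N. E y x \<longrightarrow> E y t"
    proof (rule collect_levels[where Q = E])
      show "dfn False (\<lambda>v w. E (v 0) (v 1))" by (rule dfn_var_mem)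
      show "\<exists>s\<in>lev. E y s" if "y \<in> N" "E y x" for y using IH[OF that] by blast
    qed (use x subD in blast)+
    then obtain t where t: "t \<in> lev" "sub x t" by (auto simp: sub_in_def)
    then show "\<exists>s\<in>N. s \<in> lev \<and> E x s" using lev_pw[of t] lev_N[of t] x by (intro bexI[of _ "pw t"]) simp_all
  qed
  then show ?thesis by blast
qed

lemma collection:
  assumes Q: "dfn False (\<lambda>v w. Q (v 0) (v 1))" and a: "a \<in> N"
    and ex: "\<And>x. x \<in> N \<Longrightarrow> E x a \<Longrightarrow> \<exists>y\<in>N. Q x y"
  shows "\<exists>t\<in>lev. \<forall>x\<in>N. E x a \<longrightarrow> (\<exists>y\<in>N. E y t \<and> Q x y)"
proof (rule collect_levels[where Q = "\<lambda>x s. \<exists>y\<in>N. E y s \<and> Q x y"])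
  show "dfn False (\<lambda>v w. \<exists>y\<in>N. E y (v 1) \<and> Q (v 0) y)"
    by (intro dfn_intros dfn_subst2[OF Q])
  show "\<exists>s\<in>lev. \<exists>y\<in>N. E y s \<and> Q x y" if "x \<in> N" "E x a" for x
    using ex[OF that] lev_cover by blast
qed (use a subD in blast)+

text \<open>
  Without dependent choice there need not be a sequence of successive elements. Instead, passing from a
  level to the least level with all required successors is iterated, which yields a set that is closed
  under having some successor.
\<close>

lemma successor_closed_set_ex:
  assumes Q: "dfn False (\<lambda>v w. Q (v 0) (v 1))" and B: "B \<in> P" and x0: "x0 \<in> B"
    and step: "\<And>y. y \<in> B \<Longrightarrow> \<exists>q\<in>B. Q y q"
  shows "\<exists>W\<in>N. (\<exists>x\<in>N. E x W) \<and> (\<forall>y\<in>N. E y W \<longrightarrow> y \<in> B \<and> (\<exists>q\<in>N. E q W \<and> Q y q))"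
proof -
  have BN: "y \<in> N" if "y \<in> B" for y using that P_sub B by blast
  define S where "S s t \<longleftrightarrow> (\<forall>y\<in>N. E y s \<and> y \<in> B \<longrightarrow> (\<exists>q\<in>N. E q t \<and> q \<in> B \<and> Q y q))" for s t
  define R where "R s t \<longleftrightarrow> t \<in> lev \<and> S s t \<and> (\<forall>u\<in>N. u \<in> lev \<and> S s u \<longrightarrow> sub t u)" for s t
  have S: "dfn False (\<lambda>v w. S (v 0) (v 1))" unfolding S_def by (intro dfn_intros dfn_subst2[OF Q] B)
  have R: "dfn False (\<lambda>v w. R (v 0) (v 1))"
    unfolding R_def by (intro dfn_intros dfn_subst2[OF S] lev_class)
  have B': "dfn False (\<lambda>v w. v 0 \<in> B)" by (intro dfn_intros B)
  have "\<exists>t\<in>lev. R s t" if s: "s \<in> N" for s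
  proof -
    have "\<exists>t\<in>lev. \<forall>y\<in>N. E y (sep s (\<lambda>y. y \<in> B)) \<longrightarrow> (\<exists>q\<in>N. E q t \<and> (q \<in> B \<and> Q y q))"
    proof (rule collection)
      show "dfn False (\<lambda>v w. v 1 \<in> B \<and> Q (v 0) (v 1))" by (intro dfn_intros Q B)
      show "sep s (\<lambda>y. y \<in> B) \<in> N" by (rule sep(1)[OF B' s])
      show "\<exists>q\<in>N. q \<in> B \<and> Q y q" if "y \<in> N" "E y (sep s (\<lambda>y. y \<in> B))" for y
        using that step[of y] BN sep(2)[OF B' s] by blast
    qed
    then obtain t where t: "t \<in> lev" "S s t"
      using sep(2)[OF B' s] unfolding S_def by blast
    have "dfn False (\<lambda>v w. S s (v 0))" by (intro dfn_subst2[OF S] dfn_intros s)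
    from lev_least[OF this t] show ?thesis unfolding R_def by blast
  qed
  then have R_ex: "\<exists>t\<in>N. R s t" if "s \<in> N" for s using that lev_N by blast
  have R_fun: "t = t'" if "R s t" "R s t'" for s t t'
  proof -
    have "t \<in> N" "t' \<in> N" using that lev_N unfolding R_def by simp_all
    then show ?thesis using that sub_antisym[of t t'] unfolding R_def by simp
  qed
  define g where "g s = (THE t. t \<in> N \<and> R s t)" for s
  have g: "g s \<in> N" "R s (g s)" if s: "s \<in> N" for s
  proof -
    obtain t where "t \<in> N" "R s t" using R_ex[OF s] by blast
    then have "\<exists>!t. t \<in> N \<and> R s t" using R_fun by blast
    from theI'[OF this] show "g s \<in> N" "R s (g s)" by (simp_all add: g_def)
  qed
  have tm_g: "tm False (\<lambda>v w. g (v 0))"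
    unfolding tm_def
  proof (intro conjI allI impI)
    show "dfn False (\<lambda>v w. v 0 = g (v (Suc 0)))"
    proof (rule dfn_cong)
      show "dfn False (\<lambda>v w. R (v (Suc 0)) (v 0))" by (rule dfn_subst2[OF R]) (rule dfn_intros)+
      fix v w assume "range (v :: nat \<Rightarrow> 'a) \<subseteq> N"
      then have "v (Suc 0) \<in> N" by (rule subsetD) simp
      note * = g(2)[OF this]
      show "v 0 = g (v (Suc 0)) \<longleftrightarrow> R (v (Suc 0)) (v 0)"
      proof
        assume "R (v (Suc 0)) (v 0)"
        from R_fun[OF this *] show "v 0 = g (v (Suc 0))" .
      qed (simp add: *)
    qed
    fix v w assume "range (v :: nat \<Rightarrow> 'a) \<subseteq> N"
    then have "v 0 \<in> N" by (rule subsetD) simp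
    then show "g (v 0) \<in> N" by (rule g)
  qed
  obtain W where W: "W \<in> N" "E (up x0 x0) W" "\<forall>y\<in>N. E y W \<longrightarrow> E (g y) W"
    using closed_set_ex[OF tm_g up_in[OF BN[OF x0] BN[OF x0]]] by blast
  note w = sep[OF B' un_in[OF W(1)]]
  have "E x0 (un W)" using W(1,2) BN[OF x0] by auto
  then have "E x0 (sep (un W) (\<lambda>y. y \<in> B))" using x0 BN[OF x0] by (simp add: w)
  moreover have "\<exists>q\<in>N. E q (sep (un W) (\<lambda>y. y \<in> B)) \<and> Q y q"
    if y: "y \<in> N" "E y (sep (un W) (\<lambda>y. y \<in> B))" for y
  proof -
    from y obtain s where s: "s \<in> N" "E s W" "E y s" "y \<in> B" using W(1) by (auto simp: w)
    then obtain q where q: "q \<in> N" "E q (g s)" "q \<in> B" "Q y q" using g[OF s(1)] y(1) unfolding R_def S_def by blast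
    moreover from this have "E q (un W)"
      using W(1) W(3)[rule_format, OF s(1,2)] g(1)[OF s(1)] un_mem by blast
    ultimately show ?thesis by (auto simp: w)
  qed
  ultimately show ?thesis using w BN[OF x0] by blast
qed

end

section \<open>Ranking the lost positions of a game\<close>

context zf2
begin

context
  fixes Ext :: "'a \<Rightarrow> 'a \<Rightarrow> 'a \<Rightarrow> bool"
  assumes Ext: "dfn False (\<lambda>v w. Ext (v 0) (v 1) (v 2))"
    and Ext_anti: "\<forall>b\<in>N. \<forall>c\<in>N. \<forall>y\<in>N. \<forall>q\<in>N. sub b c \<longrightarrow> Ext c y q \<longrightarrow> Ext b y q"
begin

text \<open>
  Some challenge leaves only answers with \<open>Q\<close>. Since larger challenges allow fewer answers, these
  properties form a filter for each \<open>y\<close>, which is what makes stages comparable below.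
\<close>

definition forced :: "('a \<Rightarrow> bool) \<Rightarrow> 'a \<Rightarrow> bool" where
  "forced Q y \<longleftrightarrow> (\<exists>b\<in>N. \<forall>q\<in>N. Ext b y q \<longrightarrow> Q q)"

lemma forced_mono: "forced Q y \<Longrightarrow> (\<And>q. q \<in> N \<Longrightarrow> Q q \<Longrightarrow> R q) \<Longrightarrow> forced R y"
  unfolding forced_def by blast

lemma forced_conj:
  assumes "forced Q y" "forced R y" "y \<in> N" shows "forced (\<lambda>q. Q q \<and> R q) y"
proof -
  from assms obtain b c where b: "b \<in> N" "\<forall>q\<in>N. Ext b y q \<longrightarrow> Q q" and c: "c \<in> N" "\<forall>q\<in>N. Ext c y q \<longrightarrow> R q"
    unfolding forced_def by blast
  have "sub b (bun b c)" "sub c (bun b c)" using b c by (simp_all add: subI)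
  then have "Ext b y q \<and> Ext c y q" if "q \<in> N" "Ext (bun b c) y q" for q
    using Ext_anti b c that assms(3) bun_in by blast
  then show ?thesis unfolding forced_def using b c bun_in by blast
qed

lemma dfn_forced [dfn_intros]:
  assumes A: "dfn False (\<lambda>v w. A (v 0) (\<lambda>i. v (Suc i)) w)" and t: "tm False t"
  shows "dfn False (\<lambda>v w. forced (\<lambda>q. A q v w) (t v w))"
proof -
  have A': "dfn False (\<lambda>v w. A (v 0) (\<lambda>i. v (Suc (Suc i))) w)"
    using dfn_reindex[OF A, where f = "case_nat 0 (\<lambda>i. Suc (Suc i))" and g = id] by simp
  show ?thesis unfolding forced_def
    by (intro dfn_intros dfn_subst3[OF Ext] A' tm_reindex[OF t])
qed

definition lost :: "'a set" where "lost = lfpc (\<lambda>X. forced (\<lambda>q. q \<in> X))"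

lemma lost_op: "dfn False (\<lambda>v w. forced (\<lambda>q. q \<in> w 0) (v 0))"
  by (intro dfn_intros)

lemma lost_mono: "\<forall>X Y z. X \<subseteq> Y \<longrightarrow> forced (\<lambda>q. q \<in> X) z \<longrightarrow> forced (\<lambda>q. q \<in> Y) z"
  unfolding forced_def by blast

lemma lost_class: "lost \<in> P"
  unfolding lost_def by (rule lfpc_class[OF lost_op lost_mono])

lemma lost_iff: "y \<in> N \<Longrightarrow> y \<in> lost \<longleftrightarrow> forced (\<lambda>q. q \<in> lost) y"
  unfolding lost_def by (rule lfpc_unfold[OF lost_op lost_mono])

lemma lost_N: "y \<in> lost \<Longrightarrow> y \<in> N" using lost_class P_sub by blast

lemma lost_induct:
  assumes y: "y \<in> lost" and Q: "dfn False (\<lambda>v w. Q (v 0))"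
    and step: "\<And>y. y \<in> N \<Longrightarrow> forced Q y \<Longrightarrow> Q y"
  shows "Q y"
proof (rule lfpc_induct[OF lost_op lost_mono Q y[unfolded lost_def]])
  fix z assume z: "z \<in> N" "forced (\<lambda>q. q \<in> {x \<in> N. Q x}) z"
  have "forced Q z" using z(2) by (rule forced_mono) simp
  then show "Q z" by (rule step[OF z(1)])
qed

text \<open>
  Stage comparison in the style of Moschovakis: \<open>le p q\<close> expresses that \<open>p\<close> enters the class of lost positions and
  does so no later than \<open>q\<close>, and \<open>lt p q\<close> that \<open>q\<close> has not entered at the stage of \<open>p\<close>. The
  relation is itself inductively defined, by playing the two positions against each other, so neither ordinals nor
  class well-orders are involved.
\<close>

definition le_op :: "'a set \<Rightarrow> 'a \<Rightarrow> bool" where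
  "le_op X z \<longleftrightarrow> (\<exists>p\<in>N. \<exists>q\<in>N. z = pr p q \<and>
     forced (\<lambda>p'. \<not> forced (\<lambda>q'. \<not> pr p' q' \<in> X) q) p)"

definition le :: "'a \<Rightarrow> 'a \<Rightarrow> bool" where "le p q \<longleftrightarrow> pr p q \<in> lfpc le_op"

definition lt :: "'a \<Rightarrow> 'a \<Rightarrow> bool" where "lt p q \<longleftrightarrow> \<not> forced (\<lambda>q'. \<not> le p q') q"

lemma dfn_le_op: "dfn False (\<lambda>v w. le_op (w 0) (v 0))"
  unfolding le_op_def by (intro dfn_intros)

lemma le_op_mono: "\<forall>X Y z. X \<subseteq> Y \<longrightarrow> le_op X z \<longrightarrow> le_op Y z"
proof (intro allI impI)
  fix X Y :: "'a set" and z assume XY: "X \<subseteq> Y" and z: "le_op X z"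
  then obtain p q where p: "p \<in> N" "q \<in> N" "z = pr p q"
    "forced (\<lambda>p'. \<not> forced (\<lambda>q'. \<not> pr p' q' \<in> X) q) p" unfolding le_op_def by blast
  have "forced (\<lambda>p'. \<not> forced (\<lambda>q'. \<not> pr p' q' \<in> Y) q) p"
    using p(4)
  proof (rule forced_mono)
    fix p' assume *: "\<not> forced (\<lambda>q'. \<not> pr p' q' \<in> X) q"
    show "\<not> forced (\<lambda>q'. \<not> pr p' q' \<in> Y) q"
    proof
      assume "forced (\<lambda>q'. \<not> pr p' q' \<in> Y) q"
      then have "forced (\<lambda>q'. \<not> pr p' q' \<in> X) q" by (rule forced_mono) (use XY in blast)
      with * show False ..
    qed
  qed
  with p show "le_op Y z" unfolding le_op_def by blast
qed

lemma le_class: "lfpc le_op \<in> P" by (rule lfpc_class[OF dfn_le_op le_op_mono])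

lemma dfn_le [dfn_intros]: "tm False s \<Longrightarrow> tm False t \<Longrightarrow> dfn False (\<lambda>v w. le (s v w) (t v w))"
  unfolding le_def by (intro dfn_intros le_class)

lemma dfn_lt [dfn_intros]: "tm False s \<Longrightarrow> tm False t \<Longrightarrow> dfn False (\<lambda>v w. lt (s v w) (t v w))"
  by (rule dfn_subst2) (unfold lt_def, intro dfn_intros)

lemma le_iff:
  assumes "p \<in> N" "q \<in> N" shows "le p q \<longleftrightarrow> forced (\<lambda>p'. lt p' q) p"
proof -
  have "le p q \<longleftrightarrow> le_op (lfpc le_op) (pr p q)"
    unfolding le_def by (rule lfpc_unfold[OF dfn_le_op le_op_mono]) (use assms in simp)
  also have "\<dots> \<longleftrightarrow> forced (\<lambda>p'. \<not> forced (\<lambda>q'. \<not> pr p' q' \<in> lfpc le_op) q) p"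
    unfolding le_op_def using assms by auto
  finally show ?thesis by (simp add: lt_def le_def)
qed

lemma le_induct:
  assumes pq: "le p q" "p \<in> N" "q \<in> N" and Q: "dfn False (\<lambda>v w. Q (v 0) (v 1))"
    and step: "\<And>p q. p \<in> N \<Longrightarrow> q \<in> N \<Longrightarrow>
      forced (\<lambda>p'. \<not> forced (\<lambda>q'. \<not> Q p' q') q) p \<Longrightarrow> Q p q"
  shows "Q p q"
proof -
  define X where "X = {z \<in> N. \<exists>p\<in>N. \<exists>q\<in>N. z = pr p q \<and> Q p q}"
  have X: "X \<in> P" unfolding X_def by (rule comprehension) (intro dfn_intros dfn_subst2[OF Q])
  have X_iff: "pr p q \<in> X \<longleftrightarrow> Q p q" if "p \<in> N" "q \<in> N" for p q
    using that by (auto simp: X_def)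
  have "lfpc le_op \<subseteq> X"
  proof (rule lfpc_least[OF dfn_le_op le_op_mono X])
    fix z assume "z \<in> N" "le_op X z"
    then obtain p q where p: "p \<in> N" "q \<in> N" "z = pr p q"
      "forced (\<lambda>p'. \<not> forced (\<lambda>q'. \<not> pr p' q' \<in> X) q) p" unfolding le_op_def by blast
    have "forced (\<lambda>p'. \<not> forced (\<lambda>q'. \<not> Q p' q') q) p"
      using p(4)
    proof (rule forced_mono)
      fix p' assume p': "p' \<in> N" and *: "\<not> forced (\<lambda>q'. \<not> pr p' q' \<in> X) q"
      show "\<not> forced (\<lambda>q'. \<not> Q p' q') q"
      proof
        assume "forced (\<lambda>q'. \<not> Q p' q') q"
        then have "forced (\<lambda>q'. \<not> pr p' q' \<in> X) q" by (rule forced_mono) (use X_iff p' in blast)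
        with * show False ..
      qed
    qed
    from step[OF p(1,2) this] show "z \<in> X" using p X_iff by blast
  qed
  with pq X_iff show ?thesis unfolding le_def by blast
qed

lemma ltD:
  assumes "lt p q" "forced Q q" shows "\<exists>s\<in>N. Q s \<and> le p s"
proof (rule ccontr)
  assume "\<not> ?thesis"
  then have "forced (\<lambda>s. \<not> le p s) q" using assms(2) by (intro forced_mono[OF assms(2)]) blast
  with assms(1) show False by (simp add: lt_def)
qed

lemma le_trans:
  assumes "le p q" "le q r" and N: "p \<in> N" "q \<in> N" "r \<in> N" shows "le p r"
proof -
  have "\<forall>r\<in>N. le q r \<longrightarrow> le p r"
  proof (rule le_induct[OF assms(1) N(1,2), where Q = "\<lambda>p q. \<forall>r\<in>N. le q r \<longrightarrow> le p r"])
    show "dfn False (\<lambda>v w. \<forall>r\<in>N. le (v 1) r \<longrightarrow> le (v 0) r)" by (intro dfn_intros)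
    fix p q assume pq: "p \<in> N" "q \<in> N"
      "forced (\<lambda>p'. \<not> forced (\<lambda>q'. \<not> (\<forall>r\<in>N. le q' r \<longrightarrow> le p' r)) q) p"
    show "\<forall>r\<in>N. le q r \<longrightarrow> le p r"
    proof (intro ballI impI)
      fix r assume r: "r \<in> N" "le q r"
      then have q: "forced (\<lambda>q'. lt q' r) q" using pq by (simp add: le_iff)
      have "forced (\<lambda>p'. lt p' r) p" using pq(3)
      proof (rule forced_mono)
        fix p' assume *: "\<not> forced (\<lambda>q'. \<not> (\<forall>r\<in>N. le q' r \<longrightarrow> le p' r)) q"
        have "\<exists>q'\<in>N. lt q' r \<and> (\<forall>r\<in>N. le q' r \<longrightarrow> le p' r)"
        proof (rule ccontr)
          assume "\<not> ?thesis"
          then have "forced (\<lambda>q'. \<not> (\<forall>r\<in>N. le q' r \<longrightarrow> le p' r)) q" by (intro forced_mono[OF q]) blast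
          with * show False ..
        qed
        then obtain q' where q': "lt q' r" "\<forall>r\<in>N. le q' r \<longrightarrow> le p' r" by blast
        show "lt p' r" unfolding lt_def
        proof
          assume "forced (\<lambda>s. \<not> le p' s) r"
          then have "forced (\<lambda>s. \<not> le q' s) r" by (rule forced_mono) (use q' in blast)
          with q'(1) show False by (simp add: lt_def)
        qed
      qed
      then show "le p r" using pq r by (simp add: le_iff)
    qed
  qed
  with assms show ?thesis by blast
qed

text \<open>
  Well-foundedness below \<open>y\<close>, tested on classes.
\<close>

definition acc :: "'a \<Rightarrow> bool" where
  "acc y \<longleftrightarrow> (\<forall>B\<in>P. y \<in> B \<longrightarrow> (\<exists>m\<in>N. m \<in> B \<and> (\<forall>z\<in>N. z \<in> B \<longrightarrow> \<not> lt z m)))"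

lemma dfn_acc [dfn_intros]: "tm False t \<Longrightarrow> dfn False (\<lambda>v w. acc (t v w))"
  by (rule dfn_subst1) (unfold acc_def, intro dfn_intros)

lemma acc_intro:
  assumes y: "y \<in> N" and step: "\<forall>w\<in>N. lt w y \<longrightarrow> acc w" shows "acc y"
  unfolding acc_def
proof (intro ballI impI)
  fix B assume B: "B \<in> P" "y \<in> B"
  show "\<exists>m\<in>N. m \<in> B \<and> (\<forall>z\<in>N. z \<in> B \<longrightarrow> \<not> lt z m)"
  proof (cases "\<exists>w\<in>N. w \<in> B \<and> lt w y")
    case True
    then obtain w where "w \<in> N" "w \<in> B" "lt w y" by blast
    with step have "acc w" by blast
    with B(1) \<open>w \<in> B\<close> show ?thesis unfolding acc_def by blast
  next
    case False
    with y B(2) show ?thesis by blast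
  qed
qed

lemma acc_irrefl:
  assumes "acc y" "y \<in> N" shows "\<not> lt y y"
proof -
  define B where "B = {z \<in> N. z = y}"
  have B: "B \<in> P" unfolding B_def by (rule comprehension) (intro dfn_intros assms(2))
  have y: "y \<in> B" using assms(2) by (simp add: B_def)
  from bspec[OF assms(1)[unfolded acc_def] B] y
  obtain m where "m \<in> B" "\<forall>z\<in>N. z \<in> B \<longrightarrow> \<not> lt z m" by blast
  with assms(2) show ?thesis by (simp add: B_def)
qed

text \<open>
  The induction has to carry along everything that is below \<open>y\<close> in the sense of \<open>le\<close>, because
  a position strictly below such a \<open>z\<close> is compared with the answers at \<open>y\<close> only through an answer at \<open>z\<close>.
\<close>

lemma lost_acc:
  assumes "y \<in> lost" shows "acc y"
proof -
  have "acc y \<and> (\<forall>z\<in>N. le z y \<longrightarrow> acc z)"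
  proof (rule lost_induct[OF assms, where Q = "\<lambda>y. acc y \<and> (\<forall>z\<in>N. le z y \<longrightarrow> acc z)"])
    show "dfn False (\<lambda>v w. acc (v 0) \<and> (\<forall>z\<in>N. le z (v 0) \<longrightarrow> acc z))" by (intro dfn_intros)
    fix y assume y: "y \<in> N" and f: "forced (\<lambda>y. acc y \<and> (\<forall>z\<in>N. le z y \<longrightarrow> acc z)) y"
    show "acc y \<and> (\<forall>z\<in>N. le z y \<longrightarrow> acc z)"
    proof (intro conjI ballI impI)
      show "acc y"
      proof (rule acc_intro[OF y], intro ballI impI)
        fix w assume w: "w \<in> N" "lt w y"
        from ltD[OF w(2) f] w(1) show "acc w" by blast
      qed
      fix z assume z: "z \<in> N" "le z y"
      then have fz: "forced (\<lambda>p. lt p y) z" using y by (simp add: le_iff)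
      show "acc z"
      proof (rule acc_intro[OF z(1)], intro ballI impI)
        fix w assume w: "w \<in> N" "lt w z"
        from ltD[OF w(2) fz] obtain p where p: "p \<in> N" "lt p y" "le w p" by blast
        from ltD[OF p(2) f] obtain s where s: "s \<in> N" "\<forall>z\<in>N. le z s \<longrightarrow> acc z" "le p s" by blast
        from le_trans[OF p(3) s(3) w(1) p(1) s(1)] s w show "acc w" by blast
      qed
    qed
  qed
  then show ?thesis ..
qed

text \<open>
  If \<open>q\<close> is not strictly before \<open>y\<close>, then \<open>y\<close> forces both that \<open>q\<close> is not below its answers and that the answers
  are comparable with \<open>q\<close>; the filter property combines the two.
\<close>

lemma lost_compare:
  assumes "forced (\<lambda>y. \<forall>q\<in>N. lt y q \<or> le q y) y" and N: "y \<in> N" "q \<in> N"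
  shows "le y q \<or> lt q y"
proof (rule disjCI)
  assume "\<not> lt q y"
  then have "forced (\<lambda>s. \<not> le q s) y" by (simp add: lt_def)
  from forced_conj[OF assms(1) this N(1)] have "forced (\<lambda>s. lt s q) y"
    by (rule forced_mono) (use N in blast)
  then show "le y q" using N by (simp add: le_iff)
qed

lemma lost_compare':
  assumes "y \<in> lost" shows "\<forall>q\<in>N. lt y q \<or> le q y"
proof (rule lost_induct[OF assms, where Q = "\<lambda>y. \<forall>q\<in>N. lt y q \<or> le q y"])
  show "dfn False (\<lambda>v w. \<forall>q\<in>N. lt (v 0) q \<or> le q (v 0))" by (intro dfn_intros)
  fix y assume y: "y \<in> N" "forced (\<lambda>y. \<forall>q\<in>N. lt y q \<or> le q y) y"
  show "\<forall>q\<in>N. lt y q \<or> le q y"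
  proof (intro ballI disjCI)
    fix q assume q: "q \<in> N" "\<not> le q y"
    show "lt y q" unfolding lt_def
    proof
      assume "forced (\<lambda>s. \<not> le y s) q"
      then have "forced (\<lambda>s. lt s y) q"
        by (rule forced_mono) (use lost_compare[OF y(2,1)] in blast)
      with q y show False by (simp add: le_iff)
    qed
  qed
qed

text \<open>
  By comparability \<open>le y y\<close> or \<open>lt y y\<close>, and the latter is excluded by well-foundedness.
\<close>

lemma lost_refl:
  assumes "y \<in> lost" shows "forced (\<lambda>q. lt q y) y"
proof -
  have y: "y \<in> N" using assms by (rule lost_N)
  have "forced (\<lambda>q. q \<in> lost) y" using assms lost_iff[OF y] by simp
  then have "forced (\<lambda>y. \<forall>q\<in>N. lt y q \<or> le q y) y"
    by (rule forced_mono) (use lost_compare' in blast)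
  from lost_compare[OF this y y] acc_irrefl[OF lost_acc[OF assms] y] have "le y y" by blast
  with y show ?thesis by (simp add: le_iff)
qed

text \<open>
  The second conjunct, well-foundedness tested on sets, is a property of the initial segments of \<open>R\<close>
  that can be expressed without quantifying over classes; this is what an embedding can transport.
\<close>

theorem lost_ranked:
  "\<exists>R\<in>P. (\<forall>y\<in>lost. \<exists>b\<in>N. \<forall>q\<in>N. Ext b y q \<longrightarrow> q \<in> lost \<and> pr q y \<in> R) \<and>
     (\<forall>W\<in>N. \<forall>x\<in>N. E x W \<longrightarrow> (\<exists>y\<in>N. E y W \<and> (\<forall>q\<in>N. E q W \<longrightarrow> pr q y \<notin> R)))"
proof -
  define R where "R = {z \<in> N. \<exists>w\<in>N. \<exists>y\<in>N. z = pr w y \<and> y \<in> lost \<and> lt w y}"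
  have R: "R \<in> P" unfolding R_def by (rule comprehension) (intro dfn_intros lost_class)
  have R_iff: "pr w y \<in> R \<longleftrightarrow> y \<in> lost \<and> lt w y" if "w \<in> N" "y \<in> N" for w y
    using that by (auto simp: R_def)
  have 1: "\<exists>b\<in>N. \<forall>q\<in>N. Ext b y q \<longrightarrow> q \<in> lost \<and> pr q y \<in> R" if y: "y \<in> lost" for y
  proof -
    have N: "y \<in> N" using y by (rule lost_N)
    have "forced (\<lambda>q. q \<in> lost) y" using y lost_iff[OF N] by simp
    from forced_conj[OF this lost_refl[OF y] N]
    have "forced (\<lambda>q. q \<in> lost \<and> pr q y \<in> R) y" by (rule forced_mono) (use R_iff N y in blast)
    then show ?thesis by (simp add: forced_def)
  qed
  have 2: "\<exists>y\<in>N. E y W \<and> (\<forall>q\<in>N. E q W \<longrightarrow> pr q y \<notin> R)" if W: "W \<in> N" "x \<in> N" "E x W" for W x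
  proof (rule ccontr)
    assume no: "\<not> ?thesis"
    then have "x \<in> lost" using W R_iff by blast
    then have x: "acc x" by (rule lost_acc)
    define B where "B = {z \<in> N. E z W}"
    have B: "B \<in> P" unfolding B_def by (rule comprehension) (intro dfn_intros W(1))
    have xB: "x \<in> B" using W by (simp add: B_def)
    from bspec[OF x[unfolded acc_def] B] xB
    obtain m where "m \<in> N" "m \<in> B" "\<forall>z\<in>N. z \<in> B \<longrightarrow> \<not> lt z m" by blast
    then have m: "m \<in> N" "E m W" "\<forall>z\<in>N. E z W \<longrightarrow> \<not> lt z m" by (simp_all add: B_def)
    have "pr q m \<notin> R" if "q \<in> N" "E q W" for q using that m R_iff[of q m] by blast
    with no m(1,2) show False by blast
  qed
  show ?thesis
  proof (rule bexI[OF _ R], intro conjI ballI impI)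
    fix y assume "y \<in> lost" then show "\<exists>b\<in>N. \<forall>q\<in>N. Ext b y q \<longrightarrow> q \<in> lost \<and> pr q y \<in> R" by (rule 1)
  next
    fix W x assume "W \<in> N" "x \<in> N" "E x W"
    then show "\<exists>y\<in>N. E y W \<and> (\<forall>q\<in>N. E q W \<longrightarrow> pr q y \<notin> R)" by (rule 2)
  qed
qed

end

end

section \<open>Applying an embedding to classes\<close>

locale embedding = zf2 +
  fixes j :: "'a \<Rightarrow> 'a"
  assumes elem: "elementary_emb N E j" and graph: "graph_in N E j \<in> P"
begin

lemma j_in [simp]: "x \<in> N \<Longrightarrow> j x \<in> N"
  using elem by (auto simp: elementary_emb_def)

text \<open>
  The parameters of a pure definition are empty, hence fixed by \<open>j\<close>, so only the arguments move.
\<close>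

lemma elem_env:
  assumes Q: "dfn True Q" and v: "range v \<subseteq> N" and w: "range w \<subseteq> P"
  shows "Q v w \<longleftrightarrow> Q (j \<circ> v) w"
proof -
  obtain \<phi> p q where "defines_by True \<phi> p q Q" using Q by (rule dfnE)
  note 1 = defines_byD[OF this]
  have 1: "set_fm2 \<phi>" "range p \<subseteq> {emp}" "range q \<subseteq> P"
    "\<And>v w. range v \<subseteq> N \<Longrightarrow> range w \<subseteq> P \<Longrightarrow> Q v w \<longleftrightarrow> sat2 N E P \<phi> (mix v p) (mix w q)"
    using 1 by (simp_all add: cst_def)
  define \<psi> where "\<psi> = fm_of \<phi>"
  have \<psi>: "sat2 N E P \<phi> u x \<longleftrightarrow> sat N E j \<psi> u" for u x
    unfolding \<psi>_def by (rule sat_fm_of[symmetric]) (rule 1(1))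
  have pure: "pure_fm \<psi>" unfolding \<psi>_def by (rule fm_of_pure) (rule 1(1))
  have p: "p = (\<lambda>_. emp)" using 1(2) by (auto simp: fun_eq_iff)
  have inv: "sat N E j \<chi> u \<longleftrightarrow> sat N E j \<chi> (j \<circ> u)" if "pure_fm \<chi>" "range u \<subseteq> N" for \<chi> u
    using elem that by (simp add: elementary_emb_def)
  have "j emp = emp"
  proof -
    have "sat N E j (FAll 1 (FNeg (FMem 1 0))) (\<lambda>_. emp)" by simp
    then have "sat N E j (FAll 1 (FNeg (FMem 1 0))) (j \<circ> (\<lambda>_. emp))"
      by (subst (asm) inv) auto
    then show ?thesis by (intro extensionality) simp_all
  qed
  then have m: "j \<circ> mix v p = mix (j \<circ> v) p" by (auto simp: fun_eq_iff mix_def p)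
  have "range (mix v p) \<subseteq> N" by (rule mix_range) (use v p in auto)
  then have "sat N E j \<psi> (mix v p) \<longleftrightarrow> sat N E j \<psi> (mix (j \<circ> v) p)"
    using inv[OF pure] m by metis
  moreover have "range (j \<circ> v) \<subseteq> N" using v by (simp add: image_subset_iff)
  ultimately show ?thesis using 1(4)[OF v w] 1(4)[OF _ w, of "j \<circ> v"] \<psi> by blast
qed

lemma elem_list:
  assumes Q: "dfn True (\<lambda>v w. Q v)" and v: "range v \<subseteq> N"
  shows "Q v \<longleftrightarrow> Q (\<lambda>i. j (v i))"
  using elem_env[OF Q v, of "\<lambda>_. some_class"] by (simp add: comp_def)

definition env :: "'a list \<Rightarrow> nat \<Rightarrow> 'a" where
  "env xs i = (if i < length xs then xs ! i else emp)"

lemma env_range: "set xs \<subseteq> N \<Longrightarrow> range (env xs) \<subseteq> N"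
  by (auto simp: env_def)

lemma elem1:
  assumes "dfn True (\<lambda>v w. Q (v 0))" "x \<in> N" shows "Q x \<longleftrightarrow> Q (j x)"
  using elem_list[OF assms(1) env_range[of "[x]"]] assms(2) by (simp add: env_def)

lemma elem2:
  assumes "dfn True (\<lambda>v w. Q (v 0) (v 1))" "x \<in> N" "y \<in> N" shows "Q x y \<longleftrightarrow> Q (j x) (j y)"
  using elem_list[OF assms(1) env_range[of "[x, y]"]] assms(2-) by (simp add: env_def)

lemma elem3:
  assumes "dfn True (\<lambda>v w. Q (v 0) (v 1) (v 2))" "x \<in> N" "y \<in> N" "z \<in> N"
  shows "Q x y z \<longleftrightarrow> Q (j x) (j y) (j z)"
  using elem_list[OF assms(1) env_range[of "[x, y, z]"]] assms(2-) by (simp add: env_def)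

lemma elem4:
  assumes "dfn True (\<lambda>v w. Q (v 0) (v 1) (v 2) (v 3))" "x \<in> N" "y \<in> N" "z \<in> N" "u \<in> N"
  shows "Q x y z u \<longleftrightarrow> Q (j x) (j y) (j z) (j u)"
  using elem_list[OF assms(1) env_range[of "[x, y, z, u]"]] assms(2-)
  by (simp add: env_def numeral_3_eq_3)

lemma elem6:
  assumes "dfn True (\<lambda>v w. Q (v 0) (v 1) (v 2) (v 3) (v 4) (v 5))"
    "x \<in> N" "y \<in> N" "z \<in> N" "u \<in> N" "s \<in> N" "t \<in> N"
  shows "Q x y z u s t \<longleftrightarrow> Q (j x) (j y) (j z) (j u) (j s) (j t)"
  using elem_list[OF assms(1) env_range[of "[x, y, z, u, s, t]"]] assms(2-)
  by (simp add: env_def eval_nat_numeral)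

lemma j_emp [simp]: "j emp = emp"
  using elem1[of "\<lambda>x. x = emp" emp, OF dfn_eq[OF tm_var tm_emp] emp_in] by simp

lemma j_mem [simp]: "x \<in> N \<Longrightarrow> y \<in> N \<Longrightarrow> E (j x) (j y) \<longleftrightarrow> E x y"
  using elem2[of E x y, OF dfn_var_mem] by blast

lemma j_sub [simp]: "x \<in> N \<Longrightarrow> y \<in> N \<Longrightarrow> sub (j x) (j y) \<longleftrightarrow> sub x y"
  using elem2[of sub x y, OF dfn_sub[OF tm_var tm_var]] by blast

lemma j_fun1: "tm True (\<lambda>v w. f (v 0)) \<Longrightarrow> x \<in> N \<Longrightarrow> f x \<in> N \<Longrightarrow> j (f x) = f (j x)"
  using elem2[of "\<lambda>z x. z = f x" "f x" x] by (simp add: tm_def)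

lemma j_fun2: "tm True (\<lambda>v w. f (v 0) (v 1)) \<Longrightarrow> x \<in> N \<Longrightarrow> y \<in> N \<Longrightarrow> f x y \<in> N \<Longrightarrow>
    j (f x y) = f (j x) (j y)"
  using elem3[of "\<lambda>z x y. z = f x y" "f x y" x y] by (simp add: tm_def numeral_2_eq_2)

lemma j_pr [simp]: "x \<in> N \<Longrightarrow> y \<in> N \<Longrightarrow> j (pr x y) = pr (j x) (j y)"
  by (rule j_fun2) (simp_all add: tm_pr tm_var)

lemma j_up [simp]: "x \<in> N \<Longrightarrow> y \<in> N \<Longrightarrow> j (up x y) = up (j x) (j y)"
  by (rule j_fun2) (simp_all add: tm_up tm_var)

lemma j_un [simp]: "x \<in> N \<Longrightarrow> j (un x) = un (j x)"
  by (rule j_fun1) (simp_all add: tm_un tm_var)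

lemma j_pw [simp]: "x \<in> N \<Longrightarrow> j (pw x) = pw (j x)"
  by (rule j_fun1) (simp_all add: tm_pw tm_var)

lemma tm_j [dfn_intros]:
  assumes t: "tm False t" shows "tm False (\<lambda>v w. j (t v w))"
proof (rule tm_fun1[OF t])
  show "tm False (\<lambda>v w. j (v 0))" unfolding tm_def
  proof (intro conjI allI impI)
    fix v w assume "range (v :: nat \<Rightarrow> 'a) \<subseteq> N"
    then have "v 0 \<in> N" by (rule subsetD) simp
    then show "j (v 0) \<in> N" by simp
  next
    show "dfn False (\<lambda>v w. v 0 = j (v (Suc 0)))"
    proof (rule dfn_cong)
      show "dfn False (\<lambda>v w. pr (v (Suc 0)) (v 0) \<in> graph_in N E j)" by (intro dfn_intros graph)
      fix v w assume "range (v :: nat \<Rightarrow> 'a) \<subseteq> N"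
      then have "v 0 \<in> N" "v (Suc 0) \<in> N" by (auto intro: subsetD)
      then show "v 0 = j (v (Suc 0)) \<longleftrightarrow> pr (v (Suc 0)) (v 0) \<in> graph_in N E j"
        by (auto simp: graph_in_def opair_iff)
    qed
  qed
qed

text \<open>
  By induction along membership: if every element of \<open>b\<close> lies in some \<open>j g\<close>, then \<open>b\<close> is included in
  \<open>j g\<close> for the union of suitable \<open>g\<close>, and belongs to \<open>j (pw g)\<close>.
\<close>

lemma j_cofinal:
  assumes "b \<in> N" shows "\<exists>g\<in>N. sub b (j g)"
proof -
  have "\<exists>g\<in>N. E b (j g)"
  proof (rule set_induct[OF _ assms, where Q = "\<lambda>b. \<exists>g\<in>N. E b (j g)"])
    show "dfn False (\<lambda>v w. \<exists>g\<in>N. E (v 0) (j g))" by (intro dfn_intros)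
    fix b assume b: "b \<in> N" and IH: "\<And>y. y \<in> N \<Longrightarrow> E y b \<Longrightarrow> \<exists>g\<in>N. E y (j g)"
    have "\<exists>t\<in>lev. \<forall>y\<in>N. E y b \<longrightarrow> (\<exists>g\<in>N. E g t \<and> E y (j g))"
    proof (rule collection[OF _ b])
      show "dfn False (\<lambda>v w. E (v 0) (j (v 1)))" by (intro dfn_intros)
    qed (rule IH)
    then obtain t where t: "t \<in> lev" "\<forall>y\<in>N. E y b \<longrightarrow> (\<exists>g\<in>N. E g t \<and> E y (j g))" by blast
    have tN: "t \<in> N" using t(1) by (rule lev_N)
    have "sub b (j (un t))"
    proof (rule subI)
      fix y assume y: "y \<in> N" "E y b"
      with t obtain g where g: "g \<in> N" "E g t" "E y (j g)" by blast
      have "sub (j g) (j (un t))" using g tN by (simp add: sub_un)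
      then show "E y (j (un t))" using y(1) g(3) by (rule subD)
    qed
    then have "E b (j (pw (un t)))" using b tN by simp
    then show "\<exists>g\<in>N. E b (j g)" using tN by (intro bexI[of _ "pw (un t)"]) simp_all
  qed
  then obtain g where g: "g \<in> N" "E b (j g)" by blast
  then have "sub b (j (un g))" using assms by (simp add: sub_un)
  with g show ?thesis by (intro bexI[of _ "un g"]) simp_all
qed

definition cap :: "'a set \<Rightarrow> 'a \<Rightarrow> 'a" where "cap C g = sep g (\<lambda>z. z \<in> C)"

text \<open>
  The action of \<open>j\<close> on classes.
\<close>

definition jh :: "'a set \<Rightarrow> 'a set" where "jh C = {z \<in> N. \<exists>g\<in>N. E z (j (cap C g))}"

lemma cap:
  assumes "C \<in> P" "g \<in> N"
  shows "cap C g \<in> N" "z \<in> N \<Longrightarrow> E z (cap C g) \<longleftrightarrow> E z g \<and> z \<in> C"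
proof -
  have "dfn False (\<lambda>v w. v 0 \<in> C)" by (intro dfn_intros assms)
  from sep[OF this assms(2)] show "cap C g \<in> N" "z \<in> N \<Longrightarrow> E z (cap C g) \<longleftrightarrow> E z g \<and> z \<in> C"
    by (simp_all add: cap_def)
qed

lemma jh_class: "C \<in> P \<Longrightarrow> jh C \<in> P"
  unfolding jh_def cap_def by (rule comprehension) (intro dfn_intros)

lemma jhI: "g \<in> N \<Longrightarrow> z \<in> N \<Longrightarrow> E z (j (cap C g)) \<Longrightarrow> z \<in> jh C"
  unfolding jh_def by blast

text \<open>
  Any two segments of \<open>C\<close> agree on the intersection of their domains, and therefore so do their images.
\<close>

lemma jhD:
  assumes C: "C \<in> P" and z: "z \<in> jh C" and g: "g \<in> N" "E z (j g)"
  shows "E z (j (cap C g))"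
proof -
  from z obtain h where h: "z \<in> N" "h \<in> N" "E z (j (cap C h))" unfolding jh_def by blast
  have "\<forall>z\<in>N. E z (cap C h) \<and> E z g \<longrightarrow> E z (cap C g)" using cap[OF C] h g by simp
  moreover have "dfn True (\<lambda>v w. \<forall>z\<in>N. E z (v 0) \<and> E z (v 1) \<longrightarrow> E z (v 2))" by (intro dfn_intros)
  ultimately have "\<forall>z\<in>N. E z (j (cap C h)) \<and> E z (j g) \<longrightarrow> E z (j (cap C g))"
    using elem3[of "\<lambda>x y u. \<forall>z\<in>N. E z x \<and> E z y \<longrightarrow> E z u" "cap C h" g "cap C g"] cap[OF C] h g by blast
  with h g show ?thesis by blast
qed

text \<open>
  Suppose that a self-sustaining class \<open>S\<close> meets the image of the class of lost positions. At a position in both,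
  the image of the challenge that witnesses losing has an answer in \<open>S\<close>. By elementarity this answer
  belongs to the image again and is smaller in the image of the ranking relation. So the intersection
  has no minimal element. A set reflecting this contradicts the well-foundedness of \<open>R\<close> on sets, transported by \<open>j\<close>.
\<close>

theorem self_sustaining_not_lost:
  fixes X :: "'a \<Rightarrow> 'a \<Rightarrow> 'a \<Rightarrow> 'a \<Rightarrow> bool"
  assumes X: "dfn True (\<lambda>v w. X (v 0) (v 1) (v 2) (v 3))"
    and anti: "\<forall>b\<in>N. \<forall>c\<in>N. \<forall>y\<in>N. \<forall>q\<in>N. sub b c \<longrightarrow> X a c y q \<longrightarrow> X a b y q"
    and a: "a \<in> N" "j a = a"
    and S: "S \<in> P" "\<And>y b. y \<in> S \<Longrightarrow> b \<in> N \<Longrightarrow> \<exists>q\<in>S. X a b y q"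
    and Xd: "dfn False (\<lambda>v w. X a (v 0) (v 1) (v 2))"
  shows "S \<inter> jh (lost (X a)) = {}"
proof (rule ccontr)
  assume ne: "S \<inter> jh (lost (X a)) \<noteq> {}"
  define L where "L = lost (X a)"
  have L: "L \<in> P" unfolding L_def by (rule lost_class[OF Xd anti])
  obtain R where R: "R \<in> P"
    and R1: "\<forall>y\<in>L. \<exists>b\<in>N. \<forall>q\<in>N. X a b y q \<longrightarrow> q \<in> L \<and> pr q y \<in> R"
    and R2: "\<forall>W\<in>N. \<forall>x\<in>N. E x W \<longrightarrow> (\<exists>y\<in>N. E y W \<and> (\<forall>q\<in>N. E q W \<longrightarrow> pr q y \<notin> R))"
    using lost_ranked[OF Xd anti] unfolding L_def by blast
  define B where "B = {y \<in> N. y \<in> S \<and> y \<in> jh L}"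
  have B: "B \<in> P" unfolding B_def by (rule comprehension) (intro dfn_intros S jh_class L)
  obtain y0 where y0: "y0 \<in> B" using ne S(1) P_sub unfolding B_def L_def by blast
  have step: "\<exists>q\<in>B. pr q y \<in> jh R" if y: "y \<in> B" for y
  proof -
    from y obtain g where g: "y \<in> N" "y \<in> S" "g \<in> N" "E y (j (cap L g))"
      unfolding B_def jh_def by blast
    note l = cap[OF L g(3)]
    \<comment> \<open>one challenge \<open>t\<close> that works for all lost positions in \<open>g\<close>\<close>
    have "\<exists>t\<in>lev. \<forall>y\<in>N. E y (cap L g) \<longrightarrow> (\<forall>q\<in>N. X a t y q \<longrightarrow> q \<in> L \<and> pr q y \<in> R)"
    proof (rule collect_levels[OF _ l(1)])
      show "dfn False (\<lambda>v w. \<forall>q\<in>N. X a (v 1) (v 0) q \<longrightarrow> q \<in> L \<and> pr q (v 0) \<in> R)"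
        by (intro dfn_intros dfn_subst3[OF Xd] L R)
      show "\<exists>t\<in>lev. \<forall>q\<in>N. X a t y q \<longrightarrow> q \<in> L \<and> pr q y \<in> R" if y: "y \<in> N" "E y (cap L g)" for y
      proof -
        from y l R1 obtain b where b: "b \<in> N" "\<forall>q\<in>N. X a b y q \<longrightarrow> q \<in> L \<and> pr q y \<in> R" by blast
        obtain t where t: "t \<in> lev" "E b t" using lev_cover[OF b(1)] by blast
        have "sub b t" using lev_trans[OF t(1) b(1) t(2)] .
        have tN: "t \<in> N" using t(1) by (rule lev_N)
        have "q \<in> L \<and> pr q y \<in> R" if "q \<in> N" "X a t y q" for q
        proof -
          have "X a b y q" using anti[rule_format, OF b(1) tN y(1) that(1) \<open>sub b t\<close> that(2)] .
          with b(2) that(1) show ?thesis by blast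
        qed
        with t(1) show ?thesis by blast
      qed
    next
      show "\<forall>q\<in>N. X a t y q \<longrightarrow> q \<in> L \<and> pr q y \<in> R"
        if "y \<in> N" "s \<in> lev" "t \<in> lev" "sub s t" "\<forall>q\<in>N. X a s y q \<longrightarrow> q \<in> L \<and> pr q y \<in> R" for y s t
      proof (intro ballI impI)
        fix q assume q: "q \<in> N" "X a t y q"
        have "X a s y q"
          using anti[rule_format, OF lev_N[OF that(2)] lev_N[OF that(3)] that(1) q(1) that(4) q(2)] .
        with that(5) q(1) show "q \<in> L \<and> pr q y \<in> R" by blast
      qed
    qed
    then obtain t where t: "t \<in> lev"
      "\<forall>y\<in>N. E y (cap L g) \<longrightarrow> (\<forall>q\<in>N. X a t y q \<longrightarrow> q \<in> L \<and> pr q y \<in> R)" by blast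
    have tN: "t \<in> N" using t(1) by (rule lev_N)
    obtain q where q: "q \<in> S" "X a (j t) y q" using S(2)[OF g(2), of "j t"] tN by auto
    have qN: "q \<in> N" using q(1) S(1) P_sub by blast
    \<comment> \<open>a set whose image contains the answer \<open>q\<close> and the pair to be put into the ranking\<close>
    obtain h where h: "h \<in> N" "sub (up q (pr q y)) (j h)"
      using j_cofinal[of "up q (pr q y)"] qN g(1) by auto
    have qh: "E q (j h)" "E (pr q y) (j h)"
      by (rule subD[OF h(2)]; use qN g(1) in simp)+
    note lh = cap[OF L h(1)] and rh = cap[OF R h(1)]
    define F where "F a t l h m r \<longleftrightarrow> (\<forall>y\<in>N. \<forall>q\<in>N. E y l \<and> E q h \<and> E (pr q y) h \<and> X a t y q \<longrightarrow>
        E q m \<and> E (pr q y) r)" for a t l h m r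
    have "dfn True (\<lambda>v w. F (v 0) (v 1) (v 2) (v 3) (v 4) (v 5))"
      unfolding F_def by (intro dfn_intros dfn_subst4[OF X])
    moreover have "F a t (cap L g) h (cap L h) (cap R h)"
      unfolding F_def
    proof (intro ballI impI, elim conjE)
      fix y q assume yq: "y \<in> N" "q \<in> N" "E y (cap L g)" "E q h" "E (pr q y) h" "X a t y q"
      then have "q \<in> L" "pr q y \<in> R" using t(2) by blast+
      with yq show "E q (cap L h) \<and> E (pr q y) (cap R h)" using lh(2) rh(2) by simp
    qed
    ultimately have "F (j a) (j t) (j (cap L g)) (j h) (j (cap L h)) (j (cap R h))"
      using elem6[of F, OF _ a(1) tN l(1) h(1) lh(1) rh(1)] by simp
    then have "E q (j (cap L h))" "E (pr q y) (j (cap R h))"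
      unfolding F_def a(2) using g(1,4) qN q(2) qh by blast+
    then have "q \<in> jh L" "pr q y \<in> jh R" using jhI[OF h(1)] qN g(1) by simp_all
    with qN q(1) show ?thesis unfolding B_def by blast
  qed
  have "dfn False (\<lambda>v w. pr (v 1) (v 0) \<in> jh R)" by (intro dfn_intros jh_class R)
  from successor_closed_set_ex[of "\<lambda>y q. pr q y \<in> jh R", OF this B y0 step]
  obtain W where W: "W \<in> N" "\<exists>x\<in>N. E x W"
    "\<forall>y\<in>N. E y W \<longrightarrow> y \<in> B \<and> (\<exists>q\<in>N. E q W \<and> pr q y \<in> jh R)" by blast
  obtain g where g: "g \<in> N" "sub (pw (pw W)) (j g)" using j_cofinal[of "pw (pw W)"] W(1) by auto
  note r = cap[OF R g(1)]
  have "\<forall>W\<in>N. \<forall>x\<in>N. E x W \<longrightarrow> (\<exists>y\<in>N. E y W \<and> (\<forall>q\<in>N. E q W \<longrightarrow> \<not> E (pr q y) (cap R g)))"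
  proof (intro ballI impI)
    fix W x assume "W \<in> N" "x \<in> N" "E x W"
    with R2 obtain y where y: "y \<in> N" "E y W" "\<forall>q\<in>N. E q W \<longrightarrow> pr q y \<notin> R" by blast
    then have "\<forall>q\<in>N. E q W \<longrightarrow> \<not> E (pr q y) (cap R g)" using r(2) by simp
    with y show "\<exists>y\<in>N. E y W \<and> (\<forall>q\<in>N. E q W \<longrightarrow> \<not> E (pr q y) (cap R g))" by blast
  qed
  moreover have "dfn True (\<lambda>v w. \<forall>W\<in>N. \<forall>x\<in>N. E x W \<longrightarrow>
      (\<exists>y\<in>N. E y W \<and> (\<forall>q\<in>N. E q W \<longrightarrow> \<not> E (pr q y) (v 0))))" by (intro dfn_intros)
  ultimately have "\<forall>W\<in>N. \<forall>x\<in>N. E x W \<longrightarrow>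
      (\<exists>y\<in>N. E y W \<and> (\<forall>q\<in>N. E q W \<longrightarrow> \<not> E (pr q y) (j (cap R g))))"
    using elem1[of "\<lambda>r. \<forall>W\<in>N. \<forall>x\<in>N. E x W \<longrightarrow>
      (\<exists>y\<in>N. E y W \<and> (\<forall>q\<in>N. E q W \<longrightarrow> \<not> E (pr q y) r))" "cap R g", OF _ r(1)] by simp
  with W(1,2) obtain y where y: "y \<in> N" "E y W" "\<forall>q\<in>N. E q W \<longrightarrow> \<not> E (pr q y) (j (cap R g))" by blast
  from W(3) y obtain q where q: "q \<in> N" "E q W" "pr q y \<in> jh R" by blast
  have "E (pr q y) (pw (pw W))" using W(1) y(1,2) q(1,2) by (simp add: pr_def sub_in_def)
  then have "E (pr q y) (j g)" using subD[OF g(2)] q y by simp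
  from jhD[OF R q(3) g(1) this] y q show False by blast
qed

end

section \<open>Coding formulas and assignments\<close>

context zf2
begin

text \<open>
  Names for variables and tags. Any injective enumeration by hereditarily finite sets would do.
\<close>

primrec num :: "nat \<Rightarrow> 'a" where
  "num 0 = emp"
| "num (Suc n) = up (num n) (num n)"

lemma num_in [simp]: "num n \<in> N" by (induction n) simp_all

lemma num_inj [simp]: "num n = num m \<longleftrightarrow> n = m"
proof (induction n arbitrary: m)
  case 0
  show ?case
  proof (cases m)
    case (Suc k)
    have "num k \<in> N" "E (num k) (num (Suc k))" by simp_all
    then have "num (Suc k) \<noteq> emp" using emp_mem[of "num k"] by metis
    then show ?thesis using Suc by auto
  qed simp
next
  case (Suc n)
  show ?case
  proof (cases m)
    case 0
    have "num n \<in> N" "E (num n) (num (Suc n))" by simp_all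
    then have "num (Suc n) \<noteq> emp" using emp_mem[of "num n"] by metis
    then show ?thesis using 0 by auto
  next
    case (Suc k)
    have "up (num n) (num n) = up (num k) (num k) \<longleftrightarrow> num n = num k"
      using upD[of "num n" "num n" "num k" "num k"] by auto
    then show ?thesis using Suc Suc.IH by simp
  qed
qed

lemma tm_num [dfn_intros]: "tm b (\<lambda>v w. num n)"
proof (induction n)
  case 0 show ?case by (simp add: tm_emp)
next
  case (Suc n) then show ?case by (simp add: tm_up)
qed

definition con :: "nat \<Rightarrow> 'a \<Rightarrow> 'a \<Rightarrow> 'a" where "con n x y = pr (num n) (pr x y)"

lemma con_in [simp]: "x \<in> N \<Longrightarrow> y \<in> N \<Longrightarrow> con n x y \<in> N" by (simp add: con_def)

lemma con_inj [simp]: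
  "x \<in> N \<Longrightarrow> y \<in> N \<Longrightarrow> x' \<in> N \<Longrightarrow> y' \<in> N \<Longrightarrow>
   con n x y = con m x' y' \<longleftrightarrow> n = m \<and> x = x' \<and> y = y'"
  by (simp add: con_def)

lemma tm_con [dfn_intros]: "tm b s \<Longrightarrow> tm b t \<Longrightarrow> tm b (\<lambda>v w. con n (s v w) (t v w))"
  unfolding con_def by (intro dfn_intros)

text \<open>
  The value of variable \<open>i\<close> under the assignment coded by \<open>s\<close>. Taking the union of all candidates makes the
  value defined for every \<open>s\<close>, so that every set is an assignment.
\<close>

definition val :: "'a \<Rightarrow> 'a \<Rightarrow> 'a" where
  "val s i = the_set (\<lambda>z. \<exists>x\<in>N. E (pr i x) s \<and> E z x)"

lemma val_ex:
  assumes s: "s \<in> N" and i: "i \<in> N"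
  shows "\<exists>b\<in>N. \<forall>z\<in>N. E z b \<longleftrightarrow> (\<exists>x\<in>N. E (pr i x) s \<and> E z x)"
proof -
  have "dfn False (\<lambda>v w. \<exists>x\<in>N. E (pr i x) s \<and> E (v 0) x)" by (intro dfn_intros s i)
  from separation_ex[OF this, of "un (un (un s))"] s obtain b where
    b: "b \<in> N" "\<forall>z\<in>N. E z b \<longleftrightarrow> E z (un (un (un s))) \<and> (\<exists>x\<in>N. E (pr i x) s \<and> E z x)"
    by auto
  have un_memI: "E z (un a)" if "a \<in> N" "y \<in> N" "z \<in> N" "E y a" "E z y" for a y z
    using that by (auto simp: un_mem)
  have "E z (un (un (un s)))" if "z \<in> N" "x \<in> N" "E (pr i x) s" "E z x" for z x
  proof -
    have "E (up i x) (un s)" by (rule un_memI[OF s _ _ that(3)]) (use that(2) i in \<open>simp_all add: pr_def\<close>)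
    then have "E x (un (un s))" by (rule un_memI[rotated 3]) (use that(2) s i in simp_all)
    then show ?thesis using that(4) by (rule un_memI[rotated 3]) (use that(1,2) s in simp_all)
  qed
  with b show ?thesis by (intro bexI[of _ b]) blast+
qed

lemma val_in [simp]: "s \<in> N \<Longrightarrow> i \<in> N \<Longrightarrow> val s i \<in> N"
  and val_mem: "s \<in> N \<Longrightarrow> i \<in> N \<Longrightarrow> z \<in> N \<Longrightarrow>
    E z (val s i) \<longleftrightarrow> (\<exists>x\<in>N. E (pr i x) s \<and> E z x)"
  using the_set[OF val_ex] by (simp_all add: val_def)

lemma tm_val [dfn_intros]: "tm b s \<Longrightarrow> tm b t \<Longrightarrow> tm b (\<lambda>v w. val (s v w) (t v w))"
  by (erule (1) tm_fun2) (unfold val_def, rule tm_the_set, intro dfn_intros, simp add: val_ex image_subset_iff)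

text \<open>
  \<open>s'\<close> is obtained from \<open>s\<close> by changing the value of variable \<open>n\<close>.
\<close>

definition agr :: "'a \<Rightarrow> 'a \<Rightarrow> 'a \<Rightarrow> bool" where
  "agr n s s' \<longleftrightarrow> (\<forall>i\<in>N. i \<noteq> n \<longrightarrow> val s' i = val s i)"

lemma dfn_agr [dfn_intros]:
  "tm b t \<Longrightarrow> tm b s \<Longrightarrow> tm b r \<Longrightarrow> dfn b (\<lambda>v w. agr (t v w) (s v w) (r v w))"
  by (rule dfn_subst3) (unfold agr_def, intro dfn_intros)

lemma update_ex:
  assumes N: "n \<in> N" "s \<in> N" "x \<in> N"
  shows "\<exists>s'\<in>N. agr n s s' \<and> val s' n = x"
proof -
  define Q where "Q z \<longleftrightarrow> (\<forall>y\<in>N. z \<noteq> pr n y)" for z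
  have Q: "dfn False (\<lambda>v w. Q (v 0))" unfolding Q_def by (intro dfn_intros N)
  note r = sep[OF Q N(2)]
  define s' where "s' = bun (sep s Q) (up (pr n x) (pr n x))"
  have s': "s' \<in> N" unfolding s'_def using r N by simp
  have mem: "E z s' \<longleftrightarrow> E z s \<and> Q z \<or> z = pr n x" if "z \<in> N" for z
    unfolding s'_def using r N that by simp
  have "val s' i = val s i" if i: "i \<in> N" "i \<noteq> n" for i
  proof (rule extensionality)
    fix z assume z: "z \<in> N"
    have "E (pr i y) s' \<longleftrightarrow> E (pr i y) s" if "y \<in> N" for y
      using that i N by (simp add: mem Q_def)
    then show "E z (val s' i) \<longleftrightarrow> E z (val s i)" using i z N s' by (simp add: val_mem)
  qed (use N i s' in simp_all)
  moreover have "val s' n = x"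
  proof (rule extensionality)
    fix z assume z: "z \<in> N"
    have "E (pr n y) s' \<longleftrightarrow> y = x" if "y \<in> N" for y
      using that N by (auto simp: mem Q_def)
    then show "E z (val s' n) \<longleftrightarrow> E z x" using z N s' by (auto simp: val_mem)
  qed (use N s' in simp_all)
  ultimately show ?thesis using s' unfolding agr_def by blast
qed

definition vals :: "'a \<Rightarrow> nat \<Rightarrow> 'a" where "vals s i = val s (num i)"

lemma vals_in: "s \<in> N \<Longrightarrow> vals s i \<in> N" by (simp add: vals_def)

lemma agr_vals: "agr (num n) s s' \<Longrightarrow> vals s' = (vals s)(n := val s' (num n))"
  by (auto simp: fun_eq_iff vals_def agr_def)

lemma vals_prefix_ex:
  assumes "range v \<subseteq> N" shows "\<exists>s\<in>N. \<forall>i<m. vals s i = v i"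
proof (induction m)
  case 0 show ?case by (intro bexI[of _ emp]) simp_all
next
  case (Suc m)
  then obtain s where s: "s \<in> N" "\<forall>i<m. vals s i = v i" by blast
  have "v m \<in> N" using assms by auto
  with update_ex[of "num m" s] s(1) obtain s' where
    s': "s' \<in> N" "agr (num m) s s'" "val s' (num m) = v m" by auto
  have "vals s' = (vals s)(m := v m)" using agr_vals[OF s'(2)] s'(3) by simp
  then have "\<forall>i<Suc m. vals s' i = v i" using s(2) by (auto simp: less_Suc_eq)
  with s'(1) show ?case by blast
qed

text \<open>
  The code of \<open>\<phi>\<close> if \<open>b\<close> holds and of its negation otherwise, in negation normal form; hence there is no code
  for negation, and the clauses for truth below are positive. The tags are \<open>0, ..., 5\<close> for atomic formulas and
  their negations, \<open>6\<close> and \<open>7\<close> for conjunction and disjunction, \<open>8\<close> and \<open>9\<close> for the quantifiers.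
\<close>

primrec cd :: "fm \<Rightarrow> bool \<Rightarrow> 'a" where
  "cd (FEq i k) b = con (if b then 0 else 1) (num i) (num k)"
| "cd (FMem i k) b = con (if b then 2 else 3) (num i) (num k)"
| "cd (FJ i k) b = con (if b then 4 else 5) (num i) (num k)"
| "cd (FNeg \<phi>) b = cd \<phi> (\<not> b)"
| "cd (FAnd \<phi> \<psi>) b = con (if b then 6 else 7) (cd \<phi> b) (cd \<psi> b)"
| "cd (FAll n \<phi>) b = con (if b then 8 else 9) (num n) (cd \<phi> b)"

lemma cd_in [simp]: "cd \<phi> b \<in> N"
  by (induction \<phi> arbitrary: b) simp_all

text \<open>
  The set that records that the embedding maps \<open>x\<close> to \<open>y\<close>; the tag \<open>10\<close> keeps it apart from the pairs of a code
  and an assignment.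
\<close>

definition jf :: "'a \<Rightarrow> 'a \<Rightarrow> 'a" where "jf x y = pr (con 10 x x) y"

lemma jf_in [simp]: "x \<in> N \<Longrightarrow> y \<in> N \<Longrightarrow> jf x y \<in> N" by (simp add: jf_def)

lemma tm_jf [dfn_intros]: "tm b s \<Longrightarrow> tm b t \<Longrightarrow> tm b (\<lambda>v w. jf (s v w) (t v w))"
  unfolding jf_def by (rule tm_fun2[where f = "\<lambda>x y. pr (con 10 x x) y"]) (assumption | intro dfn_intros)+

text \<open>
  The universal clauses for a class \<open>X\<close> of facts about an embedding with critical point \<open>\<mu>\<close>, as far as the facts lie
  in \<open>U\<close>. The embedding is a function that fixes the elements of \<open>\<mu>\<close> and moves \<open>\<mu>\<close>, facts about atomic formulas
  are correct, facts about conjunctions and universal formulas entail their instances, and the formulas with code in \<open>a\<close>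
  hold under all assignments.
\<close>

definition coh :: "'a \<Rightarrow> 'a \<Rightarrow> ('a \<Rightarrow> bool) \<Rightarrow> ('a \<Rightarrow> bool) \<Rightarrow> bool" where
  "coh a \<mu> U X \<longleftrightarrow>
    (\<forall>z\<in>N. \<forall>y\<in>N. \<forall>y'\<in>N. X (jf z y) \<longrightarrow> X (jf z y') \<longrightarrow> y = y') \<and>
    (\<forall>z\<in>N. \<forall>y\<in>N. E z \<mu> \<longrightarrow> X (jf z y) \<longrightarrow> y = z) \<and>
    \<not> X (jf \<mu> \<mu>) \<and>
    (\<forall>i\<in>N. \<forall>k\<in>N. \<forall>s\<in>N. X (pr (con 0 i k) s) \<longrightarrow> val s i = val s k) \<and>
    (\<forall>i\<in>N. \<forall>k\<in>N. \<forall>s\<in>N. X (pr (con 1 i k) s) \<longrightarrow> val s i \<noteq> val s k) \<and>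
    (\<forall>i\<in>N. \<forall>k\<in>N. \<forall>s\<in>N. X (pr (con 2 i k) s) \<longrightarrow> E (val s i) (val s k)) \<and>
    (\<forall>i\<in>N. \<forall>k\<in>N. \<forall>s\<in>N. X (pr (con 3 i k) s) \<longrightarrow> \<not> E (val s i) (val s k)) \<and>
    (\<forall>i\<in>N. \<forall>k\<in>N. \<forall>s\<in>N. \<forall>y\<in>N. X (pr (con 4 i k) s) \<longrightarrow> X (jf (val s i) y) \<longrightarrow> y = val s k) \<and>
    (\<forall>i\<in>N. \<forall>k\<in>N. \<forall>s\<in>N. X (pr (con 5 i k) s) \<longrightarrow> \<not> X (jf (val s i) (val s k))) \<and>
    (\<forall>c\<in>N. \<forall>d\<in>N. \<forall>s\<in>N. X (pr (con 6 c d) s) \<longrightarrow> U (pr c s) \<longrightarrow> X (pr c s)) \<and>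
    (\<forall>c\<in>N. \<forall>d\<in>N. \<forall>s\<in>N. X (pr (con 6 c d) s) \<longrightarrow> U (pr d s) \<longrightarrow> X (pr d s)) \<and>
    (\<forall>n\<in>N. \<forall>c\<in>N. \<forall>s\<in>N. \<forall>s'\<in>N. X (pr (con 8 n c) s) \<longrightarrow> agr n s s' \<longrightarrow> U (pr c s') \<longrightarrow> X (pr c s')) \<and>
    (\<forall>c\<in>N. \<forall>s\<in>N. E c a \<longrightarrow> U (pr c s) \<longrightarrow> X (pr c s))"

text \<open>
  The existential clauses: values of the embedding on \<open>U\<close>, and witnesses in \<open>Y\<close> for disjunctions and existential
  formulas in \<open>X\<close>.
\<close>

definition wit :: "('a \<Rightarrow> bool) \<Rightarrow> ('a \<Rightarrow> bool) \<Rightarrow> ('a \<Rightarrow> bool) \<Rightarrow> bool" where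
  "wit U X Y \<longleftrightarrow>
    (\<forall>z\<in>N. U z \<longrightarrow> (\<exists>y\<in>N. Y (jf z y))) \<and>
    (\<forall>c\<in>N. \<forall>d\<in>N. \<forall>s\<in>N. X (pr (con 7 c d) s) \<longrightarrow> Y (pr c s) \<or> Y (pr d s)) \<and>
    (\<forall>n\<in>N. \<forall>c\<in>N. \<forall>s\<in>N. X (pr (con 9 n c) s) \<longrightarrow> (\<exists>s'\<in>N. agr n s s' \<and> Y (pr c s')))"

lemmas coh_conjs = coh_def[THEN iffD1]
lemmas coh_fun = coh_conjs[THEN conjunct1, rule_format]
lemmas coh_fix = coh_conjs[THEN conjunct2, THEN conjunct1, rule_format]
lemmas coh_move = coh_conjs[THEN conjunct2, THEN conjunct2, THEN conjunct1, rule_format]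
lemmas coh0 = coh_conjs[THEN conjunct2, THEN conjunct2, THEN conjunct2, THEN conjunct1, rule_format]
lemmas coh1 = coh_conjs[THEN conjunct2, THEN conjunct2, THEN conjunct2, THEN conjunct2, THEN conjunct1, rule_format]
lemmas coh2 = coh_conjs[THEN conjunct2, THEN conjunct2, THEN conjunct2, THEN conjunct2, THEN conjunct2, THEN conjunct1, rule_format]
lemmas coh3 = coh_conjs[THEN conjunct2, THEN conjunct2, THEN conjunct2, THEN conjunct2, THEN conjunct2, THEN conjunct2, THEN conjunct1, rule_format]
lemmas coh4 = coh_conjs[THEN conjunct2, THEN conjunct2, THEN conjunct2, THEN conjunct2, THEN conjunct2, THEN conjunct2, THEN conjunct2, THEN conjunct1, rule_format]
lemmas coh5 = coh_conjs[THEN conjunct2, THEN conjunct2, THEN conjunct2, THEN conjunct2, THEN conjunct2, THEN conjunct2, THEN conjunct2, THEN conjunct2, THEN conjunct1, rule_format]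
lemmas coh6 = coh_conjs[THEN conjunct2, THEN conjunct2, THEN conjunct2, THEN conjunct2, THEN conjunct2, THEN conjunct2, THEN conjunct2, THEN conjunct2, THEN conjunct2, THEN conjunct1, rule_format]
lemmas coh6' = coh_conjs[THEN conjunct2, THEN conjunct2, THEN conjunct2, THEN conjunct2, THEN conjunct2, THEN conjunct2, THEN conjunct2, THEN conjunct2, THEN conjunct2, THEN conjunct2, THEN conjunct1, rule_format]
lemmas coh8 = coh_conjs[THEN conjunct2, THEN conjunct2, THEN conjunct2, THEN conjunct2, THEN conjunct2, THEN conjunct2, THEN conjunct2, THEN conjunct2, THEN conjunct2, THEN conjunct2, THEN conjunct2, THEN conjunct1, rule_format]
lemmas coh_valid = coh_conjs[THEN conjunct2, THEN conjunct2, THEN conjunct2, THEN conjunct2, THEN conjunct2, THEN conjunct2, THEN conjunct2, THEN conjunct2, THEN conjunct2, THEN conjunct2, THEN conjunct2, THEN conjunct2, rule_format]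

text \<open>Each clause of coherence speaks of at most two instances of \<open>X\<close>, so coherence can be checked locally.\<close>

lemma coh_local:
  assumes \<mu>: "\<mu> \<in> N" and loc: "\<And>z1 z2. z1 \<in> N \<Longrightarrow> z2 \<in> N \<Longrightarrow> \<exists>V Y. coh a \<mu> V Y \<and>
    (X z1 \<longrightarrow> Y z1) \<and> (X z2 \<longrightarrow> Y z2) \<and> (U z2 \<longrightarrow> V z2 \<and> (Y z2 \<longrightarrow> X z2))"
  shows "coh a \<mu> U X"
  unfolding coh_def
proof (intro conjI ballI impI)
  show "y = y'" if "z \<in> N" "y \<in> N" "y' \<in> N" "X (jf z y)" "X (jf z y')" for z y y'
    using loc[of "jf z y" "jf z y'"] coh_fun[of a \<mu> _ _ z y y'] that by auto
  show "y = z" if "z \<in> N" "y \<in> N" "E z \<mu>" "X (jf z y)" for z y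
    using loc[of "jf z y" "jf z y"] coh_fix[of a \<mu> _ _ z y] that by auto
  show "\<not> X (jf \<mu> \<mu>)"
    using loc[of "jf \<mu> \<mu>" "jf \<mu> \<mu>"] coh_move[of a \<mu>] \<mu> by auto
  show "val s i = val s k" if "i \<in> N" "k \<in> N" "s \<in> N" "X (pr (con 0 i k) s)" for i k s
    using loc[of "pr (con 0 i k) s" emp] coh0[of a \<mu> _ _ i k s] that by auto
  show "val s i \<noteq> val s k" if "i \<in> N" "k \<in> N" "s \<in> N" "X (pr (con 1 i k) s)" for i k s
    using loc[of "pr (con 1 i k) s" emp] coh1[of a \<mu> _ _ i k s] that by auto
  show "E (val s i) (val s k)" if "i \<in> N" "k \<in> N" "s \<in> N" "X (pr (con 2 i k) s)" for i k s
    using loc[of "pr (con 2 i k) s" emp] coh2[of a \<mu> _ _ i k s] that by auto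
  show "\<not> E (val s i) (val s k)" if "i \<in> N" "k \<in> N" "s \<in> N" "X (pr (con 3 i k) s)" for i k s
    using loc[of "pr (con 3 i k) s" emp] coh3[of a \<mu> _ _ i k s] that by auto
  show "y = val s k" if "i \<in> N" "k \<in> N" "s \<in> N" "y \<in> N" "X (pr (con 4 i k) s)" "X (jf (val s i) y)" for i k s y
    using loc[of "pr (con 4 i k) s" "jf (val s i) y"] coh4[of a \<mu> _ _ i k s y] that by auto
  show "\<not> X (jf (val s i) (val s k))" if "i \<in> N" "k \<in> N" "s \<in> N" "X (pr (con 5 i k) s)" for i k s
    using loc[of "pr (con 5 i k) s" "jf (val s i) (val s k)"] coh5[of a \<mu> _ _ i k s] that by auto
  show "X (pr c s)" if "c \<in> N" "d \<in> N" "s \<in> N" "X (pr (con 6 c d) s)" "U (pr c s)" for c d s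
    using loc[of "pr (con 6 c d) s" "pr c s"] coh6[of a \<mu> _ _ c d s] that by auto
  show "X (pr d s)" if "c \<in> N" "d \<in> N" "s \<in> N" "X (pr (con 6 c d) s)" "U (pr d s)" for c d s
    using loc[of "pr (con 6 c d) s" "pr d s"] coh6'[of a \<mu> _ _ c d s] that by auto
  show "X (pr c s')" if "n \<in> N" "c \<in> N" "s \<in> N" "s' \<in> N" "X (pr (con 8 n c) s)" "agr n s s'" "U (pr c s')" for n c s s'
    using loc[of "pr (con 8 n c) s" "pr c s'"] coh8[of a \<mu> _ _ n c s s'] that by auto
  show "X (pr c s)" if "c \<in> N" "s \<in> N" "E c a" "U (pr c s)" for c s
    using loc[of emp "pr c s"] coh_valid[of a \<mu> _ _ c s] that by auto
qed

lemma coh_restrict: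
  assumes "\<mu> \<in> N" "coh a \<mu> (\<lambda>_. True) X" shows "coh a \<mu> U (\<lambda>z. U z \<and> X z)"
proof (rule coh_local[OF assms(1)])
  show "\<exists>V Y. coh a \<mu> V Y \<and> (U z1 \<and> X z1 \<longrightarrow> Y z1) \<and> (U z2 \<and> X z2 \<longrightarrow> Y z2) \<and>
      (U z2 \<longrightarrow> V z2 \<and> (Y z2 \<longrightarrow> U z2 \<and> X z2))" for z1 z2
    using assms(2) by (intro exI[of _ "\<lambda>_. True"] exI[of _ X]) simp
qed

definition extends :: "'a \<Rightarrow> 'a \<Rightarrow> 'a \<Rightarrow> 'a \<Rightarrow> bool" where
  "extends a b p q \<longleftrightarrow> (\<exists>\<mu>\<in>N. \<exists>u\<in>N. \<exists>x\<in>N. \<exists>u'\<in>N. \<exists>x'\<in>N.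
     p = pr \<mu> (pr u x) \<and> q = pr \<mu> (pr u' x') \<and> sub u u' \<and> sub b u' \<and>
     (\<forall>z\<in>N. E z x \<longleftrightarrow> E z x' \<and> E z u) \<and>
     coh a \<mu> (\<lambda>z. E z u') (\<lambda>z. E z x') \<and> wit (\<lambda>z. E z u) (\<lambda>z. E z x) (\<lambda>z. E z x'))"

lemma dfn_extends: "dfn b (\<lambda>v w. extends (v 0) (v 1) (v 2) (v 3))"
  unfolding extends_def coh_def wit_def by (intro dfn_intros)

lemma dfn_extends': "a \<in> N \<Longrightarrow> dfn False (\<lambda>v w. extends a (v 0) (v 1) (v 2))"
  by (rule dfn_subst4[OF dfn_extends]) (intro dfn_intros, assumption?)+

lemma extends_anti:
  "\<forall>b\<in>N. \<forall>c\<in>N. \<forall>y\<in>N. \<forall>q\<in>N. sub b c \<longrightarrow> extends a c y q \<longrightarrow> extends a b y q"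
  unfolding extends_def by (intro ballI impI, elim bexE conjE, intro bexI conjI) (assumption | erule (1) sub_trans)+

text \<open>
  The union of a set of levels closed under power sets.
\<close>

lemma closed_under_pairs_ex:
  "\<exists>W\<in>N. E emp W \<and> (\<forall>x\<in>N. \<forall>y\<in>N. E x W \<and> E y W \<longrightarrow> E (up x y) W)"
proof -
  have emp_lev: "emp \<in> lev"
  proof -
    have "un emp \<in> lev" by (rule lev_un) simp_all
    moreover have "un emp = emp" by (rule extensionality) simp_all
    ultimately show ?thesis by simp
  qed
  obtain W where W: "W \<in> N" "E (pw emp) W" "\<forall>y\<in>N. E y W \<longrightarrow> E (pw y) W"
    using closed_set_ex[of pw, OF tm_pw[OF tm_var] pw_in[OF emp_in]] by (elim bexE conjE) (rule that)
  have d: "dfn False (\<lambda>v w. v 0 \<in> lev)" by (intro dfn_intros lev_class)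
  note V = sep[OF d W(1)]
  define V where "V = sep W (\<lambda>z. z \<in> lev)"
  have VN: "V \<in> N" and Vm: "\<And>z. z \<in> N \<Longrightarrow> E z V \<longleftrightarrow> E z W \<and> z \<in> lev"
    using V by (simp_all add: V_def)
  have mem: "E z (un V) \<longleftrightarrow> (\<exists>s\<in>lev. E s W \<and> E z s)" if "z \<in> N" for z
    using VN that Vm lev_N by auto
  have "E emp (un V)"
    unfolding mem[OF emp_in] using W(2) lev_pw[OF emp_lev] by (intro bexI[of _ "pw emp"]) simp_all
  moreover have "E (up x y) (un V)" if xy: "x \<in> N" "y \<in> N" "E x (un V)" "E y (un V)" for x y
  proof -
    from xy mem obtain s t where st: "s \<in> lev" "E s W" "E x s" "t \<in> lev" "E t W" "E y t" by blast
    have "\<exists>r\<in>lev. E r W \<and> E x r \<and> E y r"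
    proof (cases "sub s t")
      case True
      then show ?thesis using st subD[OF True xy(1)] by blast
    next
      case False
      then have "E t s" using lev_linear[OF st(1,4)] by blast
      then have "sub t s" using lev_trans[OF st(1) lev_N[OF st(4)]] by blast
      then show ?thesis using st subD[OF _ xy(2), of t s] by blast
    qed
    then obtain r where r: "r \<in> lev" "E r W" "E x r" "E y r" by blast
    have rN: "r \<in> N" using r(1) by (rule lev_N)
    have "sub (up x y) r" using r xy by (intro subI) auto
    then have "E (up x y) (pw r)" using rN xy by simp
    moreover have "E (pw r) W" using W(3) rN r(2) by blast
    ultimately show ?thesis unfolding mem[OF up_in[OF xy(1,2)]] using lev_pw[OF r(1)] by blast
  qed
  ultimately show ?thesis using VN un_in by blast
qed

definition pair_closed :: "'a \<Rightarrow> bool" where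
  "pair_closed W \<longleftrightarrow> E emp W \<and> (\<forall>x\<in>N. \<forall>y\<in>N. E x W \<and> E y W \<longrightarrow> E (up x y) W)"

lemma dfn_pair_closed [dfn_intros]: "tm b t \<Longrightarrow> dfn b (\<lambda>v w. pair_closed (t v w))"
  by (rule dfn_subst1) (unfold pair_closed_def, intro dfn_intros)

lemma least_pair_closed_ex:
  "\<exists>H\<in>N. pair_closed H \<and> (\<forall>W\<in>N. pair_closed W \<longrightarrow> sub H W)"
proof -
  obtain V where V: "V \<in> N" "pair_closed V" using closed_under_pairs_ex unfolding pair_closed_def by blast
  define Q where "Q z \<longleftrightarrow> (\<forall>W\<in>N. pair_closed W \<longrightarrow> E z W)" for z
  have Q: "dfn False (\<lambda>v w. Q (v 0))" unfolding Q_def by (intro dfn_intros)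
  note H = sep[OF Q V(1)]
  have "E emp (sep V Q)" using H(2)[OF emp_in] V(2) unfolding Q_def pair_closed_def by blast
  moreover have "E (up x y) (sep V Q)" if xy: "x \<in> N" "y \<in> N" "E x (sep V Q)" "E y (sep V Q)" for x y
  proof -
    have x: "E x V" "Q x" "E y V" "Q y" using xy H(2) by simp_all
    have "E (up x y) V" using V(2) x(1,3) xy(1,2) unfolding pair_closed_def by blast
    moreover have "Q (up x y)" using x(2,4) xy(1,2) unfolding Q_def pair_closed_def by blast
    ultimately show ?thesis using H(2)[OF up_in[OF xy(1,2)]] by simp
  qed
  ultimately have "pair_closed (sep V Q)" unfolding pair_closed_def by blast
  moreover have "sub (sep V Q) W" if "W \<in> N" "pair_closed W" for W
    using that H(2) unfolding Q_def sub_in_def by blast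
  ultimately show ?thesis using H(1) by blast
qed

lemma pair_closed_cd:
  assumes H: "H \<in> N" "pair_closed H" shows "E (cd \<phi> b) H"
proof -
  have up: "E (up x y) H" if "x \<in> N" "y \<in> N" "E x H" "E y H" for x y
    using assms that unfolding pair_closed_def by blast
  have pr: "E (pr x y) H" if "x \<in> N" "y \<in> N" "E x H" "E y H" for x y
    unfolding pr_def by (intro up up_in that)
  have num: "E (num n) H" for n
    by (induction n) (use H up in \<open>simp_all add: pair_closed_def\<close>)
  have con: "E (con n x y) H" if "x \<in> N" "y \<in> N" "E x H" "E y H" for n x y
    unfolding con_def by (intro pr pr_in num num_in that)
  show ?thesis
    by (induction \<phi> arbitrary: b) (simp_all add: con num)
qed

end

section \<open>The truth class of an embedding\<close>

context embedding
begin

text \<open>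
  The least set closed under pairing is definable, hence fixed, and its fixed elements are closed under pairing, so all
  its elements are fixed. This is how the parameter of the game is fixed by \<open>j\<close>.
\<close>

lemma fixes_subsets_of_least_pair_closed:
  assumes H: "H \<in> N" "pair_closed H" "\<forall>W\<in>N. pair_closed W \<longrightarrow> sub H W"
    and a: "a \<in> N" "sub a H"
  shows "j a = a"
proof -
  define M where "M H \<longleftrightarrow> pair_closed H \<and> (\<forall>W\<in>N. pair_closed W \<longrightarrow> sub H W)" for H
  have "dfn True (\<lambda>v w. M (v 0))" unfolding M_def by (intro dfn_intros)
  from elem1[OF this H(1)] H have "M (j H)" by (simp add: M_def)
  then have jH: "j H = H" using H unfolding M_def by (intro sub_antisym) simp_all
  define Q where "Q z \<longleftrightarrow> j z = z" for z
  have Q: "dfn False (\<lambda>v w. Q (v 0))" unfolding Q_def by (intro dfn_intros)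
  note F = sep[OF Q H(1)]
  have F2: "E z (sep H Q) \<longleftrightarrow> E z H \<and> j z = z" if "z \<in> N" for z
    using F(2)[OF that] Q_def[of z] by blast
  have "pair_closed (sep H Q)"
    unfolding pair_closed_def
  proof (intro conjI ballI impI)
    show "E emp (sep H Q)" using H(2) F2[OF emp_in] by (simp add: pair_closed_def)
    fix x y assume xy: "x \<in> N" "y \<in> N" "E x (sep H Q) \<and> E y (sep H Q)"
    then have 1: "E x H" "E y H" "j x = x" "j y = y" using F2 by simp_all
    then have "E (up x y) H" using H(2) xy(1,2) unfolding pair_closed_def by blast
    then show "E (up x y) (sep H Q)" using F2[of "up x y"] xy(1,2) 1 by simp
  qed
  then have HF: "sub H (sep H Q)" using H(3) F(1) by blast
  have fix1: "j z = z" if "z \<in> N" "E z H" for z using subD[OF HF that] F2[OF that(1)] by simp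
  have "sub (j a) H" using a H(1) j_sub[of a H] jH by simp
  show ?thesis
  proof (rule extensionality)
    fix z assume z: "z \<in> N"
    show "E z (j a) \<longleftrightarrow> E z a"
    proof (cases "E z H")
      case True
      then show ?thesis using j_mem[OF z a(1)] fix1[OF z] by simp
    next
      case False
      then show ?thesis using subD[OF \<open>sub (j a) H\<close> z] subD[OF a(2) z] by blast
    qed
  qed (use a in simp_all)
qed

definition basic_fact :: "'a \<Rightarrow> bool" where
  "basic_fact z \<longleftrightarrow>
    (\<exists>x\<in>N. z = jf x (j x)) \<or>
    (\<exists>i\<in>N. \<exists>k\<in>N. \<exists>s\<in>N. z = pr (con 0 i k) s \<and> val s i = val s k) \<or>
    (\<exists>i\<in>N. \<exists>k\<in>N. \<exists>s\<in>N. z = pr (con 1 i k) s \<and> val s i \<noteq> val s k) \<or>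
    (\<exists>i\<in>N. \<exists>k\<in>N. \<exists>s\<in>N. z = pr (con 2 i k) s \<and> E (val s i) (val s k)) \<or>
    (\<exists>i\<in>N. \<exists>k\<in>N. \<exists>s\<in>N. z = pr (con 3 i k) s \<and> \<not> E (val s i) (val s k)) \<or>
    (\<exists>i\<in>N. \<exists>k\<in>N. \<exists>s\<in>N. z = pr (con 4 i k) s \<and> j (val s i) = val s k) \<or>
    (\<exists>i\<in>N. \<exists>k\<in>N. \<exists>s\<in>N. z = pr (con 5 i k) s \<and> j (val s i) \<noteq> val s k)"

definition compound_fact :: "'a set \<Rightarrow> 'a \<Rightarrow> bool" where
  "compound_fact X z \<longleftrightarrow>
    (\<exists>c\<in>N. \<exists>d\<in>N. \<exists>s\<in>N. z = pr (con 6 c d) s \<and> pr c s \<in> X \<and> pr d s \<in> X) \<or>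
    (\<exists>c\<in>N. \<exists>d\<in>N. \<exists>s\<in>N. z = pr (con 7 c d) s \<and> (pr c s \<in> X \<or> pr d s \<in> X)) \<or>
    (\<exists>n\<in>N. \<exists>c\<in>N. \<exists>s\<in>N. z = pr (con 8 n c) s \<and> (\<forall>s'\<in>N. agr n s s' \<longrightarrow> pr c s' \<in> X)) \<or>
    (\<exists>n\<in>N. \<exists>c\<in>N. \<exists>s\<in>N. z = pr (con 9 n c) s \<and> (\<exists>s'\<in>N. agr n s s' \<and> pr c s' \<in> X))"

definition truth_op :: "'a set \<Rightarrow> 'a \<Rightarrow> bool" where
  "truth_op X z \<longleftrightarrow> basic_fact z \<or> compound_fact X z"

text \<open>
  Taking a least fixed point provides truth for all codes at once, so nothing has to be proved
  about codes that do not come from formulas, such as those of nonstandard length.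
\<close>

definition truth :: "'a set" where "truth = lfpc truth_op"

lemma dfn_truth_op: "dfn False (\<lambda>v w. truth_op (w 0) (v 0))"
  unfolding truth_op_def basic_fact_def compound_fact_def by (intro dfn_intros)

lemma truth_op_mono: "\<forall>X Y z. X \<subseteq> Y \<longrightarrow> truth_op X z \<longrightarrow> truth_op Y z"
proof -
  have "compound_fact Y z" if XY: "X \<subseteq> Y" and "compound_fact X z" for X Y z
  proof -
    have "(\<exists>c\<in>N. \<exists>d\<in>N. \<exists>s\<in>N. z = pr (con 6 c d) s \<and> pr c s \<in> X \<and> pr d s \<in> X) \<Longrightarrow>
      (\<exists>c\<in>N. \<exists>d\<in>N. \<exists>s\<in>N. z = pr (con 6 c d) s \<and> pr c s \<in> Y \<and> pr d s \<in> Y)" using XY by blast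
    moreover have "(\<exists>c\<in>N. \<exists>d\<in>N. \<exists>s\<in>N. z = pr (con 7 c d) s \<and> (pr c s \<in> X \<or> pr d s \<in> X)) \<Longrightarrow>
      (\<exists>c\<in>N. \<exists>d\<in>N. \<exists>s\<in>N. z = pr (con 7 c d) s \<and> (pr c s \<in> Y \<or> pr d s \<in> Y))" using XY by blast
    moreover have "(\<exists>n\<in>N. \<exists>c\<in>N. \<exists>s\<in>N. z = pr (con 8 n c) s \<and> (\<forall>s'\<in>N. agr n s s' \<longrightarrow> pr c s' \<in> X)) \<Longrightarrow>
      (\<exists>n\<in>N. \<exists>c\<in>N. \<exists>s\<in>N. z = pr (con 8 n c) s \<and> (\<forall>s'\<in>N. agr n s s' \<longrightarrow> pr c s' \<in> Y))" using XY by blast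
    moreover have "(\<exists>n\<in>N. \<exists>c\<in>N. \<exists>s\<in>N. z = pr (con 9 n c) s \<and> (\<exists>s'\<in>N. agr n s s' \<and> pr c s' \<in> X)) \<Longrightarrow>
      (\<exists>n\<in>N. \<exists>c\<in>N. \<exists>s\<in>N. z = pr (con 9 n c) s \<and> (\<exists>s'\<in>N. agr n s s' \<and> pr c s' \<in> Y))" using XY by blast
    ultimately show ?thesis using that(2) unfolding compound_fact_def by argo
  qed
  then show ?thesis unfolding truth_op_def by blast
qed

end

section \<open>ZFR as a set of valid formulas\<close>

primrec fm_bound :: "fm \<Rightarrow> nat" where
  "fm_bound (FEq i k) = Suc (max i k)"
| "fm_bound (FMem i k) = Suc (max i k)"
| "fm_bound (FJ i k) = Suc (max i k)"
| "fm_bound (FNeg \<phi>) = fm_bound \<phi>"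
| "fm_bound (FAnd \<phi> \<psi>) = max (fm_bound \<phi>) (fm_bound \<psi>)"
| "fm_bound (FAll n \<phi>) = max n (fm_bound \<phi>)"

lemma sat_cong: "\<forall>i<fm_bound \<phi>. v i = v' i \<Longrightarrow> sat N E j \<phi> v \<longleftrightarrow> sat N E j \<phi> v'"
proof (induction \<phi> arbitrary: v v')
  case (FAnd \<phi> \<psi>)
  have "sat N E j \<phi> v \<longleftrightarrow> sat N E j \<phi> v'" by (rule FAnd.IH(1)) (simp add: FAnd.prems)
  moreover have "sat N E j \<psi> v \<longleftrightarrow> sat N E j \<psi> v'" by (rule FAnd.IH(2)) (simp add: FAnd.prems)
  ultimately show ?case by simp
next
  case (FNeg \<phi>)
  have "sat N E j \<phi> v \<longleftrightarrow> sat N E j \<phi> v'" by (rule FNeg.IH) (use FNeg.prems in simp)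
  then show ?case by simp
next
  case (FAll n \<phi>)
  have "sat N E j \<phi> (v(n := x)) \<longleftrightarrow> sat N E j \<phi> (v'(n := x))" for x
    by (rule FAll.IH) (simp add: FAll.prems)
  then show ?case by simp
qed (simp_all add: less_Suc_eq_le)

primrec rename :: "(nat \<Rightarrow> nat) \<Rightarrow> fm \<Rightarrow> fm" where
  "rename f (FEq i k) = FEq (f i) (f k)"
| "rename f (FMem i k) = FMem (f i) (f k)"
| "rename f (FJ i k) = FJ (f i) (f k)"
| "rename f (FNeg \<phi>) = FNeg (rename f \<phi>)"
| "rename f (FAnd \<phi> \<psi>) = FAnd (rename f \<phi>) (rename f \<psi>)"
| "rename f (FAll n \<phi>) = FAll (f n) (rename f \<phi>)"

lemma sat_rename: "inj f \<Longrightarrow> sat N E j (rename f \<phi>) v \<longleftrightarrow> sat N E j \<phi> (\<lambda>i. v (f i))"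
proof (induction \<phi> arbitrary: v)
  case (FAll n \<phi>)
  have "(\<lambda>i. (v(f n := x)) (f i)) = (\<lambda>i. v (f i))(n := x)" for x
    using FAll.prems by (auto simp: fun_eq_iff inj_eq)
  then show ?case using FAll by simp
qed simp_all

definition FImp :: "fm \<Rightarrow> fm \<Rightarrow> fm" where "FImp \<phi> \<psi> = FNeg (FAnd \<phi> (FNeg \<psi>))"
definition FEx :: "nat \<Rightarrow> fm \<Rightarrow> fm" where "FEx n \<phi> = FNeg (FAll n (FNeg \<phi>))"

lemma sat_FImp [simp]: "sat N E j (FImp \<phi> \<psi>) v \<longleftrightarrow> (sat N E j \<phi> v \<longrightarrow> sat N E j \<psi> v)"
  by (simp add: FImp_def)

lemma sat_FEx [simp]: "sat N E j (FEx n \<phi>) v \<longleftrightarrow> (\<exists>x\<in>N. sat N E j \<phi> (v(n := x)))"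
  by (simp add: FEx_def)

definition valid_in :: "'a set \<Rightarrow> ('a \<Rightarrow> 'a \<Rightarrow> bool) \<Rightarrow> ('a \<Rightarrow> 'a) \<Rightarrow> fm \<Rightarrow> bool" where
  "valid_in N E j \<phi> \<longleftrightarrow> (\<forall>v. range v \<subseteq> N \<longrightarrow> sat N E j \<phi> v)"

definition sep_fm :: "fm \<Rightarrow> fm" where
  "sep_fm \<phi> = (let m = Suc (Suc (fm_bound \<phi>)) in
     FEx (Suc m) (FAll 0 (FAnd (FImp (FMem 0 (Suc m)) (FAnd (FMem 0 m) \<phi>))
                               (FImp (FAnd (FMem 0 m) \<phi>) (FMem 0 (Suc m))))))"

definition coll_fm :: "fm \<Rightarrow> fm" where
  "coll_fm \<phi> = (let m = Suc (Suc (fm_bound \<phi>)) in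
     FImp (FAll 0 (FImp (FMem 0 m) (FEx 1 \<phi>)))
       (FEx (Suc m) (FAll 0 (FImp (FMem 0 m) (FEx 1 (FAnd (FMem 1 (Suc m)) \<phi>))))))"

text \<open>
  Validity takes care of the parameters of the scheme. The variable \<open>m\<close>, fresh for \<open>\<phi>\<close>, holds the given set, and its
  successor the set that is asserted to exist.
\<close>

lemma valid_sep_fm:
  "valid_in N E j (sep_fm \<phi>) \<longleftrightarrow> (\<forall>v. range v \<subseteq> N \<longrightarrow>
     (\<forall>a\<in>N. \<exists>b\<in>N. \<forall>x\<in>N. E x b \<longleftrightarrow> E x a \<and> sat N E j \<phi> (v(0 := x))))"
proof -
  define m where "m = Suc (Suc (fm_bound \<phi>))"
  have c: "sat N E j \<phi> (v(Suc m := b, 0 := x)) \<longleftrightarrow> sat N E j \<phi> (v(0 := x))" for v b x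
    by (rule sat_cong) (simp add: m_def)
  have d: "sat N E j \<phi> (v(m := a, 0 := x)) \<longleftrightarrow> sat N E j \<phi> (v(0 := x))" for v a x
    by (rule sat_cong) (simp add: m_def)
  have 1: "sat N E j (sep_fm \<phi>) v \<longleftrightarrow>
      (\<exists>b\<in>N. \<forall>x\<in>N. E x b \<longleftrightarrow> E x (v m) \<and> sat N E j \<phi> (v(0 := x)))" for v
    unfolding sep_fm_def m_def[symmetric] Let_def sat_FEx sat_FImp sat.simps c by (auto simp: m_def)
  show ?thesis
  proof
    assume L: "valid_in N E j (sep_fm \<phi>)"
    show "\<forall>v. range v \<subseteq> N \<longrightarrow>
       (\<forall>a\<in>N. \<exists>b\<in>N. \<forall>x\<in>N. E x b \<longleftrightarrow> E x a \<and> sat N E j \<phi> (v(0 := x)))"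
    proof (intro allI impI ballI)
      fix v :: "nat \<Rightarrow> 'a" and a assume "range v \<subseteq> N" "a \<in> N"
      then have "range (v(m := a)) \<subseteq> N" by auto
      with L 1[of "v(m := a)"] show "\<exists>b\<in>N. \<forall>x\<in>N. E x b \<longleftrightarrow> E x a \<and> sat N E j \<phi> (v(0 := x))"
        by (simp add: valid_in_def d)
    qed
  next
    assume R: "\<forall>v. range v \<subseteq> N \<longrightarrow>
       (\<forall>a\<in>N. \<exists>b\<in>N. \<forall>x\<in>N. E x b \<longleftrightarrow> E x a \<and> sat N E j \<phi> (v(0 := x)))"
    show "valid_in N E j (sep_fm \<phi>)"
      unfolding valid_in_def 1 using R by (auto simp: image_subset_iff)
  qed
qed

lemma valid_coll_fm:
  "valid_in N E j (coll_fm \<phi>) \<longleftrightarrow> (\<forall>v. range v \<subseteq> N \<longrightarrow>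
     (\<forall>a\<in>N. (\<forall>x\<in>N. E x a \<longrightarrow> (\<exists>y\<in>N. sat N E j \<phi> (v(0 := x, 1 := y)))) \<longrightarrow>
       (\<exists>b\<in>N. \<forall>x\<in>N. E x a \<longrightarrow> (\<exists>y\<in>N. E y b \<and> sat N E j \<phi> (v(0 := x, 1 := y))))))"
proof -
  define m where "m = Suc (Suc (fm_bound \<phi>))"
  have c: "sat N E j \<phi> (v(Suc m := b, 0 := x, 1 := y)) \<longleftrightarrow> sat N E j \<phi> (v(0 := x, 1 := y))" for v b x y
    by (rule sat_cong) (simp add: m_def)
  have d: "sat N E j \<phi> (v(m := a, 0 := x, 1 := y)) \<longleftrightarrow> sat N E j \<phi> (v(0 := x, 1 := y))" for v a x y
    by (rule sat_cong) (simp add: m_def)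
  have 1: "sat N E j (coll_fm \<phi>) v \<longleftrightarrow>
      (\<forall>x\<in>N. E x (v m) \<longrightarrow> (\<exists>y\<in>N. sat N E j \<phi> (v(0 := x, 1 := y)))) \<longrightarrow>
       (\<exists>b\<in>N. \<forall>x\<in>N. E x (v m) \<longrightarrow> (\<exists>y\<in>N. E y b \<and> sat N E j \<phi> (v(0 := x, 1 := y))))" for v
    unfolding coll_fm_def m_def[symmetric] Let_def sat_FEx sat_FImp sat.simps c by (simp add: m_def)
  show ?thesis
  proof
    assume L: "valid_in N E j (coll_fm \<phi>)"
    show "\<forall>v. range v \<subseteq> N \<longrightarrow>
     (\<forall>a\<in>N. (\<forall>x\<in>N. E x a \<longrightarrow> (\<exists>y\<in>N. sat N E j \<phi> (v(0 := x, 1 := y)))) \<longrightarrow>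
       (\<exists>b\<in>N. \<forall>x\<in>N. E x a \<longrightarrow> (\<exists>y\<in>N. E y b \<and> sat N E j \<phi> (v(0 := x, 1 := y)))))"
    proof (intro allI ballI, rule impI, rule ballI)
      fix v :: "nat \<Rightarrow> 'a" and a assume "range v \<subseteq> N" "a \<in> N"
      then have "range (v(m := a)) \<subseteq> N" by auto
      with L have "sat N E j (coll_fm \<phi>) (v(m := a))" by (simp add: valid_in_def)
      then show "(\<forall>x\<in>N. E x a \<longrightarrow> (\<exists>y\<in>N. sat N E j \<phi> (v(0 := x, 1 := y)))) \<longrightarrow>
       (\<exists>b\<in>N. \<forall>x\<in>N. E x a \<longrightarrow> (\<exists>y\<in>N. E y b \<and> sat N E j \<phi> (v(0 := x, 1 := y))))"
        unfolding 1 d by simp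
    qed
  next
    assume R: "\<forall>v. range v \<subseteq> N \<longrightarrow>
     (\<forall>a\<in>N. (\<forall>x\<in>N. E x a \<longrightarrow> (\<exists>y\<in>N. sat N E j \<phi> (v(0 := x, 1 := y)))) \<longrightarrow>
       (\<exists>b\<in>N. \<forall>x\<in>N. E x a \<longrightarrow> (\<exists>y\<in>N. E y b \<and> sat N E j \<phi> (v(0 := x, 1 := y)))))"
    show "valid_in N E j (coll_fm \<phi>)"
      unfolding valid_in_def 1
    proof (intro allI, rule impI)
      fix v :: "nat \<Rightarrow> 'a" assume v: "range v \<subseteq> N"
      then have "v m \<in> N" by (rule subsetD) simp
      from R[rule_format, OF v this] show "(\<forall>x\<in>N. E x (v m) \<longrightarrow> (\<exists>y\<in>N. sat N E j \<phi> (v(0 := x, 1 := y)))) \<longrightarrow>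
       (\<exists>b\<in>N. \<forall>x\<in>N. E x (v m) \<longrightarrow> (\<exists>y\<in>N. E y b \<and> sat N E j \<phi> (v(0 := x, 1 := y))))" by blast
    qed
  qed
qed

primrec graph_fm :: "nat \<Rightarrow> fm" where
  "graph_fm 0 = FEq 0 0"
| "graph_fm (Suc m) = FAnd (FJ (2 * m) (Suc (2 * m))) (graph_fm m)"

lemma sat_graph_fm: "sat N E j (graph_fm m) v \<longleftrightarrow> (\<forall>i<m. j (v (2 * i)) = v (Suc (2 * i)))"
  by (induction m) (auto simp: less_Suc_eq)

text \<open>
  Elementarity for \<open>\<phi>\<close> as the validity of one formula: the even variables hold the arguments, the odd ones their
  images.
\<close>

definition elem_fm :: "fm \<Rightarrow> fm" where
  "elem_fm \<phi> = FImp (graph_fm (fm_bound \<phi>))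
     (FAnd (FImp (rename (\<lambda>i. 2 * i) \<phi>) (rename (\<lambda>i. Suc (2 * i)) \<phi>))
           (FImp (rename (\<lambda>i. Suc (2 * i)) \<phi>) (rename (\<lambda>i. 2 * i) \<phi>)))"

lemma valid_elem_fm:
  assumes j: "j \<in> N \<rightarrow> N"
  shows "valid_in N E j (elem_fm \<phi>) \<longleftrightarrow>
    (\<forall>v. range v \<subseteq> N \<longrightarrow> (sat N E j \<phi> v \<longleftrightarrow> sat N E j \<phi> (j \<circ> v)))"
proof -
  have inj: "inj (\<lambda>i::nat. 2 * i)" "inj (\<lambda>i::nat. Suc (2 * i))" by (auto simp: inj_def)
  have 1: "sat N E j (elem_fm \<phi>) v \<longleftrightarrow> ((\<forall>i<fm_bound \<phi>. j (v (2 * i)) = v (Suc (2 * i))) \<longrightarrow>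
      (sat N E j \<phi> (\<lambda>i. v (2 * i)) \<longleftrightarrow> sat N E j \<phi> (\<lambda>i. v (Suc (2 * i)))))" for v
    unfolding elem_fm_def sat_FImp sat.simps sat_graph_fm sat_rename[OF inj(1)] sat_rename[OF inj(2)]
    by blast
  show ?thesis
  proof
    assume L: "valid_in N E j (elem_fm \<phi>)"
    show "\<forall>v. range v \<subseteq> N \<longrightarrow> (sat N E j \<phi> v \<longleftrightarrow> sat N E j \<phi> (j \<circ> v))"
    proof (intro allI, rule impI)
      fix v :: "nat \<Rightarrow> 'a" assume v: "range v \<subseteq> N"
      define u where "u = mix v (j \<circ> v)"
      have "range u \<subseteq> N" unfolding u_def by (rule mix_range) (use v j in auto)
      with L have "sat N E j (elem_fm \<phi>) u" by (simp add: valid_in_def)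
      then show "sat N E j \<phi> v \<longleftrightarrow> sat N E j \<phi> (j \<circ> v)" unfolding 1 by (simp add: u_def comp_def)
    qed
  next
    assume R: "\<forall>v. range v \<subseteq> N \<longrightarrow> (sat N E j \<phi> v \<longleftrightarrow> sat N E j \<phi> (j \<circ> v))"
    show "valid_in N E j (elem_fm \<phi>)" unfolding valid_in_def 1
    proof (intro allI, rule impI, rule impI)
      fix v :: "nat \<Rightarrow> 'a"
      assume v: "range v \<subseteq> N" and g: "\<forall>i<fm_bound \<phi>. j (v (2 * i)) = v (Suc (2 * i))"
      have "range (\<lambda>i. v (2 * i)) \<subseteq> N" using v by auto
      with R have "sat N E j \<phi> (\<lambda>i. v (2 * i)) \<longleftrightarrow> sat N E j \<phi> (j \<circ> (\<lambda>i. v (2 * i)))" by blast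
      also have "\<dots> \<longleftrightarrow> sat N E j \<phi> (\<lambda>i. v (Suc (2 * i)))" by (rule sat_cong) (simp add: g)
      finally show "sat N E j \<phi> (\<lambda>i. v (2 * i)) \<longleftrightarrow> sat N E j \<phi> (\<lambda>i. v (Suc (2 * i)))" .
    qed
  qed
qed

lemma ZFR_model_iff_valid:
  "ZFR_model N E j \<longleftrightarrow> zf_base N E \<and> j \<in> N \<rightarrow> N \<and> (\<forall>\<phi>. valid_in N E j (sep_fm \<phi>)) \<and>
     (\<forall>\<phi>. valid_in N E j (coll_fm \<phi>)) \<and> (\<forall>\<phi>. pure_fm \<phi> \<longrightarrow> valid_in N E j (elem_fm \<phi>))"
proof -
  have "elementary_emb N E j \<longleftrightarrow> j \<in> N \<rightarrow> N \<and> (\<forall>\<phi>. pure_fm \<phi> \<longrightarrow> valid_in N E j (elem_fm \<phi>))"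
    using valid_elem_fm[of j N E] unfolding elementary_emb_def by blast
  moreover have "ZFj_model N E j \<longleftrightarrow> zf_base N E \<and> (\<forall>\<phi>. valid_in N E j (sep_fm \<phi>)) \<and>
     (\<forall>\<phi>. valid_in N E j (coll_fm \<phi>))"
    unfolding ZFj_model_def valid_sep_fm valid_coll_fm by simp
  ultimately show ?thesis unfolding ZFR_model_def by blast
qed

context embedding
begin

lemma dfn_sat: "dfn False (\<lambda>v w. sat N E j \<phi> v)"
proof (induction \<phi>)
  case (FAll n \<phi>)
  have eq: "(\<lambda>i. v (if i = n then 0 else Suc i)) = (\<lambda>i. v (Suc i))(n := v 0)" for v :: "nat \<Rightarrow> 'a"
    by auto
  have "dfn False (\<lambda>v w. sat N E j \<phi> ((\<lambda>i. v (Suc i))(n := v 0)))"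
    using dfn_reindex[OF FAll, where f = "\<lambda>i. if i = n then 0 else Suc i"] unfolding eq .
  then show ?case unfolding sat.simps by (rule dfn_all)
qed (unfold sat.simps, (rule dfn_intros | assumption)+)

lemma ZFR_class: "ZFR_model N E j"
proof -
  have "ZFj_model N E j" unfolding ZFj_model_def
  proof (intro conjI allI impI ballI)
    show "zf_base N E" by (rule zf)
  next
    fix \<phi> v a assume v: "range (v :: nat \<Rightarrow> 'a) \<subseteq> N" and a: "a \<in> N"
    have "dfn False (\<lambda>u w. sat N E j \<phi> (\<lambda>i. if i < 1 then u i else v i))"
      by (rule dfn_fix_from[OF dfn_sat v, of "\<lambda>_. some_class"]) auto
    moreover have "(\<lambda>i. if i < 1 then u i else v i) = v(0 := u 0)" for u by auto
    ultimately have "dfn False (\<lambda>u w. sat N E j \<phi> (v(0 := u 0)))" by simp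
    from separation_ex[OF this a]
    show "\<exists>b\<in>N. \<forall>x\<in>N. E x b \<longleftrightarrow> E x a \<and> sat N E j \<phi> (v(0 := x))" .
  next
    fix \<phi> v a assume v: "range (v :: nat \<Rightarrow> 'a) \<subseteq> N" and a: "a \<in> N"
      and ex: "\<forall>x\<in>N. E x a \<longrightarrow> (\<exists>y\<in>N. sat N E j \<phi> (v(0 := x, 1 := y)))"
    have "dfn False (\<lambda>u w. sat N E j \<phi> (\<lambda>i. if i < 2 then u i else v i))"
      by (rule dfn_fix_from[OF dfn_sat v, of "\<lambda>_. some_class"]) auto
    moreover have "(\<lambda>i. if i < 2 then u i else v i) = v(0 := u 0, 1 := u 1)" for u
      by (auto simp: fun_eq_iff less_2_cases_iff)
    ultimately have "dfn False (\<lambda>u w. sat N E j \<phi> (v(0 := u 0, 1 := u 1)))" by simp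
    from collection[of "\<lambda>x y. sat N E j \<phi> (v(0 := x, 1 := y))", OF this a] ex
    obtain t where "t \<in> lev" "\<forall>x\<in>N. E x a \<longrightarrow> (\<exists>y\<in>N. E y t \<and> sat N E j \<phi> (v(0 := x, 1 := y)))" by blast
    then show "\<exists>b\<in>N. \<forall>x\<in>N. E x a \<longrightarrow> (\<exists>y\<in>N. E y b \<and> sat N E j \<phi> (v(0 := x, 1 := y)))"
      using lev_N by blast
  qed
  then show ?thesis using elem by (simp add: ZFR_model_def)
qed

section \<open>Initial segments of the truth class\<close>

lemma truth_class: "truth \<in> P"
  unfolding truth_def by (rule lfpc_class[OF dfn_truth_op truth_op_mono])

lemma truth_iff: "z \<in> N \<Longrightarrow> z \<in> truth \<longleftrightarrow> basic_fact z \<or> compound_fact truth z"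
  using lfpc_unfold[OF dfn_truth_op truth_op_mono] unfolding truth_def truth_op_def by blast

lemma truth_jf: "z \<in> N \<Longrightarrow> y \<in> N \<Longrightarrow> jf z y \<in> truth \<longleftrightarrow> y = j z"
  by (subst truth_iff) (auto simp: basic_fact_def compound_fact_def jf_def)

context
  fixes c d s assumes N: "c \<in> N" "d \<in> N" "s \<in> N"
begin

lemma truth0: "pr (con 0 c d) s \<in> truth \<longleftrightarrow> val s c = val s d"
  and truth1: "pr (con (Suc 0) c d) s \<in> truth \<longleftrightarrow> val s c \<noteq> val s d"
  and truth2: "pr (con 2 c d) s \<in> truth \<longleftrightarrow> E (val s c) (val s d)"
  and truth3: "pr (con 3 c d) s \<in> truth \<longleftrightarrow> \<not> E (val s c) (val s d)"
  and truth4: "pr (con 4 c d) s \<in> truth \<longleftrightarrow> j (val s c) = val s d"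
  and truth5: "pr (con 5 c d) s \<in> truth \<longleftrightarrow> j (val s c) \<noteq> val s d"
  and truth6: "pr (con 6 c d) s \<in> truth \<longleftrightarrow> pr c s \<in> truth \<and> pr d s \<in> truth"
  and truth7: "pr (con 7 c d) s \<in> truth \<longleftrightarrow> pr c s \<in> truth \<or> pr d s \<in> truth"
  and truth8: "pr (con 8 c d) s \<in> truth \<longleftrightarrow> (\<forall>s'\<in>N. agr c s s' \<longrightarrow> pr d s' \<in> truth)"
  and truth9: "pr (con 9 c d) s \<in> truth \<longleftrightarrow> (\<exists>s'\<in>N. agr c s s' \<and> pr d s' \<in> truth)"
  by (subst truth_iff; use N in \<open>auto simp: basic_fact_def compound_fact_def jf_def\<close>)+

end

lemmas truth_simps = truth0 truth1 truth2 truth3 truth4 truth5 truth6 truth7 truth8 truth9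

lemma truth_cd: "s \<in> N \<Longrightarrow> pr (cd \<phi> b) s \<in> truth \<longleftrightarrow> (sat N E j \<phi> (vals s) = b)"
proof (induction \<phi> arbitrary: b s)
  case (FAll n \<phi>)
  have IH: "pr (cd \<phi> b) s' \<in> truth \<longleftrightarrow> (sat N E j \<phi> ((vals s)(n := val s' (num n))) = b)"
    if "s' \<in> N" "agr (num n) s s'" for b s'
    using FAll.IH[OF that(1), of b] unfolding agr_vals[OF that(2)] .
  have ex: "\<exists>s'\<in>N. agr (num n) s s' \<and> val s' (num n) = x" if "x \<in> N" for x
    using update_ex[OF num_in FAll.prems that] .
  show ?case
  proof (cases b)
    case True
    have "(\<forall>s'\<in>N. agr (num n) s s' \<longrightarrow> pr (cd \<phi> True) s' \<in> truth) \<longleftrightarrow>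
        (\<forall>x\<in>N. sat N E j \<phi> ((vals s)(n := x)))"
      using IH[of _ True] ex val_in[OF _ num_in] by metis
    then show ?thesis using True FAll.prems by (simp add: truth8)
  next
    case False
    have "(\<exists>s'\<in>N. agr (num n) s s' \<and> pr (cd \<phi> False) s' \<in> truth) \<longleftrightarrow>
        (\<exists>x\<in>N. \<not> sat N E j \<phi> ((vals s)(n := x)))"
      using IH[of _ False] ex val_in[OF _ num_in] by metis
    then show ?thesis using False FAll.prems by (simp add: truth9)
  qed
next
  case (FAnd \<phi> \<psi>)
  show ?case by (cases b) (simp_all add: truth6 truth7 FAnd)
qed (auto simp: truth0 truth1 truth2 truth3 truth4 truth5 vals_def)

lemma coh_truth:
  assumes \<kappa>: "\<kappa> \<in> N" "\<forall>z\<in>N. E z \<kappa> \<longrightarrow> j z = z" "j \<kappa> \<noteq> \<kappa>"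
    and a: "\<forall>c\<in>N. E c a \<longrightarrow> (\<forall>s\<in>N. pr c s \<in> truth)"
  shows "coh a \<kappa> (\<lambda>_. True) (\<lambda>z. z \<in> truth)"
  unfolding coh_def One_nat_def
proof (intro conjI ballI impI)
  show "jf \<kappa> \<kappa> \<notin> truth" using \<kappa> truth_jf[of \<kappa> \<kappa>] by auto
qed (use \<kappa> a in \<open>simp_all add: truth_jf truth_simps\<close>)

text \<open>
  Elements of \<open>u\<close> without a witness are exempted, which lets Collection apply to all of \<open>u\<close>.
\<close>

lemma witness_set_ex:
  assumes Q: "dfn False (\<lambda>v w. Q (v 0) (v 1))" and u: "u \<in> N"
  shows "\<exists>t\<in>N. \<forall>z\<in>N. E z u \<longrightarrow> (\<exists>y\<in>N. Q z y) \<longrightarrow> (\<exists>y\<in>N. E y t \<and> Q z y)"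
proof -
  have "\<exists>t\<in>lev. \<forall>z\<in>N. E z u \<longrightarrow> (\<exists>y\<in>N. E y t \<and> ((\<exists>y\<in>N. Q z y) \<longrightarrow> Q z y))"
  proof (rule collection[OF _ u])
    show "dfn False (\<lambda>v w. (\<exists>y\<in>N. Q (v 0) y) \<longrightarrow> Q (v 0) (v 1))"
      by (intro dfn_intros dfn_subst2[OF Q])
  qed (use emp_in in blast)
  then obtain t where t: "t \<in> lev"
    "\<forall>z\<in>N. E z u \<longrightarrow> (\<exists>y\<in>N. E y t \<and> ((\<exists>y\<in>N. Q z y) \<longrightarrow> Q z y))" by blast
  show ?thesis by (rule bexI[OF _ lev_N[OF t(1)]]) (use t(2) in blast)
qed

lemma truth_witnesses:
  assumes u: "u \<in> N"
  shows "\<exists>t\<in>N. wit (\<lambda>z. E z u) (\<lambda>z. E z u \<and> z \<in> truth) (\<lambda>z. E z t \<and> z \<in> truth)"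
proof -
  define Q1 where "Q1 z y \<longleftrightarrow> y = jf z (j z)" for z y
  define Q2 where "Q2 z y \<longleftrightarrow> y \<in> truth \<and>
    (\<exists>c\<in>N. \<exists>d\<in>N. \<exists>s\<in>N. z = pr (con 7 c d) s \<and> (y = pr c s \<or> y = pr d s))" for z y
  define Q3 where "Q3 z y \<longleftrightarrow> y \<in> truth \<and>
    (\<exists>n\<in>N. \<exists>c\<in>N. \<exists>s\<in>N. z = pr (con 9 n c) s \<and> (\<exists>s'\<in>N. agr n s s' \<and> y = pr c s'))" for z y
  have "dfn False (\<lambda>v w. Q1 (v 0) (v 1))" "dfn False (\<lambda>v w. Q2 (v 0) (v 1))"
    "dfn False (\<lambda>v w. Q3 (v 0) (v 1))"
    unfolding Q1_def Q2_def Q3_def by (intro dfn_intros truth_class)+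
  note ex = this[THEN witness_set_ex, OF u]
  obtain t1 where t1: "t1 \<in> N" "\<forall>z\<in>N. E z u \<longrightarrow> (\<exists>y\<in>N. Q1 z y) \<longrightarrow> (\<exists>y\<in>N. E y t1 \<and> Q1 z y)"
    using ex(1) by (rule bexE)
  obtain t2 where t2: "t2 \<in> N" "\<forall>z\<in>N. E z u \<longrightarrow> (\<exists>y\<in>N. Q2 z y) \<longrightarrow> (\<exists>y\<in>N. E y t2 \<and> Q2 z y)"
    using ex(2) by (rule bexE)
  obtain t3 where t3: "t3 \<in> N" "\<forall>z\<in>N. E z u \<longrightarrow> (\<exists>y\<in>N. Q3 z y) \<longrightarrow> (\<exists>y\<in>N. E y t3 \<and> Q3 z y)"
    using ex(3) by (rule bexE)
  define t where "t = bun t1 (bun t2 t3)"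
  have t: "t \<in> N" "\<And>z. z \<in> N \<Longrightarrow> E z t \<longleftrightarrow> E z t1 \<or> E z t2 \<or> E z t3"
    unfolding t_def using t1(1) t2(1) t3(1) by simp_all
  have "wit (\<lambda>z. E z u) (\<lambda>z. E z u \<and> z \<in> truth) (\<lambda>z. E z t \<and> z \<in> truth)"
    unfolding wit_def
  proof (intro conjI ballI impI)
    fix z assume z: "z \<in> N" "E z u"
    have jf: "jf z (j z) \<in> N" "jf z (j z) \<in> truth" using z(1) by (simp_all add: truth_jf)
    with z t1(2) have "E (jf z (j z)) t1" unfolding Q1_def by blast
    then show "\<exists>y\<in>N. E (jf z y) t \<and> jf z y \<in> truth"
      using z(1) jf t(2)[OF jf(1)] by (intro bexI[of _ "j z"]) simp_all
  next
    fix c d s assume N: "c \<in> N" "d \<in> N" "s \<in> N" and z: "E (pr (con 7 c d) s) u \<and> pr (con 7 c d) s \<in> truth"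
    have Q2: "Q2 (pr (con 7 c d) s) y \<longleftrightarrow> y \<in> truth \<and> (y = pr c s \<or> y = pr d s)" for y
      using N by (auto simp: Q2_def)
    have zN: "pr (con 7 c d) s \<in> N" using N by simp
    have "\<exists>y\<in>N. Q2 (pr (con 7 c d) s) y" using z N unfolding Q2 by (auto simp: truth7)
    with bspec[OF t2(2) zN] z obtain y where y: "y \<in> N" "E y t2" "Q2 (pr (con 7 c d) s) y" by blast
    then show "(E (pr c s) t \<and> pr c s \<in> truth) \<or> (E (pr d s) t \<and> pr d s \<in> truth)"
      using t(2)[OF y(1)] unfolding Q2 by auto
  next
    fix n c s assume N: "n \<in> N" "c \<in> N" "s \<in> N" and z: "E (pr (con 9 n c) s) u \<and> pr (con 9 n c) s \<in> truth"
    have Q3: "Q3 (pr (con 9 n c) s) y \<longleftrightarrow> y \<in> truth \<and> (\<exists>s'\<in>N. agr n s s' \<and> y = pr c s')" for y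
      using N by (auto simp: Q3_def)
    have zN: "pr (con 9 n c) s \<in> N" using N by simp
    have "\<exists>y\<in>N. Q3 (pr (con 9 n c) s) y" using z N unfolding Q3 by (auto simp: truth9)
    with bspec[OF t3(2) zN] z obtain y where y: "y \<in> N" "E y t3" "Q3 (pr (con 9 n c) s) y" by blast
    then show "\<exists>s'\<in>N. agr n s s' \<and> E (pr c s') t \<and> pr c s' \<in> truth"
      using t(2)[OF y(1)] unfolding Q3 by blast
  qed
  with t(1) show ?thesis by blast
qed

lemma wit_mono:
  assumes "wit U X Y" "\<And>z. z \<in> N \<Longrightarrow> X' z \<Longrightarrow> X z" "\<And>z. z \<in> N \<Longrightarrow> Y z \<Longrightarrow> Y' z"
  shows "wit U X' Y'"
  unfolding wit_def
proof (intro conjI ballI impI)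
  note w = assms(1)[unfolded wit_def]
  show "\<exists>y\<in>N. Y' (jf z y)" if "z \<in> N" "U z" for z
    using w that assms(3)[OF jf_in] by blast
  show "Y' (pr c s) \<or> Y' (pr d s)" if N: "c \<in> N" "d \<in> N" "s \<in> N" and "X' (pr (con 7 c d) s)" for c d s
  proof -
    have "X (pr (con 7 c d) s)" by (rule assms(2)) (use that in simp_all)
    then have "Y (pr c s) \<or> Y (pr d s)" using w N by blast
    then show ?thesis using assms(3)[OF pr_in] N by blast
  qed
  show "\<exists>s'\<in>N. agr n s s' \<and> Y' (pr c s')" if N: "n \<in> N" "c \<in> N" "s \<in> N" and "X' (pr (con 9 n c) s)" for n c s
  proof -
    have "X (pr (con 9 n c) s)" by (rule assms(2)) (use that in simp_all)
    then have "\<exists>s'\<in>N. agr n s s' \<and> Y (pr c s')" using w N by blast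
    then show ?thesis using assms(3)[OF pr_in] N by blast
  qed
qed

text \<open>
  The positions in which \<open>j\<close> itself is being followed.
\<close>

definition segments :: "'a \<Rightarrow> 'a set" where
  "segments \<kappa> = {z \<in> N. \<exists>u\<in>N. z = pr \<kappa> (pr u (cap truth u))}"

lemma segments_class: "\<kappa> \<in> N \<Longrightarrow> segments \<kappa> \<in> P"
  unfolding segments_def cap_def by (rule comprehension) (intro dfn_intros truth_class)

lemma segments_self_sustaining:
  assumes \<kappa>: "\<kappa> \<in> N" and coh: "coh a \<kappa> (\<lambda>_. True) (\<lambda>z. z \<in> truth)"
    and p: "p \<in> segments \<kappa>" and b: "b \<in> N"
  shows "\<exists>q\<in>segments \<kappa>. extends a b p q"
proof -
  from p obtain u where u: "u \<in> N" "p = pr \<kappa> (pr u (cap truth u))" unfolding segments_def by blast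
  obtain t where t: "t \<in> N" "wit (\<lambda>z. E z u) (\<lambda>z. E z u \<and> z \<in> truth) (\<lambda>z. E z t \<and> z \<in> truth)"
    using truth_witnesses[OF u(1)] by blast
  define u' where "u' = bun u (bun b t)"
  have u': "u' \<in> N" and u'_mem: "\<And>z. z \<in> N \<Longrightarrow> E z u' \<longleftrightarrow> E z u \<or> E z b \<or> E z t"
    unfolding u'_def using u b t by simp_all
  note c = cap[OF truth_class u(1)] and c' = cap[OF truth_class u']
  have sub: "sub u u'" "sub b u'" using u'_mem by (auto intro: subI)
  have 1: "\<forall>z\<in>N. E z (cap truth u) \<longleftrightarrow> E z (cap truth u') \<and> E z u" using c(2) c'(2) u'_mem by blast
  have 2: "coh a \<kappa> (\<lambda>z. E z u') (\<lambda>z. E z (cap truth u'))"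
  proof (rule coh_local[OF \<kappa>])
    show "\<exists>V Y. coh a \<kappa> V Y \<and> (E z1 (cap truth u') \<longrightarrow> Y z1) \<and> (E z2 (cap truth u') \<longrightarrow> Y z2) \<and>
      (E z2 u' \<longrightarrow> V z2 \<and> (Y z2 \<longrightarrow> E z2 (cap truth u')))" if "z1 \<in> N" "z2 \<in> N" for z1 z2
      by (rule exI[of _ "\<lambda>z. E z u'"], rule exI[of _ "\<lambda>z. E z u' \<and> z \<in> truth"])
        (use coh_restrict[OF \<kappa> coh, of "\<lambda>z. E z u'"] c'(2) that in blast)
  qed
  have 3: "wit (\<lambda>z. E z u) (\<lambda>z. E z (cap truth u)) (\<lambda>z. E z (cap truth u'))"
    by (rule wit_mono[OF t(2)]) (use c(2) c'(2) u'_mem in blast)+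
  have "extends a b p (pr \<kappa> (pr u' (cap truth u')))"
    unfolding extends_def u(2)
    by (rule bexI[OF _ \<kappa>], rule bexI[OF _ u(1)], rule bexI[OF _ c(1)], rule bexI[OF _ u'], rule bexI[OF _ c'(1)])
      (intro conjI refl sub 1 2 3)
  moreover have "pr \<kappa> (pr u' (cap truth u')) \<in> segments \<kappa>"
    unfolding segments_def using u' c'(1) \<kappa> by auto
  ultimately show ?thesis by blast
qed

lemma init_segment: "\<kappa> \<in> N \<Longrightarrow> pr \<kappa> (pr emp emp) \<in> segments \<kappa>"
proof -
  assume \<kappa>: "\<kappa> \<in> N"
  have "cap truth emp = emp" using cap[OF truth_class emp_in] by (intro extensionality) simp_all
  then show ?thesis unfolding segments_def using \<kappa> by (auto intro!: bexI[of _ emp])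
qed

end

section \<open>Infinite runs of the game\<close>

context zf2
begin

text \<open>
  A fact about an element of \<open>u n\<close> is decided by \<open>x n\<close> once and for all, so a clause of coherence can be checked at a
  stage that contains the facts occurring in it; a witness is found one stage later.
\<close>

lemma coherent_limit:
  fixes u x :: "nat \<Rightarrow> 'a"
  assumes \<mu>: "\<mu> \<in> N"
    and sub: "\<And>n. sub (u n) (u (Suc n))"
    and ini: "\<And>n z. z \<in> N \<Longrightarrow> E z (x n) \<longleftrightarrow> E z (x (Suc n)) \<and> E z (u n)"
    and coh: "\<And>n. coh a \<mu> (\<lambda>z. E z (u (Suc n))) (\<lambda>z. E z (x (Suc n)))"
    and wit: "\<And>n. wit (\<lambda>z. E z (u n)) (\<lambda>z. E z (x n)) (\<lambda>z. E z (x (Suc n)))"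
    and cover: "\<And>z. z \<in> N \<Longrightarrow> \<exists>n. E z (u n)"
  defines "X \<equiv> \<lambda>z. \<exists>n. E z (x n)"
  shows "coh a \<mu> (\<lambda>_. True) X" "wit (\<lambda>_. True) X X"
proof -
  have u_mono: "E z (u n)" if "m \<le> n" "E z (u m)" "z \<in> N" for m n z
    using that(1,2)
  proof (induction rule: dec_induct)
    case (step k) then show ?case using subD[OF sub that(3)] by blast
  qed
  have x_mono: "E z (x n)" if "m \<le> n" "E z (x m)" "z \<in> N" for m n z
    using that(1,2)
  proof (induction rule: dec_induct)
    case (step k) then show ?case using ini[OF that(3)] by blast
  qed
  have x_down: "E z (x m)" if "m \<le> n" "E z (x n)" "E z (u m)" "z \<in> N" for m n z
    using that(1,3)
  proof (induction rule: inc_induct)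
    case base show ?case by (rule that(2))
  next
    case (step k)
    then have "E z (u k)" by simp
    then have "E z (u (Suc k))" by (rule subD[OF sub that(4)])
    with step \<open>E z (u k)\<close> show ?case using ini[OF that(4)] by blast
  qed
  have X_iff: "X z \<longleftrightarrow> E z (x n)" if "z \<in> N" "E z (u n)" for z n
  proof
    assume "X z"
    then obtain m where m: "E z (x m)" unfolding X_def by blast
    show "E z (x n)"
    proof (cases "m \<le> n")
      case True then show ?thesis using x_mono m that by blast
    next
      case False then show ?thesis using x_down[of n m z] m that by simp
    qed
  qed (auto simp: X_def)
  show "coh a \<mu> (\<lambda>_. True) X"
  proof (rule coh_local[OF \<mu>])
    fix z1 z2 assume z: "z1 \<in> N" "z2 \<in> N"
    obtain n1 n2 where n: "E z1 (u n1)" "E z2 (u n2)" using cover z by blast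
    define n where "n = Suc (max n1 n2)"
    have un: "E z1 (u n)" "E z2 (u n)"
      using u_mono[OF _ n(1) z(1), of n] u_mono[OF _ n(2) z(2), of n] by (simp_all add: n_def)
    show "\<exists>V Y. coh a \<mu> V Y \<and> (X z1 \<longrightarrow> Y z1) \<and> (X z2 \<longrightarrow> Y z2) \<and> (True \<longrightarrow> V z2 \<and> (Y z2 \<longrightarrow> X z2))"
      by (rule exI[of _ "\<lambda>z. E z (u n)"], rule exI[of _ "\<lambda>z. E z (x n)"])
        (use coh[of "max n1 n2"] un z X_iff in \<open>simp add: n_def\<close>)
  qed
  show "wit (\<lambda>_. True) X X"
    unfolding wit_def
  proof (intro conjI ballI impI)
    fix z assume z: "z \<in> N"
    then obtain n where "E z (u n)" using cover by blast
    with z wit[of n] have "\<exists>y\<in>N. E (jf z y) (x (Suc n))" unfolding wit_def by blast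
    then show "\<exists>y\<in>N. X (jf z y)" unfolding X_def by blast
  next
    fix c d s assume N: "c \<in> N" "d \<in> N" "s \<in> N" and "X (pr (con 7 c d) s)"
    then obtain n where "E (pr (con 7 c d) s) (x n)" unfolding X_def by blast
    with N wit[of n] have "E (pr c s) (x (Suc n)) \<or> E (pr d s) (x (Suc n))" unfolding wit_def by blast
    then show "X (pr c s) \<or> X (pr d s)" unfolding X_def by blast
  next
    fix m c s assume N: "m \<in> N" "c \<in> N" "s \<in> N" and "X (pr (con 9 m c) s)"
    then obtain n where "E (pr (con 9 m c) s) (x n)" unfolding X_def by blast
    with N wit[of n] have "\<exists>s'\<in>N. agr m s s' \<and> E (pr c s') (x (Suc n))" unfolding wit_def by blast
    then show "\<exists>s'\<in>N. agr m s s' \<and> X (pr c s')" unfolding X_def by blast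
  qed
qed

context
  fixes a \<mu> X
  assumes \<mu>: "\<mu> \<in> N" and coh: "coh a \<mu> (\<lambda>_. True) X" and wit: "wit (\<lambda>_. True) X X"
begin

text \<open>
  The embedding described by a coherent class with witnesses.
\<close>

definition limit_map :: "'a \<Rightarrow> 'a" where "limit_map z = (THE y. y \<in> N \<and> X (jf z y))"

lemma limit_map:
  assumes z: "z \<in> N" shows "limit_map z \<in> N" and "y \<in> N \<Longrightarrow> X (jf z y) \<longleftrightarrow> y = limit_map z"
proof -
  obtain y0 where y0: "y0 \<in> N" "X (jf z y0)" using wit z unfolding wit_def by blast
  have "limit_map z = y0" unfolding limit_map_def
  proof (rule the_equality)
    fix y assume "y \<in> N \<and> X (jf z y)"
    then show "y = y0" using coh_fun[OF coh z _ y0(1) _ y0(2)] by blast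
  qed (use y0 in blast)
  then show "limit_map z \<in> N" "y \<in> N \<Longrightarrow> X (jf z y) \<longleftrightarrow> y = limit_map z"
    using y0 coh_fun[OF coh z _ y0(1) _ y0(2), of y] by auto
qed

text \<open>
  Only the direction from codes to satisfaction is available, as a coherent class may leave the truth value
  of some codes open. For valid formulas coherence supplies the codes.
\<close>

lemma limit_map_sound: "s \<in> N \<Longrightarrow> X (pr (cd \<phi> b) s) \<Longrightarrow> sat N E limit_map \<phi> (vals s) = b"
proof (induction \<phi> arbitrary: b s)
  case (FEq i k)
  then show ?case using coh0[OF coh num_in num_in] coh1[OF coh num_in num_in]
    by (cases b) (simp_all add: vals_def)
next
  case (FMem i k)
  then show ?case using coh2[OF coh num_in num_in] coh3[OF coh num_in num_in]
    by (cases b) (simp_all add: vals_def)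
next
  case (FJ i k)
  have v: "vals s i \<in> N" "vals s k \<in> N" using FJ(1) by (simp_all add: vals_in)
  note m = limit_map[OF v(1)]
  have m1: "X (jf (val s (num i)) (limit_map (vals s i)))" using m by (simp add: vals_def)
  show ?case
  proof (cases b)
    case True
    then have "X (pr (con 4 (num i) (num k)) s)" using FJ(2) by simp
    from coh4[OF coh num_in num_in FJ(1) m(1) this m1] True show ?thesis by (simp add: vals_def)
  next
    case False
    then have "X (pr (con 5 (num i) (num k)) s)" using FJ(2) by simp
    from coh5[OF coh num_in num_in FJ(1) this] False show ?thesis using m(2)[OF v(2)] by (auto simp: vals_def)
  qed
next
  case (FNeg \<phi>)
  then show ?case using FNeg.IH[of s "\<not> b"] by auto
next
  case (FAnd \<phi> \<psi>)
  show ?case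
  proof (cases b)
    case True
    then have h: "X (pr (con 6 (cd \<phi> True) (cd \<psi> True)) s)" using FAnd.prems by simp
    have "X (pr (cd \<phi> True) s)" "X (pr (cd \<psi> True) s)"
      using coh6[OF coh cd_in cd_in FAnd.prems(1) h] coh6'[OF coh cd_in cd_in FAnd.prems(1) h] by simp_all
    then show ?thesis using FAnd.IH FAnd.prems(1) True by simp
  next
    case False
    then have h: "X (pr (con 7 (cd \<phi> False) (cd \<psi> False)) s)" using FAnd.prems by simp
    have "X (pr (cd \<phi> False) s) \<or> X (pr (cd \<psi> False) s)"
      using wit h FAnd.prems(1) cd_in unfolding wit_def by blast
    then show ?thesis using FAnd.IH(1)[OF FAnd.prems(1), of False] FAnd.IH(2)[OF FAnd.prems(1), of False] False
      by auto
  qed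
next
  case (FAll n \<phi>)
  show ?case
  proof (cases b)
    case True
    then have h: "X (pr (con 8 (num n) (cd \<phi> True)) s)" using FAll.prems by simp
    have "sat N E limit_map \<phi> ((vals s)(n := x))" if x: "x \<in> N" for x
    proof -
      obtain s' where s': "s' \<in> N" "agr (num n) s s'" "val s' (num n) = x"
        using update_ex[OF num_in FAll.prems(1) x] by blast
      have "X (pr (cd \<phi> True) s')" using coh8[OF coh num_in cd_in FAll.prems(1) s'(1) h s'(2)] by simp
      from FAll.IH[OF s'(1) this] show ?thesis unfolding agr_vals[OF s'(2)] s'(3) eq_True .
    qed
    then show ?thesis using True by simp
  next
    case False
    then have h: "X (pr (con 9 (num n) (cd \<phi> False)) s)" using FAll.prems by simp
    then obtain s' where s': "s' \<in> N" "agr (num n) s s'" "X (pr (cd \<phi> False) s')"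
      using wit FAll.prems(1) cd_in num_in unfolding wit_def by blast
    from FAll.IH[OF s'(1,3)] have "\<not> sat N E limit_map \<phi> ((vals s)(n := val s' (num n)))"
      unfolding agr_vals[OF s'(2)] by (simp only: eq_False not_False_eq_True)
    moreover have "val s' (num n) \<in> N" using s'(1) by simp
    ultimately show ?thesis using False by auto
  qed
qed

lemma limit_map_valid:
  assumes "E (cd \<phi> True) a" shows "valid_in N E limit_map \<phi>"
  unfolding valid_in_def
proof (intro allI impI)
  fix v :: "nat \<Rightarrow> 'a" assume "range v \<subseteq> N"
  from vals_prefix_ex[OF this] obtain s where s: "s \<in> N" "\<forall>i<fm_bound \<phi>. vals s i = v i" by blast
  have "X (pr (cd \<phi> True) s)" using coh_valid[OF coh cd_in s(1) assms] by simp
  from limit_map_sound[OF s(1) this] sat_cong[OF s(2)] show "sat N E limit_map \<phi> v" by simp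
qed

end

subsection \<open>Ordinals\<close>

lemma ordD:
  assumes "ord_in N E a"
  shows ord_N: "a \<in> N" and ord_trans: "x \<in> N \<Longrightarrow> E x a \<Longrightarrow> sub x a"
    and ord_linear: "x \<in> N \<Longrightarrow> y \<in> N \<Longrightarrow> E x a \<Longrightarrow> E y a \<Longrightarrow> E x y \<or> x = y \<or> E y x"
  using assms unfolding ord_in_def by simp_all

lemma no_3_loop:
  assumes N: "x \<in> N" "y \<in> N" "z \<in> N" and "E x y" "E y z" shows "\<not> E z x"
proof
  assume "E z x"
  define T where "T = bun (up x y) (up z z)"
  have T: "T \<in> N" "\<And>w. w \<in> N \<Longrightarrow> E w T \<longleftrightarrow> w = x \<or> w = y \<or> w = z"
    unfolding T_def using N by auto
  obtain m where "m \<in> N" "E m T" "\<not> (\<exists>w\<in>N. E w m \<and> E w T)"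
    using set_foundation[OF T(1) N(1)] T(2)[OF N(1)] by blast
  then show False using T(2) N assms(4,5) \<open>E z x\<close> by metis
qed

lemma transitive_initial_ord:
  assumes b: "ord_in N E b" and a: "a \<in> N" "sub a b" "a \<noteq> b"
    and tr: "\<And>x. x \<in> N \<Longrightarrow> E x a \<Longrightarrow> sub x a"
  shows "E a b"
proof -
  have bN: "b \<in> N" using b by (rule ord_N)
  have dQ: "dfn False (\<lambda>v w. \<not> E (v 0) a)" by (intro dfn_intros a)
  note d = sep[OF dQ bN]
  have "\<exists>x\<in>N. E x b \<and> \<not> E x a"
    using extensionality[OF a(1) bN] a(2,3) unfolding sub_in_def by blast
  then obtain x where "x \<in> N" "E x (sep b (\<lambda>x. \<not> E x a))" using d(2) by blast
  from set_foundation[OF d(1) this] obtain m where m: "m \<in> N" "E m (sep b (\<lambda>x. \<not> E x a))"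
    "\<not> (\<exists>z\<in>N. E z m \<and> E z (sep b (\<lambda>x. \<not> E x a)))" by blast
  have mb: "E m b" "\<not> E m a" using m(1,2) d(2) by simp_all
  have "m = a"
  proof (rule extensionality[OF m(1) a(1)])
    fix z assume z: "z \<in> N"
    show "E z m \<longleftrightarrow> E z a"
    proof
      assume zm: "E z m"
      then have "E z b" using subD[OF ord_trans[OF b m(1) mb(1)] z] by blast
      then show "E z a" using m(3) zm z d(2)[OF z] by blast
    next
      assume za: "E z a"
      then have "E z b" using subD[OF a(2) z] by blast
      from ord_linear[OF b z m(1) this mb(1)] show "E z m"
        using za mb(2) subD[OF tr[OF z za] m(1)] by blast
    qed
  qed
  with mb show ?thesis by simp
qed

lemma ord_trichotomy:
  assumes a: "ord_in N E a" and b: "ord_in N E b" shows "E a b \<or> a = b \<or> E b a"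
proof (rule ccontr)
  assume no: "\<not> ?thesis"
  have N: "a \<in> N" "b \<in> N" using a b by (simp_all add: ord_N)
  have dQ: "dfn False (\<lambda>v w. E (v 0) b)" by (intro dfn_intros N)
  note c = sep[OF dQ N(1)]
  define c where "c = sep a (\<lambda>x. E x b)"
  have cN: "c \<in> N" and cm: "\<And>z. z \<in> N \<Longrightarrow> E z c \<longleftrightarrow> E z a \<and> E z b" using c by (simp_all add: c_def)
  have sub: "sub c a" "sub c b" by (rule subI; use cm in blast)+
  have tr: "sub x c" if "x \<in> N" "E x c" for x
    using that cm subD[OF ord_trans[OF a]] subD[OF ord_trans[OF b]] by (intro subI) blast
  have "c \<noteq> a" using no transitive_initial_ord[OF b N(1)] sub(2) ord_trans[OF a] by blast
  moreover have "c \<noteq> b" using no transitive_initial_ord[OF a N(2)] sub(1) ord_trans[OF b] by blast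
  ultimately have "E c a" "E c b"
    using transitive_initial_ord[OF a cN sub(1) _ tr] transitive_initial_ord[OF b cN sub(2) _ tr] by blast+
  then have "E c c" using cm cN by blast
  with no_loop cN show False by blast
qed

lemma ord_elem:
  assumes b: "ord_in N E b" and a: "a \<in> N" "E a b" shows "ord_in N E a"
  unfolding ord_in_def
proof (intro conjI ballI impI)
  have ab: "sub a b" using ord_trans[OF b a] .
  show "a \<in> N" by (rule a)
  show "sub x a" if x: "x \<in> N" "E x a" for x
  proof (rule subI)
    fix z assume z: "z \<in> N" "E z x"
    have xb: "E x b" using subD[OF ab x] .
    have zb: "E z b" using subD[OF ord_trans[OF b x(1) xb] z] .
    from ord_linear[OF b z(1) a(1) zb a(2)] show "E z a"
      using no_2_loop[OF x(1) a(1) x(2)] no_3_loop[OF z(1) x(1) a(1) z(2) x(2)] z by blast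
  qed
  show "E x y \<or> x = y \<or> E y x" if "x \<in> N" "y \<in> N" "E x a \<and> E y a" for x y
    using that ord_linear[OF b] subD[OF ab] by blast
qed

text \<open>
  Countability enters here: along an enumeration \<open>e\<close> of \<open>N\<close>, the \<open>n\<close>-th challenge is \<open>{e n}\<close>.
\<close>

lemma branch_embedding:
  assumes N: "countable N" and a: "a \<in> N" and \<mu>: "ord_in N E \<mu>"
    and start: "pr \<mu> (pr emp emp) \<notin> lost (extends a)"
  shows "\<exists>k \<in> N \<rightarrow> N. is_crit N E k \<mu> \<and> (\<forall>\<phi>. E (cd \<phi> True) a \<longrightarrow> valid_in N E k \<phi>)"
proof -
  have \<mu>N: "\<mu> \<in> N" using \<mu> by (rule ord_N)
  define L where "L = lost (extends a)"
  define e where "e = from_nat_into N"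
  have "N \<noteq> {}" using emp_in by blast
  then have e: "range e = N" unfolding e_def using N by (rule range_from_nat_into)
  then have eN: "e n \<in> N" for n by blast
  define Pos where "Pos p \<longleftrightarrow> p \<in> N \<and> p \<notin> L \<and> (\<exists>u\<in>N. \<exists>x\<in>N. p = pr \<mu> (pr u x))" for p
  have step: "\<exists>q. Pos q \<and> extends a (up (e n) (e n)) p q" if p: "Pos p" for p n
  proof -
    have "\<not> forced (extends a) (\<lambda>q. q \<in> L) p"
      using p lost_iff[OF dfn_extends'[OF a] extends_anti, of p] unfolding Pos_def L_def by blast
    then obtain q where q: "q \<in> N" "q \<notin> L" "extends a (up (e n) (e n)) p q"
      using up_in[OF eN eN] unfolding forced_def[OF dfn_extends'[OF a] extends_anti] by blast
    from q(3) obtain \<nu> u x u' x' where *: "\<nu> \<in> N" "u \<in> N" "x \<in> N" "u' \<in> N" "x' \<in> N"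
      "p = pr \<nu> (pr u x)" "q = pr \<nu> (pr u' x')" unfolding extends_def by blast
    from p obtain v y where "v \<in> N" "y \<in> N" "p = pr \<mu> (pr v y)" unfolding Pos_def by blast
    with * \<mu>N have "\<nu> = \<mu>" by simp
    with * q show ?thesis unfolding Pos_def by blast
  qed
  have "Pos (pr \<mu> (pr emp emp))" unfolding Pos_def L_def using start \<mu>N by auto
  then obtain f where f: "\<And>n. Pos (f n)" "\<And>n. extends a (up (e n) (e n)) (f n) (f (Suc n))"
    using dependent_nat_choice[of "\<lambda>n. Pos" "\<lambda>n p q. extends a (up (e n) (e n)) p q"] step by blast
  have "\<forall>n. \<exists>ux. fst ux \<in> N \<and> snd ux \<in> N \<and> f n = pr \<mu> (pr (fst ux) (snd ux))"
    using f(1) unfolding Pos_def by (metis fst_conv snd_conv)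
  then obtain ux where ux: "\<forall>n. fst (ux n) \<in> N \<and> snd (ux n) \<in> N \<and> f n = pr \<mu> (pr (fst (ux n)) (snd (ux n)))"
    by (rule choice[THEN exE]) blast
  define u where "u n = fst (ux n)" for n
  define x where "x n = snd (ux n)" for n
  have ux: "u n \<in> N" "x n \<in> N" "f n = pr \<mu> (pr (u n) (x n))" for n using ux by (simp_all add: u_def x_def)
  have ext: "sub (u n) (u (Suc n)) \<and> sub (up (e n) (e n)) (u (Suc n)) \<and>
     (\<forall>z\<in>N. E z (x n) \<longleftrightarrow> E z (x (Suc n)) \<and> E z (u n)) \<and>
     coh a \<mu> (\<lambda>z. E z (u (Suc n))) (\<lambda>z. E z (x (Suc n))) \<and>
     wit (\<lambda>z. E z (u n)) (\<lambda>z. E z (x n)) (\<lambda>z. E z (x (Suc n)))" for n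
  proof -
    from f(2)[of n] obtain \<nu> v y v' y' where *: "\<nu> \<in> N" "v \<in> N" "y \<in> N" "v' \<in> N" "y' \<in> N"
      "f n = pr \<nu> (pr v y)" "f (Suc n) = pr \<nu> (pr v' y')" 
      "sub v v' \<and> sub (up (e n) (e n)) v' \<and> (\<forall>z\<in>N. E z y \<longleftrightarrow> E z y' \<and> E z v) \<and>
       coh a \<nu> (\<lambda>z. E z v') (\<lambda>z. E z y') \<and> wit (\<lambda>z. E z v) (\<lambda>z. E z y) (\<lambda>z. E z y')"
      unfolding extends_def by blast
    have "\<nu> = \<mu>" "v = u n" "y = x n" using *(1-3,6) ux[of n] \<mu>N by simp_all
    moreover have "v' = u (Suc n)" "y' = x (Suc n)" using *(1,4,5,7) ux[of "Suc n"] \<mu>N by simp_all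
    ultimately show ?thesis using *(8) by simp
  qed
  have cover: "\<exists>n. E z (u n)" if z: "z \<in> N" for z
  proof -
    obtain n where n: "z = e n" using z e by blast
    have "E z (up (e n) (e n))" using n eN by simp
    then have "E z (u (Suc n))" using ext[of n] subD z by blast
    then show ?thesis by blast
  qed
  define X where "X z \<longleftrightarrow> (\<exists>n. E z (x n))" for z
  have lim: "coh a \<mu> (\<lambda>_. True) X" "wit (\<lambda>_. True) X X"
    using coherent_limit[OF \<mu>N, of u x a] ext cover unfolding X_def by blast+
  define k where "k = limit_map X"
  have kN: "k z \<in> N" and k: "y \<in> N \<Longrightarrow> X (jf z y) \<longleftrightarrow> y = k z" if "z \<in> N" for z y
    using limit_map[OF \<mu>N lim that] unfolding k_def by simp_all
  have "is_crit N E k \<mu>" unfolding is_crit_def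
  proof (intro conjI allI impI)
    show "ord_in N E \<mu>" by (rule \<mu>)
    show "k \<mu> \<noteq> \<mu>" using k[OF \<mu>N \<mu>N] coh_move[OF lim(1)] by metis
    fix \<alpha> assume \<alpha>: "ord_in N E \<alpha> \<and> k \<alpha> \<noteq> \<alpha>"
    then have \<alpha>N: "\<alpha> \<in> N" using ord_N by blast
    have "\<not> E \<alpha> \<mu>"
    proof
      assume "E \<alpha> \<mu>"
      moreover have "X (jf \<alpha> (k \<alpha>))" using k[OF \<alpha>N kN[OF \<alpha>N]] by simp
      ultimately show False using coh_fix[OF lim(1) \<alpha>N kN[OF \<alpha>N]] \<alpha> by blast
    qed
    then show "ord_le E \<mu> \<alpha>" using ord_trichotomy[OF \<mu>] \<alpha> unfolding ord_le_def by blast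
  qed
  moreover have "k \<in> N \<rightarrow> N" using kN by blast
  moreover have "\<forall>\<phi>. E (cd \<phi> True) a \<longrightarrow> valid_in N E k \<phi>"
    using limit_map_valid[OF \<mu>N lim] unfolding k_def by blast
  ultimately show ?thesis by blast
qed

end

section \<open>The collapse of a set whose image contains the critical point\<close>

context embedding
begin

context
  fixes \<kappa> Y
  assumes \<kappa>: "ord_in N E \<kappa>" and fix_below: "\<forall>z\<in>N. E z \<kappa> \<longrightarrow> j z = z" and moved: "E \<kappa> (j \<kappa>)"
    and Y: "Y \<in> N" "sub Y \<kappa>" "E \<kappa> (j Y)"
begin

lemma \<kappa>N: "\<kappa> \<in> N" using \<kappa> by (rule ord_N)

text \<open>
  The transitive collapse of \<open>Y\<close>, as the least relation \<open>col\<close> such that \<open>y\<close> is related to \<open>\<xi>\<close> if and only if \<open>\<xi>\<close>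
  consists of the ordinals related to elements of \<open>Y\<close> below \<open>y\<close>. This is a positive condition on the relation, so
  recursion on ordinals is not required.
\<close>

definition col_op :: "'a set \<Rightarrow> 'a \<Rightarrow> bool" where
  "col_op X z \<longleftrightarrow> (\<exists>y\<in>N. \<exists>\<xi>\<in>N. z = pr y \<xi> \<and> E y Y \<and> E \<xi> \<kappa> \<and>
     (\<forall>y'\<in>N. E y' Y \<longrightarrow> E y' y \<longrightarrow> (\<exists>\<eta>\<in>N. E \<eta> \<xi> \<and> pr y' \<eta> \<in> X)) \<and>
     (\<forall>\<eta>\<in>N. E \<eta> \<xi> \<longrightarrow> (\<exists>y'\<in>N. E y' Y \<and> E y' y \<and> pr y' \<eta> \<in> X)))"

definition col :: "'a \<Rightarrow> 'a \<Rightarrow> bool" where "col y \<xi> \<longleftrightarrow> pr y \<xi> \<in> lfpc col_op"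

lemma dfn_col_op: "dfn False (\<lambda>v w. col_op (w 0) (v 0))"
  unfolding col_op_def by (intro dfn_intros Y(1) \<kappa>N)

lemma col_op_mono: "\<forall>X Z z. X \<subseteq> Z \<longrightarrow> col_op X z \<longrightarrow> col_op Z z"
proof (intro allI impI)
  fix X Z :: "'a set" and z assume XZ: "X \<subseteq> Z" and "col_op X z"
  then obtain y \<xi> where *: "y \<in> N" "\<xi> \<in> N" "z = pr y \<xi>" "E y Y" "E \<xi> \<kappa>"
    "\<forall>y'\<in>N. E y' Y \<longrightarrow> E y' y \<longrightarrow> (\<exists>\<eta>\<in>N. E \<eta> \<xi> \<and> pr y' \<eta> \<in> X)"
    "\<forall>\<eta>\<in>N. E \<eta> \<xi> \<longrightarrow> (\<exists>y'\<in>N. E y' Y \<and> E y' y \<and> pr y' \<eta> \<in> X)" unfolding col_op_def by blast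
  have "\<forall>y'\<in>N. E y' Y \<longrightarrow> E y' y \<longrightarrow> (\<exists>\<eta>\<in>N. E \<eta> \<xi> \<and> pr y' \<eta> \<in> Z)" using *(6) XZ by blast
  moreover have "\<forall>\<eta>\<in>N. E \<eta> \<xi> \<longrightarrow> (\<exists>y'\<in>N. E y' Y \<and> E y' y \<and> pr y' \<eta> \<in> Z)" using *(7) XZ by blast
  ultimately show "col_op Z z" unfolding col_op_def using *(1-5) by blast
qed

lemma col_class: "lfpc col_op \<in> P" by (rule lfpc_class[OF dfn_col_op col_op_mono])

lemma dfn_col [dfn_intros]: "tm False s \<Longrightarrow> tm False t \<Longrightarrow> dfn False (\<lambda>v w. col (s v w) (t v w))"
  unfolding col_def by (intro dfn_intros col_class)

lemma col_iff:
  assumes "y \<in> N" "\<xi> \<in> N"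
  shows "col y \<xi> \<longleftrightarrow> E y Y \<and> E \<xi> \<kappa> \<and>
     (\<forall>y'\<in>N. E y' Y \<longrightarrow> E y' y \<longrightarrow> (\<exists>\<eta>\<in>N. E \<eta> \<xi> \<and> col y' \<eta>)) \<and>
     (\<forall>\<eta>\<in>N. E \<eta> \<xi> \<longrightarrow> (\<exists>y'\<in>N. E y' Y \<and> E y' y \<and> col y' \<eta>))"
proof -
  have "col y \<xi> \<longleftrightarrow> col_op (lfpc col_op) (pr y \<xi>)"
    unfolding col_def by (rule lfpc_unfold[OF dfn_col_op col_op_mono]) (use assms in simp)
  also have "\<dots> \<longleftrightarrow> E y Y \<and> E \<xi> \<kappa> \<and>
     (\<forall>y'\<in>N. E y' Y \<longrightarrow> E y' y \<longrightarrow> (\<exists>\<eta>\<in>N. E \<eta> \<xi> \<and> pr y' \<eta> \<in> lfpc col_op)) \<and>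
     (\<forall>\<eta>\<in>N. E \<eta> \<xi> \<longrightarrow> (\<exists>y'\<in>N. E y' Y \<and> E y' y \<and> pr y' \<eta> \<in> lfpc col_op))" (is "_ \<longleftrightarrow> ?R")
  proof
    assume "col_op (lfpc col_op) (pr y \<xi>)"
    then obtain y0 \<xi>0 where *: "y0 \<in> N" "\<xi>0 \<in> N" "pr y \<xi> = pr y0 \<xi>0" "E y0 Y" "E \<xi>0 \<kappa>"
      "\<forall>y'\<in>N. E y' Y \<longrightarrow> E y' y0 \<longrightarrow> (\<exists>\<eta>\<in>N. E \<eta> \<xi>0 \<and> pr y' \<eta> \<in> lfpc col_op)"
      "\<forall>\<eta>\<in>N. E \<eta> \<xi>0 \<longrightarrow> (\<exists>y'\<in>N. E y' Y \<and> E y' y0 \<and> pr y' \<eta> \<in> lfpc col_op)"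
      unfolding col_op_def by blast
    then have "y0 = y" "\<xi>0 = \<xi>" using assms by simp_all
    with * show ?R by blast
  next
    assume ?R then show "col_op (lfpc col_op) (pr y \<xi>)" unfolding col_op_def using assms by blast
  qed
  finally show ?thesis unfolding col_def .
qed

lemma colD:
  assumes "col y \<xi>" "y \<in> N" "\<xi> \<in> N"
  shows col_Y: "E y Y" and col_\<kappa>: "E \<xi> \<kappa>"
    and col_fwd: "\<lbrakk>y' \<in> N; E y' Y; E y' y\<rbrakk> \<Longrightarrow> \<exists>\<eta>\<in>N. E \<eta> \<xi> \<and> col y' \<eta>"
    and col_bwd: "\<lbrakk>\<eta> \<in> N; E \<eta> \<xi>\<rbrakk> \<Longrightarrow> \<exists>y'\<in>N. E y' Y \<and> E y' y \<and> col y' \<eta>"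
  using assms(1) unfolding col_iff[OF assms(2,3)] by blast+

lemma col_fun:
  assumes y: "y \<in> N" shows "\<forall>\<xi>\<in>N. \<forall>\<xi>'\<in>N. col y \<xi> \<longrightarrow> col y \<xi>' \<longrightarrow> \<xi> = \<xi>'"
proof (rule set_induct[OF _ y, where Q = "\<lambda>y. \<forall>\<xi>\<in>N. \<forall>\<xi>'\<in>N. col y \<xi> \<longrightarrow> col y \<xi>' \<longrightarrow> \<xi> = \<xi>'"])
  show "dfn False (\<lambda>v w. \<forall>\<xi>\<in>N. \<forall>\<xi>'\<in>N. col (v 0) \<xi> \<longrightarrow> col (v 0) \<xi>' \<longrightarrow> \<xi> = \<xi>')" by (intro dfn_intros)
  fix y assume y: "y \<in> N"
    and IH: "\<And>y'. y' \<in> N \<Longrightarrow> E y' y \<Longrightarrow> \<forall>\<xi>\<in>N. \<forall>\<xi>'\<in>N. col y' \<xi> \<longrightarrow> col y' \<xi>' \<longrightarrow> \<xi> = \<xi>'"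
  have no: "\<not> E \<xi> \<xi>'" if c: "\<xi> \<in> N" "\<xi>' \<in> N" "col y \<xi>" "col y \<xi>'" for \<xi> \<xi>'
  proof
    assume "E \<xi> \<xi>'"
    from col_bwd[OF c(4) y c(2) c(1) this] obtain y' where y': "y' \<in> N" "E y' Y" "E y' y" "col y' \<xi>" by blast
    from col_fwd[OF c(3) y c(1) y'(1-3)] obtain \<eta> where \<eta>: "\<eta> \<in> N" "E \<eta> \<xi>" "col y' \<eta>" by blast
    have "\<eta> = \<xi>" using IH[OF y'(1,3)] \<eta> y'(4) c(1) by blast
    with \<eta>(2) no_loop[OF c(1)] show False by simp
  qed
  show "\<forall>\<xi>\<in>N. \<forall>\<xi>'\<in>N. col y \<xi> \<longrightarrow> col y \<xi>' \<longrightarrow> \<xi> = \<xi>'"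
  proof (intro ballI impI)
    fix \<xi> \<xi>' assume c: "\<xi> \<in> N" "\<xi>' \<in> N" "col y \<xi>" "col y \<xi>'"
    from ord_linear[OF \<kappa> c(1,2) col_\<kappa>[OF c(3) y c(1)] col_\<kappa>[OF c(4) y c(2)]]
    show "\<xi> = \<xi>'" using no[OF c] no[OF c(2,1,4,3)] by blast
  qed
qed

lemma col_inj:
  assumes N: "y \<in> N" "y' \<in> N" "\<xi> \<in> N" and c: "col y \<xi>" "col y' \<xi>" shows "y = y'"
proof -
  have no: "\<not> E y' y" if N: "y \<in> N" "y' \<in> N" and c: "col y \<xi>" "col y' \<xi>" for y y'
  proof
    assume "E y' y"
    from col_fwd[OF c(1) N(1) \<open>\<xi> \<in> N\<close> N(2) col_Y[OF c(2) N(2) \<open>\<xi> \<in> N\<close>] this]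
    obtain \<eta> where \<eta>: "\<eta> \<in> N" "E \<eta> \<xi>" "col y' \<eta>" by blast
    have "\<eta> = \<xi>" using col_fun[OF N(2)] \<eta> c(2) \<open>\<xi> \<in> N\<close> by blast
    with \<eta>(2) no_loop[OF \<open>\<xi> \<in> N\<close>] show False by simp
  qed
  have "E y \<kappa>" "E y' \<kappa>"
    using subD[OF Y(2) N(1) col_Y[OF c(1) N(1,3)]] subD[OF Y(2) N(2) col_Y[OF c(2) N(2,3)]] by auto
  from ord_linear[OF \<kappa> N(1,2) this] no[OF N(1,2) c] no[OF N(2,1) c(2,1)] show ?thesis by blast
qed

definition colset :: 'a where "colset = sep (pw (pw \<kappa>)) (\<lambda>z. z \<in> lfpc col_op)"

lemma colset_in: "colset \<in> N"
  and colset_mem: "y \<in> N \<Longrightarrow> \<xi> \<in> N \<Longrightarrow> E (pr y \<xi>) colset \<longleftrightarrow> col y \<xi>"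
  and colset_pair: "z \<in> N \<Longrightarrow> E z colset \<Longrightarrow> \<exists>y\<in>N. \<exists>\<xi>\<in>N. z = pr y \<xi>"
proof -
  have d: "dfn False (\<lambda>v w. v 0 \<in> lfpc col_op)" by (intro dfn_intros col_class)
  have K: "pw (pw \<kappa>) \<in> N" using \<kappa>N by simp
  note s = sep[OF d K]
  show "colset \<in> N" using s by (simp add: colset_def)
  show "E (pr y \<xi>) colset \<longleftrightarrow> col y \<xi>" if N: "y \<in> N" "\<xi> \<in> N"
  proof -
    have "E (pr y \<xi>) (pw (pw \<kappa>))" if c: "col y \<xi>"
    proof -
      have "E y \<kappa>" "E \<xi> \<kappa>" using subD[OF Y(2) N(1) col_Y[OF c N]] col_\<kappa>[OF c N] by auto
      then show ?thesis using N \<kappa>N by (auto simp: pr_def sub_in_def)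
    qed
    then show ?thesis using s(2)[OF pr_in[OF N]] by (auto simp: colset_def col_def)
  qed
  show "\<exists>y\<in>N. \<exists>\<xi>\<in>N. z = pr y \<xi>" if "z \<in> N" "E z colset"
  proof -
    have "z \<in> lfpc col_op" using that s(2) by (simp add: colset_def)
    then have "col_op (lfpc col_op) z" using lfpc_unfold[OF dfn_col_op col_op_mono that(1)] by simp
    then show ?thesis unfolding col_op_def by blast
  qed
qed

lemma jcol_mem: "y \<in> N \<Longrightarrow> \<xi> \<in> N \<Longrightarrow> E y \<kappa> \<Longrightarrow> E \<xi> \<kappa> \<Longrightarrow> E (pr y \<xi>) (j colset) \<longleftrightarrow> col y \<xi>"
proof -
  assume *: "y \<in> N" "\<xi> \<in> N" "E y \<kappa>" "E \<xi> \<kappa>"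
  then have "j (pr y \<xi>) = pr y \<xi>" using fix_below by simp
  then show ?thesis using j_mem[of "pr y \<xi>" colset] * colset_in colset_mem by simp
qed

lemma jcol_fun:
  assumes "y \<in> N" "\<xi> \<in> N" "\<xi>' \<in> N" "E (pr y \<xi>) (j colset)" "E (pr y \<xi>') (j colset)" shows "\<xi> = \<xi>'"
proof -
  have "\<forall>y\<in>N. \<forall>\<xi>\<in>N. \<forall>\<xi>'\<in>N. E (pr y \<xi>) colset \<longrightarrow> E (pr y \<xi>') colset \<longrightarrow> \<xi> = \<xi>'"
    using col_fun colset_mem by simp
  moreover have "dfn True (\<lambda>v w. \<forall>y\<in>N. \<forall>\<xi>\<in>N. \<forall>\<xi>'\<in>N. E (pr y \<xi>) (v 0) \<longrightarrow> E (pr y \<xi>') (v 0) \<longrightarrow> \<xi> = \<xi>')"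
    by (intro dfn_intros)
  ultimately have "\<forall>y\<in>N. \<forall>\<xi>\<in>N. \<forall>\<xi>'\<in>N. E (pr y \<xi>) (j colset) \<longrightarrow> E (pr y \<xi>') (j colset) \<longrightarrow> \<xi> = \<xi>'"
    using elem1[of "\<lambda>f. \<forall>y\<in>N. \<forall>\<xi>\<in>N. \<forall>\<xi>'\<in>N. E (pr y \<xi>) f \<longrightarrow> E (pr y \<xi>') f \<longrightarrow> \<xi> = \<xi>'", OF _ colset_in] by simp
  with assms show ?thesis by blast
qed

lemma jcol_inj:
  assumes "y \<in> N" "y' \<in> N" "\<xi> \<in> N" "E (pr y \<xi>) (j colset)" "E (pr y' \<xi>) (j colset)" shows "y = y'"
proof -
  have "\<forall>y\<in>N. \<forall>y'\<in>N. \<forall>\<xi>\<in>N. E (pr y \<xi>) colset \<longrightarrow> E (pr y' \<xi>) colset \<longrightarrow> y = y'"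
    using col_inj colset_mem by blast
  moreover have "dfn True (\<lambda>v w. \<forall>y\<in>N. \<forall>y'\<in>N. \<forall>\<xi>\<in>N. E (pr y \<xi>) (v 0) \<longrightarrow> E (pr y' \<xi>) (v 0) \<longrightarrow> y = y')"
    by (intro dfn_intros)
  ultimately have "\<forall>y\<in>N. \<forall>y'\<in>N. \<forall>\<xi>\<in>N. E (pr y \<xi>) (j colset) \<longrightarrow> E (pr y' \<xi>) (j colset) \<longrightarrow> y = y'"
    using elem1[of "\<lambda>f. \<forall>y\<in>N. \<forall>y'\<in>N. \<forall>\<xi>\<in>N. E (pr y \<xi>) f \<longrightarrow> E (pr y' \<xi>) f \<longrightarrow> y = y'", OF _ colset_in] by simp
  with assms show ?thesis by blast
qed

text \<open>
  If \<open>y\<close> is least without a value, then the values below \<open>y\<close> form an initial segment \<open>D\<close> of \<open>\<kappa>\<close>, which would be a value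
  for \<open>y\<close> unless it is all of \<open>\<kappa>\<close>. But a surjection from a subset of \<open>y\<close> onto \<open>\<kappa>\<close> contradicts that \<open>\<kappa>\<close> is critical.
\<close>

lemma col_total:
  assumes y: "y \<in> N" shows "E y Y \<longrightarrow> (\<exists>\<xi>\<in>N. col y \<xi>)"
proof (rule set_induct[OF _ y, where Q = "\<lambda>y. E y Y \<longrightarrow> (\<exists>\<xi>\<in>N. col y \<xi>)"])
  show "dfn False (\<lambda>v w. E (v 0) Y \<longrightarrow> (\<exists>\<xi>\<in>N. col (v 0) \<xi>))" by (intro dfn_intros Y)
  fix y assume y: "y \<in> N" and IH: "\<And>y'. y' \<in> N \<Longrightarrow> E y' y \<Longrightarrow> E y' Y \<longrightarrow> (\<exists>\<xi>\<in>N. col y' \<xi>)"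
  show "E y Y \<longrightarrow> (\<exists>\<xi>\<in>N. col y \<xi>)"
  proof
    assume yY: "E y Y"
    have y\<kappa>: "E y \<kappa>" using subD[OF Y(2) y yY] .
    have yo: "ord_in N E y" using ord_elem[OF \<kappa> y y\<kappa>] .
    define Q where "Q \<eta> \<longleftrightarrow> (\<exists>y'\<in>N. E y' Y \<and> E y' y \<and> col y' \<eta>)" for \<eta>
    have Q: "dfn False (\<lambda>v w. Q (v 0))" unfolding Q_def by (intro dfn_intros Y y)
    define D where "D = sep \<kappa> Q"
    have DN: "D \<in> N" and Dm: "\<And>\<eta>. \<eta> \<in> N \<Longrightarrow> E \<eta> D \<longleftrightarrow> E \<eta> \<kappa> \<and> Q \<eta>"
      using sep[OF Q \<kappa>N] by (simp_all add: D_def)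
    have Dsub: "sub D \<kappa>" by (rule subI) (simp add: Dm)
    have Dtr: "sub \<eta> D" if \<eta>: "\<eta> \<in> N" "E \<eta> D" for \<eta>
    proof (rule subI)
      fix \<zeta> assume \<zeta>: "\<zeta> \<in> N" "E \<zeta> \<eta>"
      from \<eta> Dm obtain y' where y': "y' \<in> N" "E y' Y" "E y' y" "col y' \<eta>" unfolding Q_def by blast
      from col_bwd[OF y'(4,1) \<eta>(1) \<zeta>] obtain y'' where y'': "y'' \<in> N" "E y'' Y" "E y'' y'" "col y'' \<zeta>" by blast
      have "E y'' y" using subD[OF ord_trans[OF yo y'(1,3)] y''(1,3)] .
      with y'' have "Q \<zeta>" unfolding Q_def by blast
      moreover have "E \<zeta> \<kappa>" using col_\<kappa>[OF y''(4,1) \<zeta>(1)] .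
      ultimately show "E \<zeta> D" using Dm \<zeta>(1) by simp
    qed
    have "D \<noteq> \<kappa>"
    proof
      assume D\<kappa>: "D = \<kappa>"
      \<comment> \<open>otherwise the image of the map under \<open>j\<close> has \<open>\<kappa>\<close> as a value below \<open>y\<close>\<close>
      have "\<forall>\<eta>\<in>N. E \<eta> \<kappa> \<longrightarrow> (\<exists>y'\<in>N. E y' Y \<and> E y' y \<and> E (pr y' \<eta>) colset)"
        using Dm colset_mem unfolding D\<kappa> Q_def by blast
      moreover have "dfn True (\<lambda>v w. \<forall>\<eta>\<in>N. E \<eta> (v 0) \<longrightarrow> (\<exists>y'\<in>N. E y' (v 1) \<and> E y' (v 2) \<and> E (pr y' \<eta>) (v 3)))"
        by (intro dfn_intros)
      ultimately have "\<forall>\<eta>\<in>N. E \<eta> (j \<kappa>) \<longrightarrow> (\<exists>y'\<in>N. E y' (j Y) \<and> E y' (j y) \<and> E (pr y' \<eta>) (j colset))"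
        using elem4[of "\<lambda>K Y y f. \<forall>\<eta>\<in>N. E \<eta> K \<longrightarrow> (\<exists>y'\<in>N. E y' Y \<and> E y' y \<and> E (pr y' \<eta>) f)",
            OF _ \<kappa>N Y(1) y colset_in] by simp
      with moved \<kappa>N obtain y' where y': "y' \<in> N" "E y' (j Y)" "E y' (j y)" "E (pr y' \<kappa>) (j colset)" by blast
      have "E y' y" using y'(3) fix_below y y\<kappa> by simp
      then have y'\<kappa>: "E y' \<kappa>" using subD[OF ord_trans[OF \<kappa> y y\<kappa>] y'(1)] by blast
      then have "j y' = y'" using fix_below y'(1) by blast
      then have "E y' Y" using j_mem[OF y'(1) Y(1)] y'(2) by simp
      with IH[OF y'(1) \<open>E y' y\<close>] obtain \<xi> where \<xi>: "\<xi> \<in> N" "col y' \<xi>" by blast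
      have \<xi>\<kappa>: "E \<xi> \<kappa>" using col_\<kappa>[OF \<xi>(2) y'(1) \<xi>(1)] .
      have "E (pr y' \<xi>) (j colset)" using jcol_mem[OF y'(1) \<xi>(1) y'\<kappa> \<xi>\<kappa>] \<xi>(2) by simp
      from jcol_fun[OF y'(1) \<kappa>N \<xi>(1) y'(4) this] \<xi>\<kappa> no_loop[OF \<kappa>N] show False by simp
    qed
    then have D\<kappa>: "E D \<kappa>" using transitive_initial_ord[OF \<kappa> DN Dsub _ Dtr] by blast
    have "col y D" unfolding col_iff[OF y DN]
    proof (intro conjI ballI impI yY D\<kappa>)
      fix y' assume y': "y' \<in> N" "E y' Y" "E y' y"
      with IH obtain \<xi> where \<xi>: "\<xi> \<in> N" "col y' \<xi>" by blast
      have "E \<xi> D" using Dm[OF \<xi>(1)] col_\<kappa>[OF \<xi>(2) y'(1) \<xi>(1)] y' \<xi>(2) unfolding Q_def by blast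
      with \<xi> show "\<exists>\<eta>\<in>N. E \<eta> D \<and> col y' \<eta>" by blast
    next
      fix \<eta> assume "\<eta> \<in> N" "E \<eta> D"
      then show "\<exists>y'\<in>N. E y' Y \<and> E y' y \<and> col y' \<eta>" using Dm unfolding Q_def by blast
    qed
    with DN show "\<exists>\<xi>\<in>N. col y \<xi>" by blast
  qed
qed

text \<open>
  If the values form a proper initial segment \<open>D\<close> of \<open>\<kappa>\<close>, then \<open>j\<close> fixes \<open>D\<close>, so \<open>\<kappa> \<in> j Y\<close> has a value in \<open>D\<close>
  under the image of the collapse. That value is also taken at an element of \<open>Y\<close>, against injectivity.
\<close>

lemma col_onto:
  assumes "\<xi> \<in> N" "E \<xi> \<kappa>" shows "\<exists>y\<in>N. col y \<xi>"
proof -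
  define Q where "Q \<eta> \<longleftrightarrow> (\<exists>y\<in>N. col y \<eta>)" for \<eta>
  have Q: "dfn False (\<lambda>v w. Q (v 0))" unfolding Q_def by (intro dfn_intros)
  define D where "D = sep \<kappa> Q"
  have DN: "D \<in> N" and Dm: "\<And>\<eta>. \<eta> \<in> N \<Longrightarrow> E \<eta> D \<longleftrightarrow> E \<eta> \<kappa> \<and> Q \<eta>"
    using sep[OF Q \<kappa>N] by (simp_all add: D_def)
  have Dsub: "sub D \<kappa>" by (rule subI) (simp add: Dm)
  have Dtr: "sub \<eta> D" if \<eta>: "\<eta> \<in> N" "E \<eta> D" for \<eta>
  proof (rule subI)
    fix \<zeta> assume \<zeta>: "\<zeta> \<in> N" "E \<zeta> \<eta>"
    from \<eta> Dm obtain y where y: "y \<in> N" "col y \<eta>" unfolding Q_def by blast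
    from col_bwd[OF y(2,1) \<eta>(1) \<zeta>] obtain y' where y': "y' \<in> N" "col y' \<zeta>" by blast
    then show "E \<zeta> D" using Dm[OF \<zeta>(1)] col_\<kappa>[OF y'(2,1) \<zeta>(1)] unfolding Q_def by blast
  qed
  have "D = \<kappa>"
  proof (rule ccontr)
    assume "D \<noteq> \<kappa>"
    then have D\<kappa>: "E D \<kappa>" using transitive_initial_ord[OF \<kappa> DN Dsub _ Dtr] by blast
    then have jD: "j D = D" using fix_below DN by blast
    \<comment> \<open>the image of this statement provides a value in \<open>D\<close> for \<open>\<kappa>\<close>\<close>
    have "\<forall>y\<in>N. E y Y \<longrightarrow> (\<exists>\<xi>\<in>N. E \<xi> D \<and> E (pr y \<xi>) colset)"
    proof (intro ballI impI)
      fix y assume y: "y \<in> N" "E y Y"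
      with col_total obtain \<xi> where \<xi>: "\<xi> \<in> N" "col y \<xi>" by blast
      have "E \<xi> D" using Dm[OF \<xi>(1)] col_\<kappa>[OF \<xi>(2) y(1) \<xi>(1)] y(1) \<xi>(2) unfolding Q_def by blast
      with \<xi> y(1) colset_mem show "\<exists>\<xi>\<in>N. E \<xi> D \<and> E (pr y \<xi>) colset" by blast
    qed
    moreover have "dfn True (\<lambda>v w. \<forall>y\<in>N. E y (v 0) \<longrightarrow> (\<exists>\<xi>\<in>N. E \<xi> (v 1) \<and> E (pr y \<xi>) (v 2)))"
      by (intro dfn_intros)
    ultimately have "\<forall>y\<in>N. E y (j Y) \<longrightarrow> (\<exists>\<xi>\<in>N. E \<xi> (j D) \<and> E (pr y \<xi>) (j colset))"
      using elem3[of "\<lambda>Y D f. \<forall>y\<in>N. E y Y \<longrightarrow> (\<exists>\<xi>\<in>N. E \<xi> D \<and> E (pr y \<xi>) f)", OF _ Y(1) DN colset_in] by simp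
    with Y(3) \<kappa>N jD obtain \<xi> where \<xi>: "\<xi> \<in> N" "E \<xi> D" "E (pr \<kappa> \<xi>) (j colset)" by auto
    from \<xi>(1,2) Dm obtain y where y: "y \<in> N" "col y \<xi>" unfolding Q_def by blast
    have y\<kappa>: "E y \<kappa>" using subD[OF Y(2) y(1) col_Y[OF y(2,1) \<xi>(1)]] .
    have "E \<xi> \<kappa>" using subD[OF Dsub \<xi>(1,2)] .
    from jcol_mem[OF y(1) \<xi>(1) y\<kappa> this] y(2) have "E (pr y \<xi>) (j colset)" by simp
    from jcol_inj[OF y(1) \<kappa>N \<xi>(1) this \<xi>(3)] y\<kappa> no_loop[OF \<kappa>N] show False by simp
  qed
  with Dm assms show ?thesis unfolding Q_def by blast
qed

lemma equipotent_\<kappa>: "equipotent_in N E Y \<kappa>"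
  unfolding equipotent_in_def
proof (rule bexI[OF _ colset_in])
  have mem: "(\<exists>p\<in>N. E p colset \<and> opair_in N E p y \<xi>) \<longleftrightarrow> col y \<xi>" if "y \<in> N" "\<xi> \<in> N" for y \<xi>
    using that colset_mem by (auto simp: opair_iff)
  show "bij_in N E colset Y \<kappa>"
    unfolding bij_in_def
  proof (intro conjI ballI impI)
    fix p assume p: "p \<in> N" "E p colset"
    then obtain y \<xi> where y: "y \<in> N" "\<xi> \<in> N" "p = pr y \<xi>" using colset_pair by blast
    then have "col y \<xi>" using p colset_mem by simp
    then have "E y Y" "E \<xi> \<kappa>" using col_Y col_\<kappa> y by blast+
    then show "\<exists>x\<in>N. \<exists>y\<in>N. E x Y \<and> E y \<kappa> \<and> opair_in N E p x y"
      using y opair_iff[OF p(1) y(1,2)] by blast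
  next
    fix y assume y: "y \<in> N" "E y Y"
    with col_total obtain \<xi> where \<xi>: "\<xi> \<in> N" "col y \<xi>" by blast
    show "\<exists>!z. z \<in> N \<and> (\<exists>p\<in>N. E p colset \<and> opair_in N E p y z)"
    proof (rule ex1I[of _ \<xi>])
      show "\<xi> \<in> N \<and> (\<exists>p\<in>N. E p colset \<and> opair_in N E p y \<xi>)" using \<xi> mem y(1) by blast
      fix z assume "z \<in> N \<and> (\<exists>p\<in>N. E p colset \<and> opair_in N E p y z)"
      then have "z \<in> N" "col y z" using mem y(1) by blast+
      with \<xi> col_fun[OF y(1)] show "z = \<xi>" by blast
    qed
  next
    fix \<xi> assume \<xi>: "\<xi> \<in> N" "E \<xi> \<kappa>"
    then obtain y where y: "y \<in> N" "col y \<xi>" using col_onto by blast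
    show "\<exists>!x. x \<in> N \<and> (\<exists>p\<in>N. E p colset \<and> opair_in N E p x \<xi>)"
    proof (rule ex1I[of _ y])
      show "y \<in> N \<and> (\<exists>p\<in>N. E p colset \<and> opair_in N E p y \<xi>)" using y mem \<xi>(1) by blast
      fix x assume "x \<in> N \<and> (\<exists>p\<in>N. E p colset \<and> opair_in N E p x \<xi>)"
      then have "x \<in> N" "col x \<xi>" using mem \<xi>(1) by blast+
      with y \<xi>(1) col_inj show "x = y" by blast
    qed
  qed
qed

end

section \<open>The critical points\<close>

text \<open>
  The parameter of the game: the codes of formulas that hold under all assignments.
\<close>

lemma valid_codes_ex:
  "\<exists>a\<in>N. j a = a \<and> (\<forall>c\<in>N. E c a \<longrightarrow> (\<forall>s\<in>N. pr c s \<in> truth)) \<and>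
     (\<forall>\<phi>. valid_in N E j \<phi> \<longrightarrow> E (cd \<phi> True) a)"
proof -
  obtain H where H: "H \<in> N" "pair_closed H" "\<forall>W\<in>N. pair_closed W \<longrightarrow> sub H W"
    using least_pair_closed_ex by blast
  define Q where "Q c \<longleftrightarrow> (\<forall>s\<in>N. pr c s \<in> truth)" for c
  have Q: "dfn False (\<lambda>v w. Q (v 0))" unfolding Q_def by (intro dfn_intros truth_class)
  define a where "a = sep H Q"
  have aN: "a \<in> N" and am: "\<And>c. c \<in> N \<Longrightarrow> E c a \<longleftrightarrow> E c H \<and> Q c"
    using sep[OF Q H(1)] by (simp_all add: a_def)
  have "sub a H" by (rule subI) (simp add: am)
  from fixes_subsets_of_least_pair_closed[OF H aN this] have "j a = a" .
  moreover have "\<forall>c\<in>N. E c a \<longrightarrow> (\<forall>s\<in>N. pr c s \<in> truth)" using am unfolding Q_def by blast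
  moreover have "E (cd \<phi> True) a" if v: "valid_in N E j \<phi>" for \<phi>
  proof -
    have "pr (cd \<phi> True) s \<in> truth" if s: "s \<in> N" for s
    proof -
      have "range (vals s) \<subseteq> N" using vals_in[OF s] by blast
      with v have "sat N E j \<phi> (vals s)" by (simp add: valid_in_def)
      then show ?thesis using truth_cd[OF s] by simp
    qed
    then show ?thesis using am[OF cd_in] pair_closed_cd[OF H(1,2)] unfolding Q_def by blast
  qed
  ultimately show ?thesis using aN by blast
qed

theorem many_critical_points:
  assumes ctbl: "countable N" and crit: "is_crit N E j \<kappa>" and moved: "E \<kappa> (j \<kappa>)"
  shows "\<exists>X\<in>N. sub X \<kappa> \<and> equipotent_in N E X \<kappa> \<and>
    (\<forall>\<mu>\<in>N. E \<mu> X \<longrightarrow> (\<exists>k \<in> N \<rightarrow> N. ZFR_model N E k \<and> is_crit N E k \<mu>))"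
proof -
  have \<kappa>: "ord_in N E \<kappa>" and j\<kappa>: "j \<kappa> \<noteq> \<kappa>" using crit by (simp_all add: is_crit_def)
  have \<kappa>N: "\<kappa> \<in> N" using \<kappa> by (rule ord_N)
  have below: "\<forall>z\<in>N. E z \<kappa> \<longrightarrow> j z = z"
  proof (intro ballI impI, rule ccontr)
    fix z assume z: "z \<in> N" "E z \<kappa>" "j z \<noteq> z"
    have "ord_in N E z" using ord_elem[OF \<kappa> z(1,2)] .
    with crit z(3) have "ord_le E \<kappa> z" by (simp add: is_crit_def)
    with z(2) no_2_loop[OF z(1) \<kappa>N] no_loop[OF \<kappa>N] show False by (auto simp: ord_le_def)
  qed
  obtain a where a: "a \<in> N" "j a = a" "\<forall>c\<in>N. E c a \<longrightarrow> (\<forall>s\<in>N. pr c s \<in> truth)"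
    "\<forall>\<phi>. valid_in N E j \<phi> \<longrightarrow> E (cd \<phi> True) a" using valid_codes_ex by blast
  note d = dfn_extends'[OF a(1)]
  define L where "L = lost (extends a)"
  have L: "L \<in> P" unfolding L_def by (rule lost_class[OF d extends_anti])
  define Q where "Q \<mu> \<longleftrightarrow> pr \<mu> (pr emp emp) \<notin> L" for \<mu>
  have Q: "dfn False (\<lambda>v w. Q (v 0))" unfolding Q_def by (intro dfn_intros L)
  define Y where "Y = sep \<kappa> Q"
  have YN: "Y \<in> N" unfolding Y_def by (rule sep(1)[OF Q \<kappa>N])
  have Ym: "E \<mu> Y \<longleftrightarrow> E \<mu> \<kappa> \<and> pr \<mu> (pr emp emp) \<notin> L" if "\<mu> \<in> N" for \<mu>
    using sep(2)[OF Q \<kappa>N that] Q_def[of \<mu>] unfolding Y_def by blast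
  have Ysub: "sub Y \<kappa>" by (rule subI) (simp add: Ym)
  have coh: "coh a \<kappa> (\<lambda>_. True) (\<lambda>z. z \<in> truth)" by (rule coh_truth[OF \<kappa>N below j\<kappa> a(3)])
  have S: "segments \<kappa> \<inter> jh L = {}"
    unfolding L_def
    by (rule self_sustaining_not_lost[OF dfn_extends extends_anti a(1,2) segments_class[OF \<kappa>N] _ d])
      (rule segments_self_sustaining[OF \<kappa>N coh])
  \<comment> \<open>otherwise the initial position of \<open>\<kappa>\<close> would be in the image of the lost positions\<close>
  have "E \<kappa> (j Y)"
  proof (rule ccontr)
    assume no: "\<not> E \<kappa> (j Y)"
    have "\<exists>t\<in>lev. \<forall>\<mu>\<in>N. E \<mu> \<kappa> \<longrightarrow> (\<exists>y\<in>N. E y t \<and> y = pr \<mu> (pr emp emp))"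
    proof (rule collection[OF _ \<kappa>N])
      show "dfn False (\<lambda>v w. v 1 = pr (v 0) (pr emp emp))" by (intro dfn_intros)
    qed simp
    then obtain g where g: "g \<in> N" "\<forall>\<mu>\<in>N. E \<mu> \<kappa> \<longrightarrow> E (pr \<mu> (pr emp emp)) g" using lev_N by blast
    note l = cap[OF L g(1)]
    have "\<forall>\<mu>\<in>N. E \<mu> \<kappa> \<longrightarrow> E \<mu> Y \<or> E (pr \<mu> (pr emp emp)) (cap L g)"
      using Ym l(2) g(2) by simp
    moreover have "dfn True (\<lambda>v w. \<forall>\<mu>\<in>N. E \<mu> (v 0) \<longrightarrow> E \<mu> (v 1) \<or> E (pr \<mu> (pr emp emp)) (v 2))"
      by (intro dfn_intros)
    ultimately have "\<forall>\<mu>\<in>N. E \<mu> (j \<kappa>) \<longrightarrow> E \<mu> (j Y) \<or> E (pr \<mu> (pr emp emp)) (j (cap L g))"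
      using elem3[of "\<lambda>K Y l. \<forall>\<mu>\<in>N. E \<mu> K \<longrightarrow> E \<mu> Y \<or> E (pr \<mu> (pr emp emp)) l", OF _ \<kappa>N YN l(1)] by simp
    with no moved \<kappa>N have "E (pr \<kappa> (pr emp emp)) (j (cap L g))" by blast
    then have "pr \<kappa> (pr emp emp) \<in> jh L" using g(1) \<kappa>N by (intro jhI) simp_all
    with S init_segment[OF \<kappa>N] show False by blast
  qed
  from equipotent_\<kappa>[OF \<kappa> below moved YN Ysub this] have eq: "equipotent_in N E Y \<kappa>" .
  show ?thesis
  proof (rule bexI[OF _ YN], intro conjI ballI impI)
    fix \<mu> assume \<mu>: "\<mu> \<in> N" "E \<mu> Y"
    then have "E \<mu> \<kappa>" "pr \<mu> (pr emp emp) \<notin> lost (extends a)" using Ym by (simp_all add: L_def)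
    from branch_embedding[OF ctbl a(1) ord_elem[OF \<kappa> \<mu>(1) this(1)] this(2)]
    obtain k where k: "k \<in> N \<rightarrow> N" "is_crit N E k \<mu>" "\<forall>\<phi>. E (cd \<phi> True) a \<longrightarrow> valid_in N E k \<phi>" by blast
    have "ZFR_model N E k"
      using ZFR_class k(1,3) a(4) unfolding ZFR_model_iff_valid by blast
    with k show "\<exists>k \<in> N \<rightarrow> N. ZFR_model N E k \<and> is_crit N E k \<mu>" by blast
  qed (rule Ysub eq)+
qed

end

theorem theorem1p1:
  fixes N :: "'a set"
    and E :: "'a \<Rightarrow> 'a \<Rightarrow> bool"
    and P :: "'a set set"
    and \<kappa> :: 'a
  assumes "ZF2_model N E P"
    and "\<kappa> \<in> N"
    and "ord_in N E \<kappa>"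
    and "super_Reinhardt N E P \<kappa>"
    and "countable N"
    and "countable P"
  shows "\<exists>X\<in>N. sub_in N E X \<kappa> \<and> equipotent_in N E X \<kappa> \<and>
           (\<forall>\<mu>\<in>N. E \<mu> X \<longrightarrow> (\<exists>j \<in> N \<rightarrow> N. ZFR_model N E j \<and> is_crit N E j \<mu>))"
proof -
  from assms(3,4) obtain j where j: "graph_in N E j \<in> P" "elementary_emb N E j" "is_crit N E j \<kappa>"
    "ord_le E \<kappa> (j \<kappa>)" unfolding super_Reinhardt_def by blast
  interpret embedding N E P j
    by unfold_locales (use assms(1) j in simp_all)
  have "E \<kappa> (j \<kappa>)" using j(3,4) by (auto simp: ord_le_def is_crit_def)
  from many_critical_points[OF assms(5) j(3) this] show ?thesis .
qed

end
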